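(* Let $f$ be an operator convex function, let $\rho$ be a strictly positive density matrix on a system $Q$, and let $\mathcal{E}_1$ and $\mathcal{E}_2$ be completely positive trace-preserving (CPTP) quantum operations, with $\mathcal{E}_2$ acting on the output of $\mathcal{E}_1$. Then $$S_f(\rho)\ \geq\ I_f(\rho,\mathcal{E}_1)\ \geq\ I_f(\rho,\mathcal{E}_2\circ\mathcal{E}_1).$$ If $f$ is non-affine and diffused, then equality holds in the first inequality, i.e. $S_f(\rho)=I_f(\rho,\mathcal{E}_1)$, if and only if there exists a CPTP quantum operation $\mathcal{E}_2$ such that $F(\rho,\mathcal{E}_2\circ\mathcal{E}_1)=1$.
   Context: All Hilbert spaces are finite-dimensional and complex. "Strictly positive" means Hermitian positive definite. For Hermitian $A$, $f(A)$ is defined by the spectral decomposition. A real function $f$ on an interval is operator convex if $f[\lambda A+(1-\lambda)B]\leq\lambda f(A)+(1-\lambda)f(B)$ for all Hermitian matrices $A,B$ (of the same, arbitrary size) with spectra in the domain of $f$ and all $0\le\lambda\le1$. Diffused: a non-affine operator convex function $f$ on $(t_0-a,t_0+a)$, $a>0$, is called diffused if it has the representation $$f(t)=b+ct+\kappa\int_{-a}^{a}\frac{(t-t_0)^2}{a^2-(t-t_0)x}\,p_X(x)\,dx$$ with $b,c\in\mathbb{R}$, $\kappa>0$ and $p_X$ a probability density function on $[-a,a]$ that is strictly positive almost everywhere on a (nondegenerate) subinterval of $[-a,a]$ having $x=0$ as an interior or boundary point. Quantum $f$-relative entropy: for strictly positive $\rho,\sigma$ on the same $d$-dimensional space, $$S_f(\rho||\sigma)=\mathrm{vec}(\sqrt{\rho})^\dagger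 f\left[\sigma\otimes(\rho^{-1})^{\mathsf T}\right]\mathrm{vec}(\sqrt{\rho})=\sum_{i,j=1}^d p_i f\left(\frac{q_j}{p_i}\right)|\langle i_\rho|j_\sigma\rangle|^2,$$ where $\rho=\sum_i p_i|i_\rho\rangle\langle i_\rho|$ and $\sigma=\sum_j q_j|j_\sigma\rangle\langle j_\sigma|$ are spectral decompositions and $\mathrm{vec}(A)$ stacks the entries of $A$ row by row. The quantum $f$-entropy is $S_f(\rho)=-S_f(\rho||\mathrm{I})=-\mathrm{Tr}[\rho f(\rho^{-1})]$. $f$-coherent information: let $|\psi_{RQ}\rangle$ be a purification of $\rho$ in a composite system $RQ$ with $\dim R=\dim Q$. The operation $\mathcal{E}_1$ is realized with an ancilla (environment) $E_1$, i.e. by an isometry $V_1$ from $Q$ to $Q'\otimes E_1'$ with $\mathcal{E}_1(\cdot)=\mathrm{Tr}_{E_1'}(V_1\cdot V_1^\dagger)$, and $\mathcal{E}_2$ is then realized similarly with an ancilla $E_2$, by an isometry from $Q'$ to $Q''\otimes E_2''$. Primes denote the systems after $\mathcal{E}_1$, double primes the systems after $\mathcal{E}_2\circ\mathcal{E}_1$ (with $R''=R'=R$ and $E_1''=E_1'$). Define $$I_f(\rho,\mathcal{E}_1)=-S_f\left(\rho_{R'E_1'}\,||\,\mathrm{I}\otimes\rho_{E_1'}\right),\qquad I_f(\rho,\mathcal{E}_2\circ\mathcal{E}_1)=-S_f\left(\rho_{R''E_1''E_2''}\,||\,\mathrm{I}\otimes\rho_{E_1''E_2''}\right),$$ where the $\rho$'s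 with subscripts are the reduced states of the global pure state and $\mathrm{I}$ is the identity on $R$. Entanglement fidelity: for a CPTP operation $\mathcal{E}$ from $Q$ to $Q$, $F(\rho,\mathcal{E})=\langle\psi_{RQ}|(\mathcal{I}_R\otimes\mathcal{E})(|\psi_{RQ}\rangle\langle\psi_{RQ}|)|\psi_{RQ}\rangle$. Standing convention: all matrices appearing as arguments of $S_f$ in an inequality or equality under consideration are assumed strictly positive (this restricts $\rho$ and the operations), and the domain of $f$ is an interval of positive reals (contained in $(0,\alpha)$ for some finite $\alpha$) containing all eigenvalue ratios $q_j/p_i$ that occur. The operation $\mathcal{E}_2$ in the equality criterion is only required to be CPTP from the output system $Q'$ of $\mathcal{E}_1$ to $Q$. *)

theory Defs
  imports
    "HOL-Analysis.Set_Integral"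
    "HOL-Analysis.Lebesgue_Measure"
    "Jordan_Normal_Form.Schur_Decomposition"
    "Jordan_Normal_Form.Spectral_Radius"
    "Jordan_Normal_Form.Gauss_Jordan_Elimination"
begin

text \<open>
  A Hilbert space of dimension \<open>n\<close> is \<open>carrier_vec n\<close> over the complex numbers.
  The product basis vector \<open>(i, k)\<close> of a tensor product of dimensions \<open>m\<close> and \<open>n\<close>
  has index \<open>i * n + k\<close>.
\<close>

section \<open>Hermitian matrices and functional calculus\<close>

definition hermitian :: "nat \<Rightarrow> complex mat \<Rightarrow> bool" where
  "hermitian n A \<longleftrightarrow> A \<in> carrier_mat n n \<and> mat_adjoint A = A"

text \<open>
  \<open>(A *\<^sub>v v) \<bullet>c v\<close> is the quadratic form of \<open>A\<close> at \<open>v\<close> (the operator \<open>\<bullet>c\<close> conjugates its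
  right argument); it is real for Hermitian \<open>A\<close>.
\<close>

definition pos_semidef :: "nat \<Rightarrow> complex mat \<Rightarrow> bool" where
  "pos_semidef n A \<longleftrightarrow> hermitian n A \<and> (\<forall>v \<in> carrier_vec n. 0 \<le> Re ((A *\<^sub>v v) \<bullet>c v))"

definition strictly_pos :: "nat \<Rightarrow> complex mat \<Rightarrow> bool" where
  "strictly_pos n A \<longleftrightarrow>
     hermitian n A \<and> (\<forall>v \<in> carrier_vec n. v \<noteq> 0\<^sub>v n \<longrightarrow> 0 < Re ((A *\<^sub>v v) \<bullet>c v))"

definition loewner_le :: "nat \<Rightarrow> complex mat \<Rightarrow> complex mat \<Rightarrow> bool" where
  "loewner_le n A B \<longleftrightarrow> pos_semidef n (B - A)"

definition spectral_decomposition ::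
    "nat \<Rightarrow> complex mat \<Rightarrow> complex mat \<Rightarrow> (nat \<Rightarrow> real) \<Rightarrow> bool" where
  "spectral_decomposition n A U l \<longleftrightarrow>
     U \<in> carrier_mat n n \<and> mat_adjoint U * U = 1\<^sub>m n \<and>
     A = U * mat_diag n (\<lambda>i. complex_of_real (l i)) * mat_adjoint U"

text \<open>
  For Hermitian \<open>A\<close> a spectral decomposition exists, and the matrix \<open>B\<close> below does not depend
  on its choice; for other \<open>A\<close> the value is unspecified.
\<close>

definition mat_fun :: "(real \<Rightarrow> real) \<Rightarrow> complex mat \<Rightarrow> complex mat" where
  "mat_fun f A = (THE B. \<exists>U l. spectral_decomposition (dim_row A) A U l \<and>
     B = U * mat_diag (dim_row A) (\<lambda>i. complex_of_real (f (l i))) * mat_adjoint U)"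

section \<open>Operator convex and diffused functions\<close>

definition operator_convex_on :: "real set \<Rightarrow> (real \<Rightarrow> real) \<Rightarrow> bool" where
  "operator_convex_on I f \<longleftrightarrow>
     (\<forall>n A B. \<forall>\<mu>\<in>{0..1::real}.
        hermitian n A \<and> hermitian n B \<and>
        spectrum A \<subseteq> complex_of_real ` I \<and> spectrum B \<subseteq> complex_of_real ` I \<longrightarrow>
        loewner_le n
          (mat_fun f (complex_of_real \<mu> \<cdot>\<^sub>m A + complex_of_real (1 - \<mu>) \<cdot>\<^sub>m B))
          (complex_of_real \<mu> \<cdot>\<^sub>m mat_fun f A + complex_of_real (1 - \<mu>) \<cdot>\<^sub>m mat_fun f B))"

definition affine_fun_on :: "real set \<Rightarrow> (real \<Rightarrow> real) \<Rightarrow> bool" where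
  "affine_fun_on I f \<longleftrightarrow> (\<exists>b c. \<forall>t\<in>I. f t = b + c * t)"

definition prob_density_on :: "real set \<Rightarrow> (real \<Rightarrow> real) \<Rightarrow> bool" where
  "prob_density_on S p \<longleftrightarrow>
     (\<forall>x\<in>S. 0 \<le> p x) \<and> set_integrable lborel S p \<and> (LINT x:S|lborel. p x) = 1"

text \<open>The domain \<open>I\<close> of a diffused function is the whole open interval of radius \<open>a\<close> around \<open>t0\<close>.\<close>

definition diffused_on :: "real set \<Rightarrow> (real \<Rightarrow> real) \<Rightarrow> bool" where
  "diffused_on I f \<longleftrightarrow>
     \<not> affine_fun_on I f \<and> operator_convex_on I f \<and>
     (\<exists>t0 a. 0 < a \<and> I = {t0 - a<..<t0 + a} \<and>
       (\<exists>b c \<kappa> p. 0 < \<kappa> \<and> prob_density_on {-a..a} p \<and>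
          (\<exists>u v. u < v \<and> {u..v} \<subseteq> {-a..a} \<and> 0 \<in> {u..v} \<and>
             (AE x in lborel. x \<in> {u..v} \<longrightarrow> 0 < p x)) \<and>
          (\<forall>t\<in>I. f t = b + c * t +
             \<kappa> * (LINT x:{-a..a}|lborel. (t - t0)\<^sup>2 / (a\<^sup>2 - (t - t0) * x) * p x))))"

section \<open>Composite systems\<close>

definition kron :: "complex mat \<Rightarrow> complex mat \<Rightarrow> complex mat" where
  "kron A B = Matrix.mat (dim_row A * dim_row B) (dim_col A * dim_col B)
     (\<lambda>(i, j). A $$ (i div dim_row B, j div dim_col B) * B $$ (i mod dim_row B, j mod dim_col B))"

definition vec_rows :: "complex mat \<Rightarrow> complex Matrix.vec" where
  "vec_rows A = Matrix.vec (dim_row A * dim_col A) (\<lambda>k. A $$ (k div dim_col A, k mod dim_col A))"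

definition mat_trace :: "complex mat \<Rightarrow> complex" where
  "mat_trace A = (\<Sum>i<dim_row A. A $$ (i, i))"

definition ket_bra :: "complex Matrix.vec \<Rightarrow> complex mat" where
  "ket_bra v = Matrix.mat (dim_vec v) (dim_vec v)
     (\<lambda>(i, j). vec_index v i * cnj (vec_index v j))"

text \<open>Partial traces over the first and over the second factor of dimensions \<open>m\<close> and \<open>n\<close>.\<close>

definition ptrace1 :: "nat \<Rightarrow> nat \<Rightarrow> complex mat \<Rightarrow> complex mat" where
  "ptrace1 m n A = Matrix.mat n n (\<lambda>(i, j). \<Sum>k<m. A $$ (k * n + i, k * n + j))"

definition ptrace2 :: "nat \<Rightarrow> nat \<Rightarrow> complex mat \<Rightarrow> complex mat" where
  "ptrace2 m n A = Matrix.mat m m (\<lambda>(i, j). \<Sum>k<n. A $$ (i * n + k, j * n + k))"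

text \<open>
  \<open>ampliation k m n E\<close> is the tensor product of the identity map on \<open>k\<close> by \<open>k\<close> matrices with a
  linear map \<open>E\<close> from \<open>m\<close> by \<open>m\<close> to \<open>n\<close> by \<open>n\<close> matrices: \<open>E\<close> is applied to each
  \<open>m\<close> by \<open>m\<close> block.
\<close>

definition ampliation ::
    "nat \<Rightarrow> nat \<Rightarrow> nat \<Rightarrow> (complex mat \<Rightarrow> complex mat) \<Rightarrow> complex mat \<Rightarrow> complex mat" where
  "ampliation k m n E X = Matrix.mat (k * n) (k * n)
     (\<lambda>(i, j). E (Matrix.mat m m (\<lambda>(r, s). X $$ ((i div n) * m + r, (j div n) * m + s)))
                 $$ (i mod n, j mod n))"

section \<open>States and operations\<close>

definition density_matrix :: "nat \<Rightarrow> complex mat \<Rightarrow> bool" where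
  "density_matrix n A \<longleftrightarrow> pos_semidef n A \<and> mat_trace A = 1"

definition cptp :: "nat \<Rightarrow> nat \<Rightarrow> (complex mat \<Rightarrow> complex mat) \<Rightarrow> bool" where
  "cptp m n E \<longleftrightarrow>
     (\<forall>X\<in>carrier_mat m m. E X \<in> carrier_mat n n) \<and>
     (\<forall>X\<in>carrier_mat m m. \<forall>Y\<in>carrier_mat m m. E (X + Y) = E X + E Y) \<and>
     (\<forall>c. \<forall>X\<in>carrier_mat m m. E (c \<cdot>\<^sub>m X) = c \<cdot>\<^sub>m E X) \<and>
     (\<forall>X\<in>carrier_mat m m. mat_trace (E X) = mat_trace X) \<and>
     (\<forall>k X. pos_semidef (k * m) X \<longrightarrow> pos_semidef (k * n) (ampliation k m n E X))"

text \<open>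
  The isometry \<open>V\<close> from dimension \<open>m\<close> to output dimension \<open>n\<close> times environment dimension \<open>e\<close>
  realizes the operation \<open>E\<close>.
\<close>

definition realizes ::
    "nat \<Rightarrow> nat \<Rightarrow> nat \<Rightarrow> complex mat \<Rightarrow> (complex mat \<Rightarrow> complex mat) \<Rightarrow> bool" where
  "realizes m n e V E \<longleftrightarrow>
     V \<in> carrier_mat (n * e) m \<and> mat_adjoint V * V = 1\<^sub>m m \<and>
     (\<forall>X\<in>carrier_mat m m. E X = ptrace2 n e (V * X * mat_adjoint V))"

text \<open>
  \<open>\<psi>\<close> is a vector of the composite of the reference \<open>R\<close> (first factor) and \<open>Q\<close>, both of
  dimension \<open>d\<close>.
\<close>

definition purification :: "nat \<Rightarrow> complex Matrix.vec \<Rightarrow> complex mat \<Rightarrow> bool" where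
  "purification d \<psi> \<rho> \<longleftrightarrow> \<psi> \<in> carrier_vec (d * d) \<and> ptrace1 d d (ket_bra \<psi>) = \<rho>"

definition entanglement_fidelity ::
    "nat \<Rightarrow> complex Matrix.vec \<Rightarrow> (complex mat \<Rightarrow> complex mat) \<Rightarrow> real" where
  "entanglement_fidelity d \<psi> E = Re ((ampliation d d d E (ket_bra \<psi>) *\<^sub>v \<psi>) \<bullet>c \<psi>)"

section \<open>Entropic quantities\<close>

definition f_rel_entropy :: "(real \<Rightarrow> real) \<Rightarrow> complex mat \<Rightarrow> complex mat \<Rightarrow> real" where
  "f_rel_entropy f \<rho> \<sigma> =
     Re ((mat_fun f (kron \<sigma> (transpose_mat (the (mat_inverse \<rho>)))) *\<^sub>v vec_rows (mat_fun sqrt \<rho>))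
           \<bullet>c vec_rows (mat_fun sqrt \<rho>))"

definition f_entropy :: "(real \<Rightarrow> real) \<Rightarrow> complex mat \<Rightarrow> real" where
  "f_entropy f \<rho> = - f_rel_entropy f \<rho> (1\<^sub>m (dim_row \<rho>))"

text \<open>
  The standing convention for arguments of the relative entropy: both are strictly positive and
  the domain \<open>I\<close> of the function contains all ratios of their eigenvalues.
\<close>

definition admissible :: "real set \<Rightarrow> nat \<Rightarrow> complex mat \<Rightarrow> complex mat \<Rightarrow> bool" where
  "admissible I n \<rho> \<sigma> \<longleftrightarrow> strictly_pos n \<rho> \<and> strictly_pos n \<sigma> \<and>
     (\<forall>p q. eigenvalue \<rho> (complex_of_real p) \<and> eigenvalue \<sigma> (complex_of_real q) \<longrightarrow> q / p \<in> I)"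

text \<open>
  Let \<open>V\<close> be an isometry from \<open>Q\<close> (dimension \<open>d\<close>) to output dimension \<open>n\<close> times environment
  dimension \<open>e\<close>. It is applied to the \<open>Q\<close> part of \<open>\<psi>\<close>; \<open>state_RE\<close> and \<open>state_E\<close> are the
  reduced states of the resulting pure state on reference and environment, and on the environment.
\<close>

definition state_RE ::
    "nat \<Rightarrow> nat \<Rightarrow> nat \<Rightarrow> complex Matrix.vec \<Rightarrow> complex mat \<Rightarrow> complex mat" where
  "state_RE d n e \<psi> V =
     ampliation d (n * e) e (ptrace1 n e) (ket_bra (kron (1\<^sub>m d) V *\<^sub>v \<psi>))"

definition state_E ::
    "nat \<Rightarrow> nat \<Rightarrow> nat \<Rightarrow> complex Matrix.vec \<Rightarrow> complex mat \<Rightarrow> complex mat" where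
  "state_E d n e \<psi> V = ptrace1 d e (state_RE d n e \<psi> V)"

definition f_coherent_info ::
    "(real \<Rightarrow> real) \<Rightarrow> nat \<Rightarrow> nat \<Rightarrow> nat \<Rightarrow> complex Matrix.vec \<Rightarrow> complex mat \<Rightarrow> real" where
  "f_coherent_info f d n e \<psi> V =
     - f_rel_entropy f (state_RE d n e \<psi> V) (kron (1\<^sub>m d) (state_E d n e \<psi> V))"

definition coherent_admissible ::
    "real set \<Rightarrow> nat \<Rightarrow> nat \<Rightarrow> nat \<Rightarrow> complex Matrix.vec \<Rightarrow> complex mat \<Rightarrow> bool" where
  "coherent_admissible I d n e \<psi> V \<longleftrightarrow>
     admissible I (d * e) (state_RE d n e \<psi> V) (kron (1\<^sub>m d) (state_E d n e \<psi> V))"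

text \<open>
  An operation realized by \<open>V1\<close> with environment dimension \<open>e1\<close>, followed by one realized by
  \<open>V2\<close> with environment dimension \<open>e2\<close>. The environment of the composite is the second
  environment tensor the first one, of dimension \<open>e2 * e1\<close>; exchanging the two factors is a
  unitary change of basis and does not affect entropic quantities.
\<close>

definition compose_isometry :: "nat \<Rightarrow> complex mat \<Rightarrow> complex mat \<Rightarrow> complex mat" where
  "compose_isometry e1 V2 V1 = kron V2 (1\<^sub>m e1) * V1"

end

theory Submission
  imports Defs
begin

text \<open>
  With an isometry \<open>W\<close>, operator convexity gives Jensen's inequality \<open>f (W\<^sup>* A W) \<le> W\<^sup>* f A W\<close>. For the
  relative modular operators of a pair of states and of their partial traces there is such a \<open>W\<close> (Petz) that
  maps \<open>vec \<surd>\<rho>'\<close> of the reduced state to \<open>vec \<surd>\<rho>\<close>, so the relative entropy decreases under partial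
  traces. Tracing out the environment of \<open>E1\<close>, respectively of \<open>E2\<close>, yields the two inequalities, since the
  reduced state of the reference has the spectrum of \<open>\<rho>\<close>.

  Equality for a diffused \<open>f\<close> forces equality for resolvents \<open>1 / (a\<^sup>2 - x (t - t0))\<close> with \<open>x\<close> arbitrarily
  close to \<open>0\<close>, hence \<open>W\<close> intertwines the modular operators on \<open>vec \<surd>\<rho>'\<close>. For reference and environment this says
  that their joint state is a product, which in terms of the Kraus operators of \<open>E1\<close> is
  the Knill-Laflamme condition and so is equivalent to the existence of a recovery operation.
\<close>

subsection \<open>Matrices over the complex numbers\<close>

text \<open>The two inequalities differ only in the tensor factor that is removed: the whole
  environment, or the middle factor of reference \<otimes> second environment \<otimes> first
  environment. Hence partial traces are treated abstractly. The second argument, identity \<otimes>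
  environment state, reduces to the identity because the environment state has trace one. Equality
  cannot be exploited at \<open>x = 0\<close> itself: there the kernel is a quadratic function and
  not a resolvent, and the density is positive only almost everywhere. Nearby parameters give
  relations that are continuous in \<open>x\<close>, and at \<open>0\<close> every resolvent becomes
  the constant \<open>1 / a\<^sup>2\<close>. The intertwining relation obtained in this way says
  that \<sigma> is \<rho> multiplied from the left by the lift of \<sigma>' times the inverse of
  \<rho>', the primes marking reduced matrices. For reference and environment \<sigma>' is the
  identity, and the relation becomes the product form of the joint state. The blocks of this state
  see the channel only through the products \<open>adj (K l) * K k\<close>. Strict positivity of
  \<rho> allows the purification to be cancelled around them.\<close>

abbreviation adj :: "complex mat \<Rightarrow> complex mat" where
  "adj \<equiv> mat_adjoint"

abbreviation real_diag :: "nat \<Rightarrow> (nat \<Rightarrow> real) \<Rightarrow> complex mat" where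
  "real_diag n l \<equiv> mat_diag n (\<lambda>i. complex_of_real (l i))"

lemma eq_mat_dimI:
  assumes "\<And>i j. i < n \<Longrightarrow> j < m \<Longrightarrow> A $$ (i, j) = B $$ (i, j)"
    and "dim_row A = n" "dim_row B = n" "dim_col A = m" "dim_col B = m"
  shows "A = B"
  by (rule eq_matI) (use assms in auto)

lemma adj_dim [simp]:
  "dim_row (adj A) = dim_col A" "dim_col (adj A) = dim_row A"
  by (simp_all add: mat_adjoint_def)

lemma adj_carrier [simp]: "A \<in> carrier_mat n m \<Longrightarrow> adj A \<in> carrier_mat m n"
  by (auto simp: mat_adjoint_def)

lemma adj_index [simp]:
  "i < dim_col A \<Longrightarrow> j < dim_row A \<Longrightarrow> adj A $$ (i, j) = cnj (A $$ (j, i))"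
  by (simp add: mat_adjoint_def mat_of_rows_def)

lemma mult_mat_index:
  "i < dim_row A \<Longrightarrow> j < dim_col B \<Longrightarrow> dim_col A = dim_row B \<Longrightarrow>
    (A * B) $$ (i, j) = (\<Sum>k<dim_row B. A $$ (i, k) * B $$ (k, j))"
  by (simp add: scalar_prod_def lessThan_atLeast0)

lemma mult_vec_index:
  "i < dim_row A \<Longrightarrow> dim_col A = dim_vec v \<Longrightarrow>
    vec_index (A *\<^sub>v v) i = (\<Sum>k<dim_vec v. A $$ (i, k) * vec_index v k)"
  by (simp add: scalar_prod_def lessThan_atLeast0)

lemma cscalar_prod_sum:
  "dim_vec v = dim_vec w \<Longrightarrow> v \<bullet>c w = (\<Sum>k<dim_vec w. vec_index v k * cnj (vec_index w k))"
  by (simp add: scalar_prod_def lessThan_atLeast0)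

text \<open>Entries of products stay folded until \<open>mult_mat_index\<close> or
  \<open>mult_vec_index\<close> is requested, so that sums appear only where an entrywise argument
  is intended.\<close>

declare index_mult_mat(1) [simp del] index_mult_mat_vec [simp del]

text \<open>Dimension equations replace carrier memberships here and in the algebraic laws below,
  because the simplifier can discharge them for compound matrices.\<close>

lemma mult_mat_assoc:
  fixes A B C :: "complex mat"
  shows "dim_col A = dim_row B \<Longrightarrow> dim_col B = dim_row C \<Longrightarrow> A * B * C = A * (B * C)"
  by (metis assoc_mult_mat carrier_matI)

lemma mult_mat_vec_assoc:
  fixes A B :: "complex mat"
  shows "dim_col A = dim_row B \<Longrightarrow> dim_col B = dim_vec v \<Longrightarrow> A * B *\<^sub>v v = A *\<^sub>v (B *\<^sub>v v)"
  by (metis assoc_mult_mat_vec carrier_matI carrier_vec_dim_vec)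

lemma one_mult_mat_dim [simp]:
  fixes A :: "complex mat"
  shows "dim_row A = n \<Longrightarrow> 1\<^sub>m n * A = A" "dim_col A = n \<Longrightarrow> A * 1\<^sub>m n = A"
  by auto

lemma one_mult_vec_dim [simp]:
  fixes v :: "complex Matrix.vec"
  shows "dim_vec v = n \<Longrightarrow> 1\<^sub>m n *\<^sub>v v = v"
  by auto

lemma adj_mult:
  "dim_col A = dim_row B \<Longrightarrow> adj (A * B) = adj B * adj (A :: complex mat)"
  by (rule eq_matI) (auto simp: mult_mat_index mult.commute)

lemma adj_adjoint [simp]: "adj (adj A) = (A :: complex mat)"
  by (rule eq_matI) auto

lemma adj_one [simp]: "adj (1\<^sub>m n) = (1\<^sub>m n :: complex mat)"
  by (rule eq_matI) auto

lemma mat_diag_index [simp]: "i < n \<Longrightarrow> j < n \<Longrightarrow> mat_diag n f $$ (i, j) = (if i = j then f j else 0)"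
  by (simp add: mat_diag_def)

lemma mat_diag_dims [simp]: "dim_row (mat_diag n f) = n" "dim_col (mat_diag n f) = n"
  by (simp_all add: mat_diag_def)

lemma adj_diag [simp]: "adj (mat_diag n f) = mat_diag n (\<lambda>i. cnj (f i))"
  by (rule eq_matI) auto

lemma mat_diag_mult_index:
  fixes A :: "complex mat"
  shows "dim_row A = n \<Longrightarrow> i < n \<Longrightarrow> j < dim_col A \<Longrightarrow> (mat_diag n f * A) $$ (i, j) = f i * A $$ (i, j)"
    "dim_col A = n \<Longrightarrow> i < dim_row A \<Longrightarrow> j < n \<Longrightarrow> (A * mat_diag n f) $$ (i, j) = A $$ (i, j) * f j"
  by (subst mat_diag_mult_left[of _ _ "dim_col A"], auto)
    (subst mat_diag_mult_right[of _ "dim_row A"], auto)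

lemma mat_diag_vec_index:
  fixes v :: "complex Matrix.vec"
  assumes "dim_vec v = n" "i < n"
  shows "vec_index (mat_diag n f *\<^sub>v v) i = f i * vec_index v i"
proof -
  have "vec_index (mat_diag n f *\<^sub>v v) i = (\<Sum>k<n. if i = k then f k * vec_index v k else 0)"
    using assms by (subst mult_vec_index) (auto intro: sum.cong simp del: sum.delta sum.delta')
  then show ?thesis using assms by simp
qed

lemma left_inverse_imp_right_inverse:
  fixes A B :: "complex mat"
  assumes "A * B = 1\<^sub>m n" "A \<in> carrier_mat n n" "B \<in> carrier_mat n n"
  shows "B * A = 1\<^sub>m n"
  using assms mat_mult_left_right_inverse by blast

lemma cscalar_prod_adjoint:
  fixes A :: "complex mat"
  assumes "dim_vec v = dim_col A" "dim_vec w = dim_row A"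
  shows "(A *\<^sub>v v) \<bullet>c w = v \<bullet>c (adj A *\<^sub>v w)"
proof -
  have "(A *\<^sub>v v) \<bullet>c w = (\<Sum>i<dim_row A. \<Sum>k<dim_col A. A $$ (i, k) * vec_index v k * cnj (vec_index w i))"
    using assms by (simp add: cscalar_prod_sum mult_vec_index sum_distrib_right)
  also have "\<dots> = (\<Sum>k<dim_col A. \<Sum>i<dim_row A. A $$ (i, k) * vec_index v k * cnj (vec_index w i))"
    by (rule sum.swap)
  also have "\<dots> = v \<bullet>c (adj A *\<^sub>v w)"
    using assms by (simp add: cscalar_prod_sum mult_vec_index sum_distrib_left ac_simps)
  finally show ?thesis .
qed

lemma cscalar_prod_commute:
  fixes v w :: "complex Matrix.vec"
  shows "dim_vec v = dim_vec w \<Longrightarrow> w \<bullet>c v = cnj (v \<bullet>c w)"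
  by (simp add: cscalar_prod_sum mult.commute)

lemma cscalar_prod_diff:
  fixes u v w :: "complex Matrix.vec"
  assumes "dim_vec u = dim_vec w" "dim_vec v = dim_vec w"
  shows "(u - v) \<bullet>c w = u \<bullet>c w - v \<bullet>c w" "w \<bullet>c (u - v) = w \<bullet>c u - w \<bullet>c v"
  using assms by (simp_all add: cscalar_prod_sum algebra_simps sum_subtractf)

lemma cscalar_prod_self:
  fixes v :: "complex Matrix.vec"
  shows "v \<bullet>c v = complex_of_real (\<Sum>k<dim_vec v. (cmod (vec_index v k))\<^sup>2)"
  by (simp only: cscalar_prod_sum complex_norm_square of_real_sum)

lemma mult_unit_vec_index:
  fixes A :: "complex mat"
  assumes "i < dim_row A" "j < n" "dim_col A = n"
  shows "vec_index (A *\<^sub>v unit_vec n j) i = A $$ (i, j)"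
proof -
  have "vec_index (A *\<^sub>v unit_vec n j) i = (\<Sum>k<n. if k = j then A $$ (i, k) else 0)"
    using assms by (subst mult_vec_index) (auto intro: sum.cong simp del: sum.delta sum.delta')
  then show ?thesis using assms by simp
qed

lemma mult_mat_vec_smult:
  fixes v :: "complex Matrix.vec"
  shows "dim_col A = dim_vec v \<Longrightarrow> A *\<^sub>v (c \<cdot>\<^sub>v v) = c \<cdot>\<^sub>v (A *\<^sub>v v)"
  by (rule eq_vecI) (simp_all add: mult_vec_index sum_distrib_left mult.left_commute)

subsection \<open>The spectral theorem\<close>

lemma spectral_decompositionD:
  assumes "spectral_decomposition n A U l"
  shows "U \<in> carrier_mat n n" "dim_row U = n" "dim_col U = n" "dim_row A = n" "dim_col A = n"
    "adj U * U = 1\<^sub>m n" "U * adj U = 1\<^sub>m n"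
    "A = U * real_diag n l * adj U"
proof -
  show U: "U \<in> carrier_mat n n" and "adj U * U = 1\<^sub>m n"
    and "A = U * real_diag n l * adj U"
    using assms unfolding spectral_decomposition_def by blast+
  then show "U * adj U = 1\<^sub>m n"
    by (auto intro: left_inverse_imp_right_inverse[of "adj U"])
  show "dim_row U = n" "dim_col U = n" using U by auto
  then show "dim_row A = n" "dim_col A = n"
    unfolding \<open>A = _\<close> by auto
qed

lemma spectral_decomposition_hermitian:
  assumes "spectral_decomposition n A U l"
  shows "hermitian n A"
proof -
  note S = spectral_decompositionD[OF assms]
  have "adj A = A"
    by (simp add: S(8) adj_mult mult_mat_assoc S(2,3))
  then show ?thesis using S(4,5) by (auto simp: hermitian_def)
qed

text \<open>A reflection that carries the first coordinate axis to the line of \<open>v\<close>. It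
  serves to split off an eigenvector; being Hermitian and an involution, it is its own adjoint and
  inverse.\<close>

lemma householder:
  fixes v :: "complex Matrix.vec"
  assumes "dim_vec v = Suc n" "v \<noteq> 0\<^sub>v (Suc n)"
  shows "\<exists>H c. H \<in> carrier_mat (Suc n) (Suc n) \<and> adj H = H \<and> H * H = 1\<^sub>m (Suc n) \<and>
    c \<noteq> 0 \<and> H *\<^sub>v unit_vec (Suc n) 0 = c \<cdot>\<^sub>v v"
proof -
  define N where "N = (\<Sum>k<Suc n. (cmod (vec_index v k))\<^sup>2)"
  \<comment> \<open>The phase of the first entry, with the default 1 if that entry vanishes, so that
    \<open>s\<close> has modulus one in any case.\<close>
  define s where "s = (if vec_index v 0 = 0 then 1 else sgn (vec_index v 0))"
  have N: "N > 0"
  proof -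
    obtain k where "k < Suc n" "vec_index v k \<noteq> 0"
      using assms by (metis eq_vecI index_zero_vec(1) index_zero_vec(2))
    then show ?thesis unfolding N_def
      by (intro sum_pos2[of _ k]) auto
  qed
  have s: "s * cnj s = 1"
    by (auto simp: s_def sgn_div_norm complex_norm_square[symmetric] power2_eq_square field_simps simp flip: of_real_mult)
  have vs: "vec_index v 0 = of_real (cmod (vec_index v 0)) * s"
    by (simp add: s_def sgn_div_norm scaleR_conv_of_real)
  define r where "r = cmod (vec_index v 0)"
  \<comment> \<open>The normal vector of the mirror. Both contributions to its first entry have
    phase \<open>s\<close> and cannot cancel; its square norm is \<open>2 * M\<close>, so dividing
    by \<open>M\<close> in \<open>H\<close> gives the reflection along \<open>w\<close>.\<close>
  define w where "w = (\<lambda>k. vec_index v k + (if k = 0 then of_real (sqrt N) * s else 0))"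
  define M where "M = N + sqrt N * r"
  have M: "M > 0" using N by (auto simp: M_def r_def add_pos_nonneg)
  have ww: "(\<Sum>k<Suc n. w k * cnj (w k)) = of_real (2 * M)"
  proof -
    have "(\<Sum>k<Suc n. w k * cnj (w k)) = w 0 * cnj (w 0) + (\<Sum>k<n. vec_index v (Suc k) * cnj (vec_index v (Suc k)))"
      by (simp add: sum.lessThan_Suc_shift w_def del: sum.lessThan_Suc)
    also have "w 0 = (r + sqrt N) * s"
      by (simp add: w_def algebra_simps vs[folded r_def])
    also have "(r + sqrt N) * s * cnj ((r + sqrt N) * s) = of_real ((r + sqrt N)^2)"
      using s by (simp add: power2_eq_square ac_simps)
    also have "(\<Sum>k<n. vec_index v (Suc k) * cnj (vec_index v (Suc k))) = of_real (N - r^2)"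
      by (simp add: N_def r_def sum.lessThan_Suc_shift complex_norm_square[symmetric] del: sum.lessThan_Suc)
    finally have "(\<Sum>k<Suc n. w k * cnj (w k)) = of_real ((r + sqrt N)^2 + (N - r^2))"
      by (simp only: of_real_add)
    also have "(r + sqrt N)^2 + (N - r^2) = 2 * M"
      using N by (simp add: M_def power2_eq_square algebra_simps)
    finally show ?thesis .
  qed
  define H where "H = Matrix.mat (Suc n) (Suc n) (\<lambda>(i, j). (if i = j then 1 else 0) - w i * cnj (w j) / of_real M)"
  have H: "H \<in> carrier_mat (Suc n) (Suc n)" by (simp add: H_def)
  have Hi: "H $$ (i, j) = (if i = j then 1 else 0) - w i * cnj (w j) / of_real M" if "i < Suc n" "j < Suc n" for i j
    using that by (simp add: H_def)
  have "adj H = H"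
    by (rule eq_matI) (use H in \<open>auto simp: H_def\<close>)
  moreover have "H * H = 1\<^sub>m (Suc n)"
  proof (rule eq_mat_dimI[of "Suc n" "Suc n"])
    fix i j assume ij: "i < Suc n" "j < Suc n"
    have "(H * H) $$ (i, j) = (\<Sum>k<Suc n. H $$ (i, k) * H $$ (k, j))"
      using H ij by (subst mult_mat_index) auto
    also have "\<dots> = (\<Sum>k<Suc n. (if k = i then (if i = j then 1 else 0) - w i * cnj (w j) / of_real M else 0)
        - (if k = j then w i * cnj (w j) / of_real M else 0)
        + w i * cnj (w j) / (of_real M)^2 * (w k * cnj (w k)))"
      using ij by (intro sum.cong) (auto simp: Hi algebra_simps power2_eq_square)
    also have "\<dots> = (if i = j then 1 else 0) - w i * cnj (w j) / of_real M - w i * cnj (w j) / of_real M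
        + w i * cnj (w j) / (of_real M)^2 * of_real (2 * M)"
      unfolding sum.distrib sum_subtractf sum_distrib_left[symmetric] ww
      using ij by (simp del: sum.lessThan_Suc)
    also have "\<dots> = (if i = j then 1 else 0)"
      using M by (simp add: power2_eq_square)
    finally show "(H * H) $$ (i, j) = (1\<^sub>m (Suc n) :: complex mat) $$ (i, j)" using ij by simp
  qed (use H in auto)
  moreover have "H *\<^sub>v unit_vec (Suc n) 0 = (- cnj s / of_real (sqrt N)) \<cdot>\<^sub>v v"
  proof (rule eq_vecI)
    fix i assume "i < dim_vec ((- cnj s / of_real (sqrt N)) \<cdot>\<^sub>v v)"
    then have i: "i < Suc n" using assms by simp
    have "vec_index (H *\<^sub>v unit_vec (Suc n) 0) i = H $$ (i, 0)"
      using H i by (intro mult_unit_vec_index) auto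
    also have "\<dots> = (if i = 0 then 1 else 0) - w i * cnj (w 0) / of_real M"
      using i by (simp add: Hi)
    also have "cnj (w 0) = of_real (r + sqrt N) * cnj s"
      by (simp add: w_def algebra_simps) (subst vs, simp add: r_def)
    \<comment> \<open>The factor \<open>r + sqrt N\<close> is common to \<open>cnj (w 0)\<close> and
      \<open>M\<close>; once it cancels, the first column of \<open>H\<close> is a multiple of
      \<open>v\<close>.\<close>
    also have "M = sqrt N * (r + sqrt N)"
      using N by (simp add: M_def algebra_simps)
    also have "w i * (of_real (r + sqrt N) * cnj s) / of_real (sqrt N * (r + sqrt N)) = w i * cnj s / of_real (sqrt N)"
    proof -
      have "r + sqrt N > 0" using N by (simp add: r_def add_nonneg_pos)
      then have "complex_of_real (r + sqrt N) \<noteq> 0" by (metis less_irrefl of_real_eq_0_iff)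
      moreover have "w i * (of_real (r + sqrt N) * cnj s) = w i * cnj s * of_real (r + sqrt N)"
        by (simp only: ac_simps)
      ultimately show ?thesis
        by (simp only: of_real_mult nonzero_mult_divide_mult_cancel_right not_False_eq_True)
    qed
    also have "(if i = 0 then 1 else 0) - w i * cnj s / of_real (sqrt N) = - cnj s / of_real (sqrt N) * vec_index v i"
      using N s by (simp add: w_def algebra_simps add_divide_distrib)
    finally show "vec_index (H *\<^sub>v unit_vec (Suc n) 0) i = vec_index ((- cnj s / of_real (sqrt N)) \<cdot>\<^sub>v v) i"
      using i assms by simp
  qed (use H assms in auto)
  moreover have "- cnj s / of_real (sqrt N) \<noteq> 0" using s N by auto
  ultimately show ?thesis using H by blast
qed

text \<open>The direct sum of a scalar and a matrix: the shape of a Hermitian matrix whose first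
  basis vector is an eigenvector.\<close>

definition block1 :: "complex \<Rightarrow> complex mat \<Rightarrow> complex mat" where
  "block1 c M = Matrix.mat (Suc (dim_row M)) (Suc (dim_col M))
     (\<lambda>(i, j). if i = 0 \<and> j = 0 then c else if i = 0 \<or> j = 0 then 0 else M $$ (i - 1, j - 1))"

lemma block1_dim [simp]:
  "dim_row (block1 c M) = Suc (dim_row M)" "dim_col (block1 c M) = Suc (dim_col M)"
  by (simp_all add: block1_def)

lemma block1_index [simp]:
  "block1 c M $$ (0, 0) = c"
  "j < dim_col M \<Longrightarrow> block1 c M $$ (0, Suc j) = 0"
  "i < dim_row M \<Longrightarrow> block1 c M $$ (Suc i, 0) = 0"
  "i < dim_row M \<Longrightarrow> j < dim_col M \<Longrightarrow> block1 c M $$ (Suc i, Suc j) = M $$ (i, j)"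
  by (simp_all add: block1_def)

lemma eq_mat_SucI:
  assumes "dim_row A = Suc n" "dim_row B = Suc n" "dim_col A = Suc m" "dim_col B = Suc m"
    "A $$ (0, 0) = B $$ (0, 0)"
    "\<And>i. i < n \<Longrightarrow> A $$ (Suc i, 0) = B $$ (Suc i, 0)"
    "\<And>j. j < m \<Longrightarrow> A $$ (0, Suc j) = B $$ (0, Suc j)"
    "\<And>i j. i < n \<Longrightarrow> j < m \<Longrightarrow> A $$ (Suc i, Suc j) = B $$ (Suc i, Suc j)"
  shows "A = B"
proof (rule eq_matI)
  fix i j assume "i < dim_row B" "j < dim_col B"
  then show "A $$ (i, j) = B $$ (i, j)"
    using assms by (cases i; cases j) auto
qed (use assms in auto)

lemma block1_mult:
  assumes "dim_col M = dim_row N"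
  shows "block1 a M * block1 b N = block1 (a * b) (M * N)"
  by (rule eq_mat_SucI[of _ "dim_row M" _ "dim_col N"])
    (use assms in \<open>simp_all add: mult_mat_index sum.lessThan_Suc_shift del: sum.lessThan_Suc\<close>)

lemma block1_adjoint: "adj (block1 a M) = block1 (cnj a) (adj M)"
  by (rule eq_mat_SucI[of _ "dim_col M" _ "dim_row M"]) simp_all

lemma block1_one: "block1 1 (1\<^sub>m n) = 1\<^sub>m (Suc n)"
  by (rule eq_mat_SucI[of _ n _ n]) simp_all

lemma block1_diag: "block1 (f 0) (mat_diag n (\<lambda>i. f (Suc i))) = mat_diag (Suc n) f"
  by (rule eq_mat_SucI[of _ n _ n]) simp_all

lemma hermitianD:
  assumes "hermitian n A"
  shows "dim_row A = n" "dim_col A = n" "adj A = A"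
  using assms by (auto simp: hermitian_def)

lemma hermitian_conj:
  assumes "hermitian n A" "dim_row H = n"
  shows "hermitian (dim_col H) (adj H * A * H)"
  using assms(2) hermitianD[OF assms(1)]
  by (auto simp: hermitian_def adj_mult mult_mat_assoc)

lemma spectral_decomposition_conj:
  assumes "spectral_decomposition n A U l" "H \<in> carrier_mat n n" "adj H * H = 1\<^sub>m n"
  shows "spectral_decomposition n (H * A * adj H) (H * U) l"
proof -
  note S = spectral_decompositionD[OF assms(1)]
  have H: "dim_row H = n" "dim_col H = n" using assms(2) by auto
  have "adj (H * U) * (H * U) = adj U * (adj H * H) * U"
    by (simp add: S(2,3) H adj_mult mult_mat_assoc)
  then have "adj (H * U) * (H * U) = 1\<^sub>m n"
    using S(2,3,6) assms(3) by simp
  moreover have "H * A * adj H =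
      H * U * real_diag n l * adj (H * U)"
    unfolding S(8) by (simp add: S(2,3) H adj_mult mult_mat_assoc)
  ultimately show ?thesis
    using S(1) assms(2) unfolding spectral_decomposition_def by (intro conjI mult_carrier_mat)
qed

text \<open>Induction by deflation: a Householder reflection moves an eigenvector to the first basis
  vector, and Hermitian symmetry then clears the first row together with the first column.\<close>

theorem spectral_theorem: "hermitian n A \<Longrightarrow> \<exists>U l. spectral_decomposition n A U l"
proof (induction n arbitrary: A)
  case 0
  then have "spectral_decomposition 0 A A (\<lambda>_. 0)"
    by (auto simp: spectral_decomposition_def hermitian_def intro!: eq_matI)
  then show ?case by blast
next
  case (Suc n)
  note A = hermitianD[OF Suc.prems]
  have Ac: "A \<in> carrier_mat (Suc n) (Suc n)" using A by auto
  from spectrum_non_empty[OF Ac] obtain e v where "eigenvector A v e"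
    by (auto simp: spectrum_def eigenvalue_def)
  then have v: "dim_vec v = Suc n" "v \<noteq> 0\<^sub>v (Suc n)" "A *\<^sub>v v = e \<cdot>\<^sub>v v"
    using A by (auto simp: eigenvector_def)
  obtain H c where H: "H \<in> carrier_mat (Suc n) (Suc n)" "adj H = H" "H * H = 1\<^sub>m (Suc n)"
    "c \<noteq> 0" "H *\<^sub>v unit_vec (Suc n) 0 = c \<cdot>\<^sub>v v"
    using householder[OF v(1,2)] by blast
  have Hd: "dim_row H = Suc n" "dim_col H = Suc n" using H(1) by auto
  define B where "B = H * A * H"
  have Bd: "dim_row B = Suc n" "dim_col B = Suc n" by (simp_all add: B_def Hd)
  have hB: "hermitian (Suc n) B"
    using hermitian_conj[OF Suc.prems Hd(1)] by (simp add: H(2) B_def Hd)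
  have "B *\<^sub>v unit_vec (Suc n) 0 = H *\<^sub>v (A *\<^sub>v (c \<cdot>\<^sub>v v))"
    unfolding B_def by (simp add: mult_mat_vec_assoc Hd A H(5) v)
  also have "\<dots> = e \<cdot>\<^sub>v (H *\<^sub>v (c \<cdot>\<^sub>v v))"
    by (simp add: mult_mat_vec_smult Hd A v smult_smult_assoc mult.commute)
  also have "H *\<^sub>v (c \<cdot>\<^sub>v v) = H *\<^sub>v (H *\<^sub>v unit_vec (Suc n) 0)" by (simp add: H(5))
  also have "\<dots> = unit_vec (Suc n) 0"
    by (simp add: mult_mat_vec_assoc[symmetric] Hd H(3))
  finally have Be: "B *\<^sub>v unit_vec (Suc n) 0 = e \<cdot>\<^sub>v unit_vec (Suc n) 0" .
  have B0: "B $$ (i, 0) = (if i = 0 then e else 0)" if "i < Suc n" for i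
  proof -
    have "vec_index (B *\<^sub>v unit_vec (Suc n) 0) i = B $$ (i, 0)"
      using that Bd by (intro mult_unit_vec_index) auto
    then show ?thesis using that by (auto simp: Be split: if_splits)
  qed
  have Bh: "B $$ (i, j) = cnj (B $$ (j, i))" if "i < Suc n" "j < Suc n" for i j
    using adj_index[of i B j] that Bd hermitianD(3)[OF hB] by simp
  \<comment> \<open>The eigenvalue is now a diagonal entry of a Hermitian matrix, hence
    real.\<close>
  have e: "e = complex_of_real (Re e)"
    using Bh[of 0 0] B0[of 0] by (simp add: complex_eq_iff)
  define C where "C = Matrix.mat n n (\<lambda>(i, j). B $$ (Suc i, Suc j))"
  have Cd: "dim_row C = n" "dim_col C = n" by (simp_all add: C_def)
  have BC: "B = block1 e C"
  proof (rule eq_mat_SucI[of _ n _ n])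
    fix j assume "j < n"
    then show "B $$ (0, Suc j) = block1 e C $$ (0, Suc j)"
      using Bh[of 0 "Suc j"] B0[of "Suc j"] Cd by simp
  qed (use B0 Bd in \<open>auto simp: C_def\<close>)
  have "adj C = C"
  proof (rule eq_matI)
    fix i j assume "i < dim_row C" "j < dim_col C"
    then show "adj C $$ (i, j) = C $$ (i, j)"
      using Bh[of "Suc i" "Suc j"] Cd by (simp add: C_def)
  qed (use Cd in auto)
  then have "hermitian n C" using Cd by (auto simp: hermitian_def)
  then obtain U l where "spectral_decomposition n C U l" using Suc.IH by blast
  note S = spectral_decompositionD[OF this]
  \<comment> \<open>The eigenvalue that was split off takes index 0 and shifts the others by
    one.\<close>
  have "spectral_decomposition (Suc n) B (block1 1 U) (case_nat (Re e) l)"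
    unfolding spectral_decomposition_def
  proof (intro conjI)
    show "block1 1 U \<in> carrier_mat (Suc n) (Suc n)" using S(2,3) by auto
    show "adj (block1 1 U) * block1 1 U = 1\<^sub>m (Suc n)"
      using S(2,3,6) by (simp add: block1_adjoint block1_mult block1_one)
    have "real_diag (Suc n) (\<lambda>i. case_nat (Re e) l i)
        = block1 e (real_diag n l)"
      by (subst block1_diag[symmetric]) (simp flip: e)
    then show "B = block1 1 U * real_diag (Suc n) (\<lambda>i. case_nat (Re e) l i) *
        adj (block1 1 U)"
      unfolding BC using S(2,3,8) by (simp add: block1_adjoint block1_mult)
  qed
  from spectral_decomposition_conj[OF this H(1)]
  have "spectral_decomposition (Suc n) (H * B * H) (H * block1 1 U) (case_nat (Re e) l)"
    by (simp add: H(2,3))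
  also have "H * B * H = (H * H) * A * (H * H)"
    unfolding B_def by (simp add: mult_mat_assoc Hd A)
  also have "\<dots> = A" by (simp add: H(3) A)
  finally show ?case by blast
qed

subsection \<open>Functional calculus\<close>

text \<open>In the two eigenbases the relation \<open>A * W = W * B\<close> says that an entry of
  the transformed \<open>W\<close> vanishes unless the two eigenvalues at its position agree, and
  then \<open>f\<close> agrees on them too.\<close>

lemma spectral_intertwining:
  assumes "spectral_decomposition n A U l" "spectral_decomposition m B V k"
    and "dim_row W = n" "dim_col W = m" "A * W = W * B"
  shows "U * real_diag n (\<lambda>i. f (l i)) * adj U * W =
    W * (V * real_diag m (\<lambda>i. f (k i)) * adj V)"
proof -
  note S = spectral_decompositionD[OF assms(1)] and T = spectral_decompositionD[OF assms(2)]
  define M where "M = adj U * W * V"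
  have Md: "dim_row M = n" "dim_col M = m" using S T assms by (auto simp: M_def)
  have cancel: "adj U * (U * X) = X" if "dim_row X = n" for X
    using that S by (simp add: mult_mat_assoc[symmetric])
  have cancel': "V * (adj V * X) = X" if "dim_row X = m" for X
    using that T by (simp add: mult_mat_assoc[symmetric])
  have cancelU: "U * (adj U * X) = X" if "dim_row X = n" for X
    using that S by (simp add: mult_mat_assoc[symmetric])
  have "real_diag n l * M = adj U * (A * W) * V"
    unfolding M_def S(8) using S(2,3) T(2,3) assms(3,4) by (simp add: mult_mat_assoc cancel)
  also have "\<dots> = M * real_diag m k"
    unfolding assms(5) M_def T(8) using S(2,3) T(2,3,6) assms(3,4) by (simp add: mult_mat_assoc)
  finally have eq: "real_diag n l * M = M * real_diag m k" .
  have "real_diag n (\<lambda>i. f (l i)) * M = M * real_diag m (\<lambda>i. f (k i))" (is "?L = ?R")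
  proof (rule eq_mat_dimI[of n m])
    fix i j assume ij: "i < n" "j < m"
    have "l i * M $$ (i, j) = M $$ (i, j) * k j"
      using arg_cong[OF eq, of "\<lambda>M. M $$ (i, j)"] ij Md by (simp add: mat_diag_mult_index)
    then have "M $$ (i, j) = 0 \<or> l i = k j" by auto
    then show "?L $$ (i, j) =
        ?R $$ (i, j)"
      using ij Md by (auto simp: mat_diag_mult_index)
  qed (use Md in auto)
  then have "U * (real_diag n (\<lambda>i. f (l i)) * M) * adj V =
      U * (M * real_diag m (\<lambda>i. f (k i))) * adj V" by simp
  then show ?thesis
    unfolding M_def using S(2,3) T(2,3,7) assms(3,4) by (simp add: mult_mat_assoc cancelU)
qed

text \<open>Well-definedness of the functional calculus: two decompositions of the same matrix are
  intertwined by the identity, so all candidates for \<open>THE\<close> coincide.\<close>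

lemma mat_fun_eq:
  assumes "spectral_decomposition n A U l"
  shows "mat_fun f A = U * real_diag n (\<lambda>i. f (l i)) * adj U"
proof -
  note S = spectral_decompositionD[OF assms]
  have "B = U * real_diag n (\<lambda>i. f (l i)) * adj U"
    if "spectral_decomposition n A V k"
      "B = V * real_diag n (\<lambda>i. f (k i)) * adj V" for B V k
    using spectral_intertwining[OF that(1) assms, of "1\<^sub>m n" f]
      spectral_decompositionD[OF that(1)] S that(2) by simp
  then show ?thesis
    unfolding mat_fun_def S(4) using assms by (intro the_equality) blast+
qed

lemma mat_fun_spectral_decomposition:
  assumes "spectral_decomposition n A U l"
  shows "spectral_decomposition n (mat_fun f A) U (\<lambda>i. f (l i))"
  using spectral_decompositionD[OF assms] mat_fun_eq[OF assms, of f]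
  by (simp add: spectral_decomposition_def)

lemma mat_fun_intertwining:
  assumes "hermitian n A" "hermitian m B" "dim_row W = n" "dim_col W = m" "A * W = W * B"
  shows "mat_fun f A * W = W * mat_fun f B"
proof -
  obtain U l V k where "spectral_decomposition n A U l" "spectral_decomposition m B V k"
    using assms(1,2) spectral_theorem by meson
  then show ?thesis
    using spectral_intertwining[of n A U l m B V k W f] assms by (simp add: mat_fun_eq)
qed

text \<open>Translates the conditions on spectra in \<open>operator_convex_on\<close> and
  \<open>admissible\<close> into conditions on the diagonal of a decomposition.\<close>

lemma eigenvalue_spectral_decomposition:
  assumes "spectral_decomposition n A U l"
  shows "eigenvalue A z \<longleftrightarrow> (\<exists>i<n. z = complex_of_real (l i))"
proof
  note S = spectral_decompositionD[OF assms]
  show "\<exists>i<n. z = complex_of_real (l i)" if "eigenvalue A z"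
  proof -
    from that obtain v where v: "dim_vec v = n" "v \<noteq> 0\<^sub>v n" "A *\<^sub>v v = z \<cdot>\<^sub>v v"
      unfolding eigenvalue_def eigenvector_def S(4) carrier_vec_def by blast
    define w where "w = adj U *\<^sub>v v"
    have wd: "dim_vec w = n" using S by (simp add: w_def)
    have vw: "v = U *\<^sub>v w" using S v by (simp add: w_def mult_mat_vec_assoc[symmetric])
    have "w \<noteq> 0\<^sub>v n"
    proof
      assume "w = 0\<^sub>v n"
      then have "v = 0\<^sub>v n"
        unfolding vw using S by (intro eq_vecI) (auto simp: mult_vec_index)
      then show False using v by simp
    qed
    then obtain i where i: "i < n" "vec_index w i \<noteq> 0"
      using wd by (metis eq_vecI index_zero_vec(1) index_zero_vec(2))
    have "real_diag n l *\<^sub>v w = adj U *\<^sub>v (A *\<^sub>v v)"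
      unfolding vw S(8) using S(2,3,6) wd
      by (simp add: mult_mat_vec_assoc[symmetric] mult_mat_assoc) (simp add: mult_mat_assoc[symmetric] S(6) S(2,3))
    also have "\<dots> = z \<cdot>\<^sub>v w"
      unfolding v(3) w_def using S v by (intro mult_mat_vec_smult) simp
    finally have "vec_index (real_diag n l *\<^sub>v w) i = vec_index (z \<cdot>\<^sub>v w) i" by simp
    then show ?thesis using i wd by (auto simp: mat_diag_vec_index)
  qed
  show "eigenvalue A z" if "\<exists>i<n. z = complex_of_real (l i)"
  proof -
    from that obtain i where i: "i < n" "z = complex_of_real (l i)" by blast
    have e: "unit_vec n i \<noteq> (0\<^sub>v n :: complex Matrix.vec)" using i by auto
    define v where "v = U *\<^sub>v unit_vec n i"
    have "adj U *\<^sub>v v = unit_vec n i"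
      using S by (simp add: v_def mult_mat_vec_assoc[symmetric])
    moreover have "adj U *\<^sub>v 0\<^sub>v n = 0\<^sub>v n"
      using S by (intro eq_vecI) (auto simp: mult_vec_index)
    ultimately have "v \<noteq> 0\<^sub>v n" using e by metis
    moreover have "A *\<^sub>v v = z \<cdot>\<^sub>v v"
    proof -
      have "real_diag n l *\<^sub>v unit_vec n i = z \<cdot>\<^sub>v unit_vec n i"
        using i by (intro eq_vecI) (auto simp: mat_diag_vec_index)
      moreover have "A *\<^sub>v v = U *\<^sub>v (real_diag n l *\<^sub>v unit_vec n i)"
        unfolding S(8) v_def using S(2,3,6)
        by (simp add: mult_mat_vec_assoc[symmetric] mult_mat_assoc)
      ultimately show ?thesis
        unfolding v_def using S by (simp add: mult_mat_vec_smult)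
    qed
    moreover have "dim_vec v = n" by (simp add: v_def S(2))
    ultimately show ?thesis
      unfolding eigenvalue_def eigenvector_def S(4) carrier_vec_def by blast
  qed
qed

subsection \<open>Kronecker products\<close>

lemma sum_mult_index:
  fixes f :: "nat \<Rightarrow> 'a::comm_monoid_add"
  shows "(\<Sum>k<m * n. f k) = (\<Sum>a<m. \<Sum>b<n. f (a * n + b))"
proof -
  have "(\<Sum>k<m * n. f k) = (\<Sum>a<m. sum f {a * n..<a * n + n})"
    by (rule sum.nat_group[symmetric])
  also have "\<dots> = (\<Sum>a<m. \<Sum>b<n. f (a * n + b))"
    by (rule sum.cong, rule refl, subst sum.atLeastLessThan_shift_0) (simp add: lessThan_atLeast0)
  finally show ?thesis .
qed

lemma index_div_mod [simp]:
  fixes a b n :: nat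
  shows "b < n \<Longrightarrow> (a * n + b) div n = a" "b < n \<Longrightarrow> (a * n + b) mod n = b"
  by auto

lemma index_less [simp]:
  fixes a b n :: nat
  assumes "a < m" "b < n"
  shows "a * n + b < m * n"
proof -
  have "Suc a * n \<le> m * n" using assms(1) by (intro mult_le_mono1) simp
  then show ?thesis using assms(2) by simp
qed

lemma div_mod_less:
  fixes i m n :: nat
  assumes "i < m * n"
  shows "i div n < m" "i mod n < n"
proof -
  have "n > 0" using assms by (cases n) auto
  then show "i div n < m" "i mod n < n"
    using assms by (simp_all add: less_mult_imp_div_less)
qed

lemma sum_div_mod:
  fixes f :: "nat \<Rightarrow> nat \<Rightarrow> 'a::comm_monoid_add"
  shows "(\<Sum>k<m * n. f (k div n) (k mod n)) = (\<Sum>a<m. \<Sum>b<n. f a b)"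
  unfolding sum_mult_index by simp

lemma kron_dim [simp]:
  "dim_row (kron A B) = dim_row A * dim_row B" "dim_col (kron A B) = dim_col A * dim_col B"
  by (simp_all add: kron_def)

lemma kron_index:
  "i < dim_row A * dim_row B \<Longrightarrow> j < dim_col A * dim_col B \<Longrightarrow>
    kron A B $$ (i, j) = A $$ (i div dim_row B, j div dim_col B) * B $$ (i mod dim_row B, j mod dim_col B)"
  by (simp add: kron_def)

lemma kron_mult:
  assumes "dim_col A = dim_row C" "dim_col B = dim_row D"
  shows "kron A B * kron C D = kron (A * C) (B * D)" (is "?L = ?R")
proof (rule eq_mat_dimI[of "dim_row A * dim_row B" "dim_col C * dim_col D"])
  fix i j assume ij: "i < dim_row A * dim_row B" "j < dim_col C * dim_col D"
  note dm = div_mod_less[OF ij(1)] div_mod_less[OF ij(2)]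
  have "?L $$ (i, j) = (\<Sum>k<dim_row C * dim_row D.
      (A $$ (i div dim_row B, k div dim_row D) * B $$ (i mod dim_row B, k mod dim_row D)) *
      (C $$ (k div dim_row D, j div dim_col D) * D $$ (k mod dim_row D, j mod dim_col D)))"
    using ij assms by (simp add: mult_mat_index kron_index)
  also have "\<dots> = (\<Sum>a<dim_row C. \<Sum>b<dim_row D.
      (A $$ (i div dim_row B, a) * C $$ (a, j div dim_col D)) *
      (B $$ (i mod dim_row B, b) * D $$ (b, j mod dim_col D)))"
    by (subst sum_div_mod) (simp add: ac_simps)
  also have "\<dots> = ?R $$ (i, j)"
    using ij assms dm by (simp add: mult_mat_index kron_index sum_product)
  finally show "?L $$ (i, j) = ?R $$ (i, j)" .
qed auto

lemma kron_adjoint: "adj (kron A B) = kron (adj A) (adj B)"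
  by (rule eq_matI) (auto simp: kron_index div_mod_less)

lemma kron_one: "kron (1\<^sub>m m) (1\<^sub>m n) = 1\<^sub>m (m * n)" (is "?L = _")
proof (rule eq_mat_dimI[of "m * n" "m * n"])
  fix i j assume ij: "i < m * n" "j < m * n"
  have "i = j \<longleftrightarrow> i div n = j div n \<and> i mod n = j mod n"
    by (metis div_mult_mod_eq)
  then show "?L $$ (i, j) = 1\<^sub>m (m * n) $$ (i, j)"
    using ij div_mod_less[OF ij(1)] div_mod_less[OF ij(2)] by (auto simp: kron_index)
qed auto

lemma kron_diag:
  "kron (mat_diag m f) (mat_diag n g) = mat_diag (m * n) (\<lambda>k. f (k div n) * g (k mod n))" (is "?L = ?R")
proof (rule eq_mat_dimI[of "m * n" "m * n"])
  fix i j assume ij: "i < m * n" "j < m * n"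
  have "i = j \<longleftrightarrow> i div n = j div n \<and> i mod n = j mod n"
    by (metis div_mult_mod_eq)
  then show "?L $$ (i, j) =
      ?R $$ (i, j)"
    using ij div_mod_less[OF ij(1)] div_mod_less[OF ij(2)] by (auto simp: kron_index)
qed auto

lemma transpose_mult_dim:
  fixes A B :: "complex mat"
  shows "dim_col A = dim_row B \<Longrightarrow> transpose_mat (A * B) = transpose_mat B * transpose_mat A"
  by (rule eq_matI) (auto simp: mult_mat_index mult.commute)

lemma adj_transpose: "adj (transpose_mat A) = transpose_mat (adj (A :: complex mat))"
  by (rule eq_matI) auto

lemma transpose_diag [simp]: "transpose_mat (mat_diag n f) = mat_diag n f"
  by (rule eq_matI) auto

lemma vec_rows_dim [simp]: "dim_vec (vec_rows A) = dim_row A * dim_col A"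
  by (simp add: vec_rows_def)

lemma vec_rows_index:
  "k < dim_row A * dim_col A \<Longrightarrow> vec_index (vec_rows A) k = A $$ (k div dim_col A, k mod dim_col A)"
  by (simp add: vec_rows_def)

lemma vec_rows_inject:
  assumes "vec_rows A = vec_rows B" "dim_row A = dim_row B" "dim_col A = dim_col B"
  shows "A = B"
proof (rule eq_matI)
  fix i j assume ij: "i < dim_row B" "j < dim_col B"
  then have "i * dim_col B + j < dim_row B * dim_col B" by simp
  then show "A $$ (i, j) = B $$ (i, j)"
    using arg_cong[OF assms(1), of "\<lambda>v. vec_index v (i * dim_col B + j)"] ij assms(2,3)
    by (simp add: vec_rows_index)
qed (use assms in auto)

text \<open>With rows stacked, the second tensor factor acts on the column index, that is, from the
  right and transposed. This is the reason for the transpose in the relative entropy.\<close>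

lemma kron_mult_vec_rows:
  assumes "dim_col A = dim_row X" "dim_col B = dim_col X"
  shows "kron A B *\<^sub>v vec_rows X = vec_rows (A * X * transpose_mat B)"
proof (rule eq_vecI)
  fix i assume "i < dim_vec (vec_rows (A * X * transpose_mat B))"
  then have i: "i < dim_row A * dim_row B" by simp
  note dm = div_mod_less[OF i]
  have "vec_index (kron A B *\<^sub>v vec_rows X) i = (\<Sum>k<dim_row X * dim_col X.
      A $$ (i div dim_row B, k div dim_col X) * B $$ (i mod dim_row B, k mod dim_col X) *
      X $$ (k div dim_col X, k mod dim_col X))"
    using i assms by (simp add: mult_vec_index kron_index vec_rows_index)
  also have "\<dots> = (\<Sum>a<dim_row X. \<Sum>b<dim_col X. A $$ (i div dim_row B, a) * B $$ (i mod dim_row B, b) * X $$ (a, b))"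
    by (rule sum_div_mod)
  also have "\<dots> = (\<Sum>b<dim_col X. \<Sum>a<dim_row X. A $$ (i div dim_row B, a) * B $$ (i mod dim_row B, b) * X $$ (a, b))"
    by (rule sum.swap)
  also have "\<dots> = vec_index (vec_rows (A * X * transpose_mat B)) i"
    using i assms dm by (simp add: vec_rows_index mult_mat_index sum_distrib_right sum_distrib_left ac_simps)
  finally show "vec_index (kron A B *\<^sub>v vec_rows X) i = vec_index (vec_rows (A * X * transpose_mat B)) i" .
qed (use assms in auto)

text \<open>Stacking is unitary for the Hilbert-Schmidt inner product, so overlaps of purifying
  vectors become traces.\<close>

lemma cscalar_prod_vec_rows:
  assumes "dim_row A = dim_row B" "dim_col A = dim_col B"
  shows "vec_rows A \<bullet>c vec_rows B = mat_trace (A * adj B)"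
proof -
  have "vec_rows A \<bullet>c vec_rows B = (\<Sum>k<dim_row B * dim_col B.
      A $$ (k div dim_col B, k mod dim_col B) * cnj (B $$ (k div dim_col B, k mod dim_col B)))"
    using assms by (simp add: cscalar_prod_sum vec_rows_index)
  also have "\<dots> = (\<Sum>a<dim_row B. \<Sum>b<dim_col B. A $$ (a, b) * cnj (B $$ (a, b)))"
    by (rule sum_div_mod)
  also have "\<dots> = mat_trace (A * adj B)"
    using assms by (simp add: mat_trace_def mult_mat_index)
  finally show ?thesis .
qed

lemma mat_trace_mult_commute:
  assumes "dim_row A = dim_col B" "dim_col A = dim_row B"
  shows "mat_trace (A * B) = mat_trace (B * A)"
proof -
  have "mat_trace (A * B) = (\<Sum>i<dim_row A. \<Sum>k<dim_row B. A $$ (i, k) * B $$ (k, i))"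
    using assms by (simp add: mat_trace_def mult_mat_index)
  also have "\<dots> = (\<Sum>k<dim_row B. \<Sum>i<dim_row A. A $$ (i, k) * B $$ (k, i))"
    by (rule sum.swap)
  also have "\<dots> = mat_trace (B * A)"
    using assms by (simp add: mat_trace_def mult_mat_index mult.commute)
  finally show ?thesis .
qed

subsection \<open>Sums of matrices\<close>

text \<open>The dimensions are explicit arguments so that the empty sum is a zero matrix of definite
  size.\<close>

definition mat_sum :: "nat \<Rightarrow> nat \<Rightarrow> nat \<Rightarrow> (nat \<Rightarrow> complex mat) \<Rightarrow> complex mat" where
  "mat_sum m n K F = Matrix.mat m n (\<lambda>(i, j). \<Sum>k<K. F k $$ (i, j))"

lemma mat_sum_dim [simp]: "dim_row (mat_sum m n K F) = m" "dim_col (mat_sum m n K F) = n"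
  by (simp_all add: mat_sum_def)

lemma mat_sum_index: "i < m \<Longrightarrow> j < n \<Longrightarrow> mat_sum m n K F $$ (i, j) = (\<Sum>k<K. F k $$ (i, j))"
  by (simp add: mat_sum_def)

lemma mat_sum_cong: "(\<And>k. k < K \<Longrightarrow> F k = G k) \<Longrightarrow> mat_sum m n K F = mat_sum m n K G"
  by (simp add: mat_sum_def)

lemma mat_sum_mult_left:
  assumes "dim_col A = m" "\<And>k. k < K \<Longrightarrow> dim_row (F k) = m" "\<And>k. k < K \<Longrightarrow> dim_col (F k) = n"
  shows "A * mat_sum m n K F = mat_sum (dim_row A) n K (\<lambda>k. A * F k)" (is "?L = ?R")
proof (rule eq_mat_dimI[of "dim_row A" n])
  fix i j assume ij: "i < dim_row A" "j < n"
  have "?L $$ (i, j) = (\<Sum>a<m. \<Sum>k<K. A $$ (i, a) * F k $$ (a, j))"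
    using ij assms by (simp add: mult_mat_index mat_sum_index sum_distrib_left)
  also have "\<dots> = (\<Sum>k<K. \<Sum>a<m. A $$ (i, a) * F k $$ (a, j))" by (rule sum.swap)
  also have "\<dots> = ?R $$ (i, j)"
    using ij assms by (simp add: mult_mat_index mat_sum_index)
  finally show "?L $$ (i, j) = ?R $$ (i, j)" .
qed auto

lemma mat_sum_mult_right:
  assumes "dim_row A = n" "\<And>k. k < K \<Longrightarrow> dim_row (F k) = m" "\<And>k. k < K \<Longrightarrow> dim_col (F k) = n"
  shows "mat_sum m n K F * A = mat_sum m (dim_col A) K (\<lambda>k. F k * A)" (is "?L = ?R")
proof (rule eq_mat_dimI[of m "dim_col A"])
  fix i j assume ij: "i < m" "j < dim_col A"
  have "?L $$ (i, j) = (\<Sum>a<n. \<Sum>k<K. F k $$ (i, a) * A $$ (a, j))"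
    using ij assms by (simp add: mult_mat_index mat_sum_index sum_distrib_right)
  also have "\<dots> = (\<Sum>k<K. \<Sum>a<n. F k $$ (i, a) * A $$ (a, j))" by (rule sum.swap)
  also have "\<dots> = ?R $$ (i, j)"
    using ij assms by (simp add: mult_mat_index mat_sum_index)
  finally show "?L $$ (i, j) = ?R $$ (i, j)" .
qed auto

lemma mat_sum_adjoint:
  assumes "\<And>k. k < K \<Longrightarrow> dim_row (F k) = m" "\<And>k. k < K \<Longrightarrow> dim_col (F k) = n"
  shows "adj (mat_sum m n K F) = mat_sum n m K (\<lambda>k. adj (F k))"
  by (rule eq_matI) (use assms in \<open>auto simp: mat_sum_index\<close>)

lemma mat_sum_transpose:
  assumes "\<And>k. k < K \<Longrightarrow> dim_row (F k) = m" "\<And>k. k < K \<Longrightarrow> dim_col (F k) = n"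
  shows "transpose_mat (mat_sum m n K F) = mat_sum n m K (\<lambda>k. transpose_mat (F k))"
  by (rule eq_matI) (use assms in \<open>auto simp: mat_sum_index\<close>)

lemma mat_sum_mult_vec_rows:
  assumes "\<And>k. k < K \<Longrightarrow> dim_row (A k) = m" "\<And>k. k < K \<Longrightarrow> dim_row (B k) = n"
    and "\<And>k. k < K \<Longrightarrow> dim_col (A k) = dim_row X" "\<And>k. k < K \<Longrightarrow> dim_col (B k) = dim_col X"
  shows "mat_sum (m * n) (dim_row X * dim_col X) K (\<lambda>k. kron (A k) (B k)) *\<^sub>v vec_rows X =
    vec_rows (mat_sum m n K (\<lambda>k. A k * X * transpose_mat (B k)))"
proof (rule eq_vecI)
  fix i assume "i < dim_vec (vec_rows (mat_sum m n K (\<lambda>k. A k * X * transpose_mat (B k))))"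
  then have i: "i < m * n" by simp
  note dm = div_mod_less[OF i]
  have "vec_index (mat_sum (m * n) (dim_row X * dim_col X) K (\<lambda>k. kron (A k) (B k)) *\<^sub>v vec_rows X) i =
      (\<Sum>j<dim_row X * dim_col X. \<Sum>k<K. kron (A k) (B k) $$ (i, j) * vec_index (vec_rows X) j)"
    using i by (simp add: mult_vec_index mat_sum_index sum_distrib_right)
  also have "\<dots> = (\<Sum>k<K. \<Sum>j<dim_row X * dim_col X. kron (A k) (B k) $$ (i, j) * vec_index (vec_rows X) j)"
    by (rule sum.swap)
  also have "\<dots> = (\<Sum>k<K. vec_index (kron (A k) (B k) *\<^sub>v vec_rows X) i)"
    using i assms by (intro sum.cong) (simp_all add: mult_vec_index)
  also have "\<dots> = (\<Sum>k<K. (A k * X * transpose_mat (B k)) $$ (i div n, i mod n))"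
    using i assms by (intro sum.cong) (simp_all add: kron_mult_vec_rows vec_rows_index)
  also have "\<dots> = vec_index (vec_rows (mat_sum m n K (\<lambda>k. A k * X * transpose_mat (B k)))) i"
    using i dm by (simp add: vec_rows_index mat_sum_index)
  finally show "vec_index (mat_sum (m * n) (dim_row X * dim_col X) K (\<lambda>k. kron (A k) (B k)) *\<^sub>v vec_rows X) i =
      vec_index (vec_rows (mat_sum m n K (\<lambda>k. A k * X * transpose_mat (B k)))) i" .
qed auto

subsection \<open>Strictly positive matrices\<close>

lemma quadratic_form_diag:
  fixes v :: "complex Matrix.vec"
  assumes "dim_vec v = n"
  shows "(real_diag n f *\<^sub>v v) \<bullet>c v =
    complex_of_real (\<Sum>i<n. f i * (cmod (vec_index v i))\<^sup>2)"
proof -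
  have "(real_diag n f *\<^sub>v v) \<bullet>c v =
      (\<Sum>i<n. complex_of_real (f i) * (vec_index v i * cnj (vec_index v i)))"
    using assms by (simp add: cscalar_prod_sum mat_diag_vec_index mult.assoc)
  then show ?thesis
    by (simp only: complex_norm_square of_real_sum of_real_mult)
qed

lemma quadratic_form_spectral:
  assumes "spectral_decomposition n A U l" "dim_vec v = n"
  shows "(A *\<^sub>v v) \<bullet>c v = complex_of_real (\<Sum>i<n. l i * (cmod (vec_index (adj U *\<^sub>v v) i))\<^sup>2)"
proof -
  note S = spectral_decompositionD[OF assms(1)]
  have "(A *\<^sub>v v) \<bullet>c v =
      (U *\<^sub>v (real_diag n l *\<^sub>v (adj U *\<^sub>v v))) \<bullet>c v"
    unfolding S(8) by (simp add: S(2,3) assms(2) mult_mat_vec_assoc)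
  also have "\<dots> = (real_diag n l *\<^sub>v (adj U *\<^sub>v v)) \<bullet>c (adj U *\<^sub>v v)"
    by (subst cscalar_prod_adjoint) (simp_all add: S(2,3) assms(2))
  finally show ?thesis by (subst (asm) quadratic_form_diag) (simp_all add: S(2,3))
qed

lemma quadratic_form_eigenvector:
  assumes "spectral_decomposition n A U l" "i < n"
  shows "(A *\<^sub>v (U *\<^sub>v unit_vec n i)) \<bullet>c (U *\<^sub>v unit_vec n i) = complex_of_real (l i)"
    and "U *\<^sub>v unit_vec n i \<in> carrier_vec n" "U *\<^sub>v unit_vec n i \<noteq> 0\<^sub>v n"
proof -
  note S = spectral_decompositionD[OF assms(1)]
  have "adj U *\<^sub>v (U *\<^sub>v unit_vec n i) = unit_vec n i"
    using S(2,3,6) by (simp add: mult_mat_vec_assoc[symmetric])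
  note U = this
  show c: "U *\<^sub>v unit_vec n i \<in> carrier_vec n" by (rule carrier_vecI) (simp add: S(2))
  have "(A *\<^sub>v (U *\<^sub>v unit_vec n i)) \<bullet>c (U *\<^sub>v unit_vec n i)
      = complex_of_real (\<Sum>k<n. l k * (cmod (vec_index (unit_vec n i :: complex Matrix.vec) k))\<^sup>2)"
    using quadratic_form_spectral[OF assms(1), of "U *\<^sub>v unit_vec n i"] S(2) U by simp
  also have "(\<Sum>k<n. l k * (cmod (vec_index (unit_vec n i :: complex Matrix.vec) k))\<^sup>2) = (\<Sum>k<n. if k = i then l k else 0)"
    by (rule sum.cong) (auto simp: unit_vec_def)
  finally show "(A *\<^sub>v (U *\<^sub>v unit_vec n i)) \<bullet>c (U *\<^sub>v unit_vec n i) = complex_of_real (l i)"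
    using assms(2) by simp
  have "adj U *\<^sub>v 0\<^sub>v n = 0\<^sub>v n"
    using S(2,3) by (intro eq_vecI) (auto simp: mult_vec_index)
  then show "U *\<^sub>v unit_vec n i \<noteq> 0\<^sub>v n" using U assms(2) by (metis unit_vec_nonzero)
qed

lemma strictly_pos_spectral:
  assumes "spectral_decomposition n A U l" "strictly_pos n A" "i < n"
  shows "l i > 0"
proof -
  have "0 < Re ((A *\<^sub>v (U *\<^sub>v unit_vec n i)) \<bullet>c (U *\<^sub>v unit_vec n i))"
    using assms(2) quadratic_form_eigenvector(2,3)[OF assms(1,3)] unfolding strictly_pos_def by blast
  then show ?thesis by (simp add: quadratic_form_eigenvector(1)[OF assms(1,3)])
qed

lemma pos_semidef_spectral:
  assumes "spectral_decomposition n A U l" "pos_semidef n A" "i < n"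
  shows "l i \<ge> 0"
proof -
  have "0 \<le> Re ((A *\<^sub>v (U *\<^sub>v unit_vec n i)) \<bullet>c (U *\<^sub>v unit_vec n i))"
    using assms(2) quadratic_form_eigenvector(2)[OF assms(1,3)] unfolding pos_semidef_def by blast
  then show ?thesis by (simp add: quadratic_form_eigenvector(1)[OF assms(1,3)])
qed

lemma strictly_pos_spectral_obtains:
  assumes "strictly_pos n A"
  obtains U l where "spectral_decomposition n A U l" "\<And>i. i < n \<Longrightarrow> l i > 0"
proof -
  obtain U l where "spectral_decomposition n A U l"
    using assms spectral_theorem unfolding strictly_pos_def by blast
  then show ?thesis using that strictly_pos_spectral assms by blast
qed

lemma mat_fun_mult:
  assumes "hermitian n A"
  shows "mat_fun f A * mat_fun g A = mat_fun (\<lambda>x. f x * g x) A"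
proof -
  obtain U l where U: "spectral_decomposition n A U l" using assms spectral_theorem by blast
  note S = spectral_decompositionD[OF U]
  have "adj U * (U * X) = X" if "dim_row X = n" for X
    using that S(2,3,6) by (simp add: mult_mat_assoc[symmetric])
  moreover have "mat_diag n h * (mat_diag n k * X) = mat_diag n (\<lambda>i. h i * k i) * X"
    if "dim_row X = n" for X and h k :: "nat \<Rightarrow> complex"
    using that by (simp add: mult_mat_assoc[symmetric])
  ultimately show ?thesis
    by (simp add: mat_fun_eq[OF U] mult_mat_assoc S(2,3))
qed

lemma mat_fun_id: 
  assumes "hermitian n A"
  shows "mat_fun (\<lambda>x. x) A = A"
proof -
  obtain U l where U: "spectral_decomposition n A U l" using assms spectral_theorem by blast
  show ?thesis unfolding mat_fun_eq[OF U] by (rule spectral_decompositionD(8)[OF U, symmetric])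
qed

lemma mat_fun_const_one:
  assumes "hermitian n A"
  shows "mat_fun (\<lambda>x. 1) A = 1\<^sub>m n"
proof -
  obtain U l where U: "spectral_decomposition n A U l" using assms spectral_theorem by blast
  show ?thesis unfolding mat_fun_eq[OF U] using spectral_decompositionD(2,3,7)[OF U] by simp
qed

lemma mat_fun_hermitian:
  assumes "hermitian n A"
  shows "hermitian n (mat_fun f A)"
  using assms spectral_theorem mat_fun_spectral_decomposition spectral_decomposition_hermitian by meson

lemma mat_fun_cong:
  assumes "spectral_decomposition n A U l" "\<And>i. i < n \<Longrightarrow> f (l i) = g (l i)"
  shows "mat_fun f A = mat_fun g A"
proof -
  have "real_diag n (\<lambda>i. f (l i)) = real_diag n (\<lambda>i. g (l i))"
    using assms(2) by (intro eq_matI) auto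
  then show ?thesis by (simp add: mat_fun_eq[OF assms(1)])
qed

text \<open>Identities between roots and inverses hold for positive arguments but not for all reals;
  strict positivity confines the comparison to the former.\<close>

lemma mat_fun_pos_cong:
  assumes "strictly_pos n A" "\<And>x. x > 0 \<Longrightarrow> f x = g x"
  shows "mat_fun f A = mat_fun g A"
  using strictly_pos_spectral_obtains[OF assms(1)] mat_fun_cong assms(2) by metis

lemma mat_fun_pos_mult:
  assumes "strictly_pos n A" "\<And>x. x > 0 \<Longrightarrow> f x * g x = h x"
  shows "mat_fun f A * mat_fun g A = mat_fun h A"
  using assms mat_fun_mult[of n A f g] mat_fun_pos_cong[OF assms(1), of "\<lambda>x. f x * g x" h]
  by (simp add: strictly_pos_def)

lemma mat_fun_pos_one:
  assumes "strictly_pos n A" "\<And>x. x > 0 \<Longrightarrow> f x = 1"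
  shows "mat_fun f A = 1\<^sub>m n"
  using mat_fun_pos_cong[OF assms] mat_fun_const_one[of n A] assms(1) by (simp add: strictly_pos_def)

lemma mat_fun_inverse:
  assumes "strictly_pos n A"
  shows "A * mat_fun inverse A = 1\<^sub>m n" "mat_fun inverse A * A = 1\<^sub>m n"
proof -
  have h: "hermitian n A" using assms by (simp add: strictly_pos_def)
  have "mat_fun (\<lambda>x. x) A * mat_fun inverse A = 1\<^sub>m n" "mat_fun inverse A * mat_fun (\<lambda>x. x) A = 1\<^sub>m n"
    unfolding mat_fun_mult[OF h] by (rule mat_fun_pos_one[OF assms]; simp)+
  then show "A * mat_fun inverse A = 1\<^sub>m n" "mat_fun inverse A * A = 1\<^sub>m n"
    by (simp_all add: mat_fun_id[OF h])
qed

text \<open>The first identity collapses the Petz isometry composed with its adjoint, the second one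
  its compression of the modular operator.\<close>

lemma mat_fun_sqrt:
  assumes "strictly_pos n A"
  shows "mat_fun sqrt A * mat_fun sqrt A = A" "mat_fun sqrt A * (mat_fun inverse A * mat_fun sqrt A) = 1\<^sub>m n"
proof -
  have h: "hermitian n A" using assms by (simp add: strictly_pos_def)
  show "mat_fun sqrt A * mat_fun sqrt A = A"
    using mat_fun_pos_mult[OF assms, of sqrt sqrt "\<lambda>x. x"] mat_fun_id[OF h] by simp
  show "mat_fun sqrt A * (mat_fun inverse A * mat_fun sqrt A) = 1\<^sub>m n"
    unfolding mat_fun_mult[OF h] by (rule mat_fun_pos_one[OF assms]) (simp add: field_simps)
qed

text \<open>Replaces the Gauss-Jordan inverse in \<open>f_rel_entropy\<close> by the functional
  calculus.\<close>

lemma mat_inverse_strictly_pos: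
  assumes "strictly_pos n A"
  shows "the (mat_inverse A) = mat_fun inverse A"
proof -
  have h: "hermitian n A" using assms by (simp add: strictly_pos_def)
  have c: "A \<in> carrier_mat n n" "mat_fun inverse A \<in> carrier_mat n n"
    using h mat_fun_hermitian[OF h] by (simp_all add: hermitian_def)
  \<comment> \<open>Exhibiting a two-sided inverse rules out the result \<open>None\<close>.\<close>
  have "A \<in> Units (ring_mat TYPE(complex) n ())"
    using mat_fun_inverse[OF assms] c by (auto simp: Units_def ring_mat_def)
  then obtain B where B: "mat_inverse A = Some B"
    using mat_inverse(1)[OF c(1), where b = "()"] by (cases "mat_inverse A") auto
  from mat_inverse(2)[OF c(1) B] have B': "A * B = 1\<^sub>m n" "B \<in> carrier_mat n n" by auto
  have "B = mat_fun inverse A * A * B" using mat_fun_inverse[OF assms] B' by simp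
  also have "\<dots> = mat_fun inverse A"
    using c B' by (simp add: mult_mat_assoc)
  finally show ?thesis using B by simp
qed

section \<open>Linearity of products and adjoints under dimension conditions\<close>

lemma mult_add_distrib_dim:
  fixes A B C :: "complex mat"
  assumes "dim_row B = dim_row C" "dim_col B = dim_col C"
  shows "dim_col A = dim_row C \<Longrightarrow> A * (B + C) = A * B + A * C"
    "dim_row A = dim_col C \<Longrightarrow> (B + C) * A = B * A + C * A"
  using assms by (auto intro!: eq_matI simp: mult_mat_index algebra_simps sum.distrib)

lemma mult_diff_distrib_dim:
  fixes A B C :: "complex mat"
  assumes "dim_row B = dim_row C" "dim_col B = dim_col C"
  shows "dim_col A = dim_row C \<Longrightarrow> A * (B - C) = A * B - A * C"
    "dim_row A = dim_col C \<Longrightarrow> (B - C) * A = B * A - C * A"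
  using assms by (auto intro!: eq_matI simp: mult_mat_index algebra_simps sum_subtractf)

lemma mult_smult_dim:
  fixes A B :: "complex mat"
  assumes "dim_col A = dim_row B"
  shows "A * (c \<cdot>\<^sub>m B) = c \<cdot>\<^sub>m (A * B)" "(c \<cdot>\<^sub>m A) * B = c \<cdot>\<^sub>m (A * B)"
  using assms by (auto intro!: eq_matI simp: mult_mat_index sum_distrib_left ac_simps)

lemma adj_diff:
  assumes "dim_row A = dim_row B" "dim_col A = dim_col B"
  shows "adj (A - B) = adj A - adj (B :: complex mat)"
  using assms by (auto intro!: eq_matI)

lemma adj_add:
  assumes "dim_row A = dim_row B" "dim_col A = dim_col B"
  shows "adj (A + B) = adj A + adj (B :: complex mat)"
  using assms by (auto intro!: eq_matI)

lemma adj_smult: "adj (c \<cdot>\<^sub>m A) = cnj c \<cdot>\<^sub>m adj (A :: complex mat)"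
  by (auto intro!: eq_matI)

lemma mat_vec_distrib:
  fixes A B :: "complex mat"
  assumes "dim_row A = dim_row B" "dim_col A = dim_vec v" "dim_col B = dim_vec v"
  shows "(A + B) *\<^sub>v v = A *\<^sub>v v + B *\<^sub>v v" "(A - B) *\<^sub>v v = A *\<^sub>v v - B *\<^sub>v v"
  using assms by (auto intro!: eq_vecI
      simp: mult_vec_index algebra_simps sum.distrib sum_subtractf sum_distrib_left)

lemma smult_mat_vec:
  fixes A :: "complex mat"
  shows "dim_col A = dim_vec v \<Longrightarrow> (c \<cdot>\<^sub>m A) *\<^sub>v v = c \<cdot>\<^sub>v (A *\<^sub>v v)"
  by (auto intro!: eq_vecI simp: mult_vec_index sum_distrib_left mult.assoc)

lemma cscalar_prod_add_left:
  fixes u v w :: "complex Matrix.vec"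
  assumes "dim_vec u = dim_vec w" "dim_vec v = dim_vec w"
  shows "(u + v) \<bullet>c w = u \<bullet>c w + v \<bullet>c w"
  using assms by (simp add: cscalar_prod_sum algebra_simps sum.distrib)

subsection \<open>The operator Jensen inequality for an isometry\<close>

lemma isometry_norm:
  fixes W :: "complex mat"
  assumes "adj W * W = 1\<^sub>m m" "dim_col W = m" "dim_vec u = m" "dim_vec v = m"
  shows "(W *\<^sub>v u) \<bullet>c (W *\<^sub>v v) = u \<bullet>c v"
  using assms by (simp add: cscalar_prod_adjoint mult_mat_vec_assoc[symmetric])

text \<open>Convexity at weight one half, evaluated at a vector: the form required for averaging a
  matrix with its reflection.\<close>

lemma operator_convex_midpoint:
  assumes "operator_convex_on I f" "spectral_decomposition n A U l" "spectral_decomposition n B V k"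
    and "\<And>i. i < n \<Longrightarrow> l i \<in> I" "\<And>i. i < n \<Longrightarrow> k i \<in> I" "dim_vec v = n"
  shows "Re ((mat_fun f ((1/2) \<cdot>\<^sub>m A + (1/2) \<cdot>\<^sub>m B) *\<^sub>v v) \<bullet>c v)
    \<le> (Re ((mat_fun f A *\<^sub>v v) \<bullet>c v) + Re ((mat_fun f B *\<^sub>v v) \<bullet>c v)) / 2"
proof -
  note h = spectral_decomposition_hermitian[OF assms(2)] spectral_decomposition_hermitian[OF assms(3)]
  have sp: "spectrum A \<subseteq> complex_of_real ` I" "spectrum B \<subseteq> complex_of_real ` I"
    using assms(4,5) by (auto simp: spectrum_def eigenvalue_spectral_decomposition[OF assms(2)]
        eigenvalue_spectral_decomposition[OF assms(3)])
  define C where "C = (1/2) \<cdot>\<^sub>m A + (1/2) \<cdot>\<^sub>m B"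
  have "loewner_le n (mat_fun f (complex_of_real (1/2) \<cdot>\<^sub>m A + complex_of_real (1 - 1/2) \<cdot>\<^sub>m B))
      (complex_of_real (1/2) \<cdot>\<^sub>m mat_fun f A + complex_of_real (1 - 1/2) \<cdot>\<^sub>m mat_fun f B)"
    using assms(1)[unfolded operator_convex_on_def, rule_format, of "1/2" n A B] h sp by simp
  then have le: "loewner_le n (mat_fun f C) ((1/2) \<cdot>\<^sub>m mat_fun f A + (1/2) \<cdot>\<^sub>m mat_fun f B)"
    by (simp add: C_def)
  have "hermitian n C"
    using hermitianD[OF h(1)] hermitianD[OF h(2)]
    by (auto simp: hermitian_def C_def adj_add adj_smult)
  note d = hermitianD[OF mat_fun_hermitian[OF this, of f]] hermitianD[OF mat_fun_hermitian[OF h(1), of f]]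
    hermitianD[OF mat_fun_hermitian[OF h(2), of f]]
  have "(((1/2) \<cdot>\<^sub>m mat_fun f A + (1/2) \<cdot>\<^sub>m mat_fun f B - mat_fun f C) *\<^sub>v v) \<bullet>c v =
     ((mat_fun f A *\<^sub>v v) \<bullet>c v + (mat_fun f B *\<^sub>v v) \<bullet>c v) / 2 - (mat_fun f C *\<^sub>v v) \<bullet>c v"
    using d assms(6)
    by (simp add: mat_vec_distrib smult_mat_vec cscalar_prod_diff cscalar_prod_add_left field_simps)
  moreover have "0 \<le> Re ((((1/2) \<cdot>\<^sub>m mat_fun f A + (1/2) \<cdot>\<^sub>m mat_fun f B - mat_fun f C) *\<^sub>v v) \<bullet>c v)"
    using le carrier_vecI[OF assms(6)] unfolding loewner_le_def pos_semidef_def by blast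
  ultimately show ?thesis by (simp add: C_def)
qed

text \<open>Conjugating with the reflection \<open>S = 2 W W\<^sup>* - 1\<close>, which fixes the range of \<open>W\<close>, turns the average
  of \<open>A\<close> and \<open>S A S\<close> into a matrix that acts on this range as \<open>W\<^sup>* A W\<close>.\<close>

lemma operator_jensen:
  assumes "operator_convex_on I f" "spectral_decomposition n A U l" "\<And>i. i < n \<Longrightarrow> l i \<in> I"
    and W: "dim_row W = n" "dim_col W = m" "adj W * W = 1\<^sub>m m" and v: "dim_vec v = m"
  shows "Re ((mat_fun f (adj W * A * W) *\<^sub>v v) \<bullet>c v)
    \<le> Re ((mat_fun f A *\<^sub>v (W *\<^sub>v v)) \<bullet>c (W *\<^sub>v v))"
proof -
  have hA: "hermitian n A" using assms(2) by (rule spectral_decomposition_hermitian)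
  note Ad = hermitianD[OF hA] and fA = hermitianD[OF mat_fun_hermitian[OF hA, of f]]
  define P where "P = W * adj W"
  define S where "S = 2 \<cdot>\<^sub>m P - 1\<^sub>m n"
  have Pd: "dim_row P = n" "dim_col P = n" by (simp_all add: P_def W)
  have Sd: "dim_row S = n" "dim_col S = n" by (simp_all add: S_def)
  have PW: "P * W = W" by (simp add: P_def mult_mat_assoc W)
  have PP: "P * P = P" by (simp add: P_def mult_mat_assoc W) (simp add: mult_mat_assoc[symmetric] W)
  have "adj P = P" by (simp add: P_def adj_mult W)
  then have Sadj: "adj S = S"
    by (simp add: S_def adj_diff adj_smult Pd)
  have SW: "S * W = W"
    by (simp add: S_def mult_diff_distrib_dim mult_smult_dim Pd W PW) (auto intro!: eq_matI)
  have SS: "S * S = 1\<^sub>m n"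
    by (simp add: S_def mult_diff_distrib_dim mult_smult_dim Pd PP) (use Pd in \<open>auto intro!: eq_matI\<close>)
  define B where "B = S * A * S"
  have Bd: "dim_row B = n" "dim_col B = n" by (simp_all add: B_def Sd)
  have B: "spectral_decomposition n B (S * U) l"
    using spectral_decomposition_conj[OF assms(2), of S] Sd SS by (auto simp: Sadj B_def)
  define C where "C = (1/2) \<cdot>\<^sub>m A + (1/2) \<cdot>\<^sub>m B"
  have hB: "hermitian n B" using B by (rule spectral_decomposition_hermitian)
  have hC: "hermitian n C"
    using Ad hermitianD[OF hB]
    by (auto simp: hermitian_def C_def adj_add adj_smult)
  have BW: "B * W = S * (A * W)"
    by (simp add: B_def mult_mat_assoc Sd Ad W SW)
  have "C * W = (1/2) \<cdot>\<^sub>m (A * W) + (1/2) \<cdot>\<^sub>m (S * (A * W))"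
    by (simp add: C_def mult_add_distrib_dim mult_smult_dim Ad Bd W BW)
  \<comment> \<open>The average of the identity and \<open>S\<close> is the projection
    \<open>P\<close>.\<close>
  also have "\<dots> = P * (A * W)"
    by (simp add: S_def mult_diff_distrib_dim mult_smult_dim Pd Ad W)
      (use Pd Ad W in \<open>auto intro!: eq_matI simp: algebra_simps\<close>)
  also have "\<dots> = W * (adj W * A * W)"
    by (simp add: P_def mult_mat_assoc W Ad)
  finally have CW: "C * W = W * (adj W * A * W)" .
  have hA': "hermitian m (adj W * A * W)"
    using hermitian_conj[OF hA W(1)] W by simp
  note fA' = hermitianD[OF mat_fun_hermitian[OF hA', of f]] and fC = hermitianD[OF mat_fun_hermitian[OF hC, of f]]
  \<comment> \<open>The range of \<open>W\<close> is invariant under \<open>C\<close>, so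
    \<open>f\<close> of \<open>C\<close> acts on it as \<open>f\<close> of the compression.\<close>
  have fCW: "mat_fun f C * W = W * mat_fun f (adj W * A * W)"
    using mat_fun_intertwining[OF hC hA' W(1,2) CW] .
  have fB: "mat_fun f B = S * mat_fun f A * S"
    unfolding mat_fun_eq[OF B] mat_fun_eq[OF assms(2)]
    using spectral_decompositionD(2,3)[OF assms(2)] Sd by (simp add: adj_mult Sadj mult_mat_assoc)
  have SWv: "S *\<^sub>v (W *\<^sub>v v) = W *\<^sub>v v"
    by (simp add: mult_mat_vec_assoc[symmetric] Sd W v SW)
  have "(mat_fun f C *\<^sub>v (W *\<^sub>v v)) \<bullet>c (W *\<^sub>v v) = (W *\<^sub>v (mat_fun f (adj W * A * W) *\<^sub>v v)) \<bullet>c (W *\<^sub>v v)"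
    by (simp add: mult_mat_vec_assoc[symmetric] fC fA' W v fCW)
  also have "\<dots> = (mat_fun f (adj W * A * W) *\<^sub>v v) \<bullet>c v"
    by (rule isometry_norm[OF W(3,2)]) (simp_all add: fA' v)
  finally have 1: "(mat_fun f C *\<^sub>v (W *\<^sub>v v)) \<bullet>c (W *\<^sub>v v) = (mat_fun f (adj W * A * W) *\<^sub>v v) \<bullet>c v" .
  \<comment> \<open>The functional calculus commutes with conjugation by \<open>S\<close>, and
    \<open>S\<close> fixes \<open>W v\<close>; hence both matrices in the average contribute the
    same value.\<close>
  have "(mat_fun f B *\<^sub>v (W *\<^sub>v v)) \<bullet>c (W *\<^sub>v v) = (S *\<^sub>v (mat_fun f A *\<^sub>v (W *\<^sub>v v))) \<bullet>c (W *\<^sub>v v)"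
    unfolding fB by (simp add: mult_mat_vec_assoc Sd fA W v SWv)
  also have "\<dots> = (mat_fun f A *\<^sub>v (W *\<^sub>v v)) \<bullet>c (W *\<^sub>v v)"
    by (subst cscalar_prod_adjoint) (simp_all add: Sd W v fA Sadj SWv)
  finally have 2: "(mat_fun f B *\<^sub>v (W *\<^sub>v v)) \<bullet>c (W *\<^sub>v v) = (mat_fun f A *\<^sub>v (W *\<^sub>v v)) \<bullet>c (W *\<^sub>v v)" .
  show ?thesis
    using operator_convex_midpoint[OF assms(1,2) B assms(3,3), of "W *\<^sub>v v"] W v
    by (simp add: C_def[symmetric] 1 2)
qed

subsection \<open>Relative modular operators and partial traces\<close>

abbreviation mat_inv_sqrt :: "complex mat \<Rightarrow> complex mat" where
  "mat_inv_sqrt \<equiv> mat_fun (\<lambda>x. 1 / sqrt x)"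

text \<open>On stacked matrices this is left multiplication by \<sigma> combined with right
  multiplication by the inverse of \<rho>.\<close>

definition modular_op :: "complex mat \<Rightarrow> complex mat \<Rightarrow> complex mat" where
  "modular_op \<rho> \<sigma> = kron \<sigma> (transpose_mat (mat_fun inverse \<rho>))"

lemma f_rel_entropy_modular:
  assumes "strictly_pos n \<rho>"
  shows "f_rel_entropy f \<rho> \<sigma> =
    Re ((mat_fun f (modular_op \<rho> \<sigma>) *\<^sub>v vec_rows (mat_fun sqrt \<rho>)) \<bullet>c vec_rows (mat_fun sqrt \<rho>))"
  by (simp add: f_rel_entropy_def modular_op_def mat_inverse_strictly_pos[OF assms])

text \<open>The eigenvalues are the ratios that \<open>admissible\<close> places in the domain. The
  transposed inverse of \<rho> has the conjugated eigenvectors, hence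
  \<open>transpose_mat (adj U)\<close>.\<close>

lemma modular_op_spectral:
  assumes "spectral_decomposition n \<rho> U p" "spectral_decomposition n \<sigma> V q"
  shows "spectral_decomposition (n * n) (modular_op \<rho> \<sigma>) (kron V (transpose_mat (adj U)))
    (\<lambda>k. q (k div n) / p (k mod n))"
proof -
  note S = spectral_decompositionD[OF assms(1)] and T = spectral_decompositionD[OF assms(2)]
  have UU: "transpose_mat U * transpose_mat (adj U) = 1\<^sub>m n"
    using S(2,3,6) by (simp add: transpose_mult_dim[symmetric])
  have "kron V (transpose_mat (adj U)) \<in> carrier_mat (n * n) (n * n)"
    using S(2,3) T(2,3) by auto
  moreover have "adj (kron V (transpose_mat (adj U))) * kron V (transpose_mat (adj U)) = 1\<^sub>m (n * n)"
    using S(2,3) T(2,3) by (simp add: kron_adjoint adj_transpose kron_mult T(6) UU kron_one)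
  moreover have "modular_op \<rho> \<sigma> = kron V (transpose_mat (adj U)) *
      mat_diag (n * n) (\<lambda>k. complex_of_real (q (k div n) / p (k mod n))) *
      adj (kron V (transpose_mat (adj U)))"
  proof -
    have "mat_diag (n * n) (\<lambda>k. complex_of_real (q (k div n) / p (k mod n))) =
        kron (real_diag n q) (real_diag n (\<lambda>i. inverse (p i)))"
      by (simp add: kron_diag divide_inverse)
    moreover have "transpose_mat (mat_fun inverse \<rho>) = transpose_mat (adj U) *
        real_diag n (\<lambda>i. inverse (p i)) * transpose_mat U"
      using S(2,3) by (simp add: mat_fun_eq[OF assms(1)] transpose_mult_dim mult_mat_assoc)
    ultimately show ?thesis
      unfolding modular_op_def using S(2,3) T(2,3)
      by (simp add: kron_adjoint adj_transpose kron_mult) (simp flip: T(8))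
  qed
  ultimately show ?thesis unfolding spectral_decomposition_def by blast
qed

lemma admissible_modular_op:
  assumes "admissible I n \<rho> \<sigma>"
  obtains U l where "spectral_decomposition (n * n) (modular_op \<rho> \<sigma>) U l" "\<And>k. k < n * n \<Longrightarrow> l k \<in> I"
proof -
  obtain U p V q where U: "spectral_decomposition n \<rho> U p" and V: "spectral_decomposition n \<sigma> V q"
    using assms strictly_pos_spectral_obtains unfolding admissible_def by metis
  have "q (k div n) / p (k mod n) \<in> I" if "k < n * n" for k
    using assms div_mod_less[OF that] unfolding admissible_def
      eigenvalue_spectral_decomposition[OF U] eigenvalue_spectral_decomposition[OF V] by blast
  then show ?thesis using that modular_op_spectral[OF U V] by blast
qed

lemma modular_op_mult_vec_rows:
  assumes "hermitian n \<rho>" "dim_row \<sigma> = n" "dim_col \<sigma> = n" "dim_row X = n" "dim_col X = n"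
  shows "modular_op \<rho> \<sigma> *\<^sub>v vec_rows X = vec_rows (\<sigma> * X * mat_fun inverse \<rho>)"
  using hermitianD[OF mat_fun_hermitian[OF assms(1), of inverse]] assms(2-)
  by (simp add: modular_op_def kron_mult_vec_rows)

text \<open>
  The isometries \<open>J 0, \<dots>, J (K - 1)\<close> embed an \<open>m\<close>-dimensional factor into an \<open>N\<close>-dimensional space along
  the basis vectors of a complementary factor of dimension \<open>K\<close>; \<open>reduce\<close> is the partial
  trace over the latter.
\<close>

locale factor_embedding =
  fixes N m K :: nat and J :: "nat \<Rightarrow> complex mat"
  assumes J_dim [simp]: "k < K \<Longrightarrow> dim_row (J k) = N" "k < K \<Longrightarrow> dim_col (J k) = m"
    and J_orth: "k < K \<Longrightarrow> l < K \<Longrightarrow> adj (J k) * J l = (if k = l then 1\<^sub>m m else 0\<^sub>m m m)"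
    and J_complete: "mat_sum N N K (\<lambda>k. J k * adj (J k)) = 1\<^sub>m N"
begin

definition reduce :: "complex mat \<Rightarrow> complex mat" where
  "reduce A = mat_sum m m K (\<lambda>k. adj (J k) * A * J k)"

lemma mult_reduce_mult:
  assumes "dim_col A = m" "dim_row B = m" "dim_row X = N" "dim_col X = N"
  shows "A * (reduce X * B) = mat_sum (dim_row A) (dim_col B) K (\<lambda>k. A * adj (J k) * X * J k * B)"
proof -
  have "A * (reduce X * B) = mat_sum (dim_row A) (dim_col B) K (\<lambda>k. A * (adj (J k) * X * J k * B))"
    unfolding reduce_def using assms by (simp add: mat_sum_mult_right mat_sum_mult_left)
  also have "\<dots> = mat_sum (dim_row A) (dim_col B) K (\<lambda>k. A * adj (J k) * X * J k * B)"
    by (intro mat_sum_cong) (simp add: mult_mat_assoc assms)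
  finally show ?thesis .
qed

text \<open>On unstacked matrices it sends \<open>X\<close> to
  \<open>L * mat_fun sqrt \<rho>\<close>, where \<open>L\<close> is the lift of
  \<open>X * mat_inv_sqrt (reduce \<rho>)\<close>. The lift of \<open>Y\<close>, the sum of all
  \<open>J k * Y * adj (J k)\<close>, is \<open>Y\<close> tensored with the identity of the factor
  that \<open>reduce\<close> removes.\<close>

definition petz_isometry :: "complex mat \<Rightarrow> complex mat" where
  "petz_isometry \<rho> = mat_sum (N * N) (m * m) K
     (\<lambda>k. kron (J k) (transpose_mat (mat_inv_sqrt (reduce \<rho>) * adj (J k) * mat_fun sqrt \<rho>)))"

lemma reduce_dim [simp]: "dim_row (reduce A) = m" "dim_col (reduce A) = m"
  by (simp_all add: reduce_def)

lemma petz_isometry_dim [simp]: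
  "dim_row (petz_isometry \<rho>) = N * N" "dim_col (petz_isometry \<rho>) = m * m"
  by (simp_all add: petz_isometry_def)

context
  fixes \<rho> :: "complex mat"
  assumes pos: "strictly_pos N \<rho>" and pos': "strictly_pos m (reduce \<rho>)"
begin

private lemma h: "hermitian N \<rho>" and h': "hermitian m (reduce \<rho>)"
  using pos pos' by (simp_all add: strictly_pos_def)

private lemma fun_dim [simp]:
  "dim_row (mat_fun f \<rho>) = N" "dim_col (mat_fun f \<rho>) = N" "adj (mat_fun f \<rho>) = mat_fun f \<rho>"
  "dim_row (mat_fun f (reduce \<rho>)) = m" "dim_col (mat_fun f (reduce \<rho>)) = m"
  "adj (mat_fun f (reduce \<rho>)) = mat_fun f (reduce \<rho>)"
  using hermitianD[OF mat_fun_hermitian[OF h, of f]] hermitianD[OF mat_fun_hermitian[OF h', of f]] by simp_all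

private lemma rho_dim [simp]: "dim_row \<rho> = N" "dim_col \<rho> = N"
  using hermitianD[OF h] by simp_all

private lemma root_inverse:
  "mat_inv_sqrt (reduce \<rho>) * mat_inv_sqrt (reduce \<rho>) = mat_fun inverse (reduce \<rho>)"
  by (rule mat_fun_pos_mult[OF pos']) (simp add: field_simps)

private lemma root_rho_root: "mat_inv_sqrt (reduce \<rho>) * (reduce \<rho> * mat_inv_sqrt (reduce \<rho>)) = 1\<^sub>m m"
proof -
  have "mat_inv_sqrt (reduce \<rho>) * (mat_fun (\<lambda>x. x) (reduce \<rho>) * mat_inv_sqrt (reduce \<rho>)) = 1\<^sub>m m"
    unfolding mat_fun_mult[OF h'] by (rule mat_fun_pos_one[OF pos']) (simp add: field_simps)
  then show ?thesis by (simp add: mat_fun_id[OF h'])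
qed

private lemma sqrt_root: "mat_fun sqrt (reduce \<rho>) * mat_inv_sqrt (reduce \<rho>) = 1\<^sub>m m"
  unfolding mat_fun_mult[OF h'] by (rule mat_fun_pos_one[OF pos']) simp

lemma petz_isometry_mult_vec_rows:
  assumes "dim_row X = m" "dim_col X = m"
  shows "petz_isometry \<rho> *\<^sub>v vec_rows X =
    vec_rows (mat_sum N N K (\<lambda>k. J k * (X * mat_inv_sqrt (reduce \<rho>)) * adj (J k)) * mat_fun sqrt \<rho>)"
proof -
  have "petz_isometry \<rho> *\<^sub>v vec_rows X = vec_rows (mat_sum N N K
      (\<lambda>k. J k * X * (mat_inv_sqrt (reduce \<rho>) * adj (J k) * mat_fun sqrt \<rho>)))"
    unfolding petz_isometry_def using mat_sum_mult_vec_rows[of K J N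
      "\<lambda>k. transpose_mat (mat_inv_sqrt (reduce \<rho>) * adj (J k) * mat_fun sqrt \<rho>)" N X] assms
    by simp
  also have "mat_sum N N K (\<lambda>k. J k * X * (mat_inv_sqrt (reduce \<rho>) * adj (J k) * mat_fun sqrt \<rho>))
      = mat_sum N N K (\<lambda>k. J k * (X * mat_inv_sqrt (reduce \<rho>)) * adj (J k)) * mat_fun sqrt \<rho>"
  proof -
    have "mat_sum N N K (\<lambda>k. J k * X * (mat_inv_sqrt (reduce \<rho>) * adj (J k) * mat_fun sqrt \<rho>))
      = mat_sum N N K (\<lambda>k. J k * (X * mat_inv_sqrt (reduce \<rho>)) * adj (J k) * mat_fun sqrt \<rho>)"
      by (intro mat_sum_cong) (simp add: mult_mat_assoc assms)
    then show ?thesis by (subst mat_sum_mult_right) simp_all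
  qed
  finally show ?thesis .
qed

text \<open>The root cancels the inverse root, and the lift of the identity is the identity by
  \<open>J_complete\<close>.\<close>

lemma petz_isometry_sqrt:
  "petz_isometry \<rho> *\<^sub>v vec_rows (mat_fun sqrt (reduce \<rho>)) = vec_rows (mat_fun sqrt \<rho>)"
proof -
  have "mat_sum N N K (\<lambda>k. J k * (mat_fun sqrt (reduce \<rho>) * mat_inv_sqrt (reduce \<rho>)) * adj (J k))
      = mat_sum N N K (\<lambda>k. J k * adj (J k))"
    by (rule mat_sum_cong) (simp add: sqrt_root)
  then show ?thesis
    by (simp add: petz_isometry_mult_vec_rows J_complete)
qed

text \<open>Both the isometry property and the compression of the modular operator are instances of this.\<close>

private lemma compress:
  assumes "dim_row A = N" "dim_col A = N" "dim_row B = N" "dim_col B = N"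
    and eq: "\<And>k l. k < K \<Longrightarrow> l < K \<Longrightarrow>
      kron (adj (J k) * A * J l)
        (transpose_mat (mat_inv_sqrt (reduce \<rho>) * adj (J l) * mat_fun sqrt \<rho> * B *
          mat_fun sqrt \<rho> * J k * mat_inv_sqrt (reduce \<rho>))) =
      (if k = l then G k else 0\<^sub>m (m * m) (m * m))"
  shows "adj (petz_isometry \<rho>) * kron A (transpose_mat B) * petz_isometry \<rho> = mat_sum (m * m) (m * m) K G"
proof -
  define M where "M = (\<lambda>k. transpose_mat (mat_inv_sqrt (reduce \<rho>) * adj (J k) * mat_fun sqrt \<rho>))"
  have M: "dim_row (M k) = N" "dim_col (M k) = m" if "k < K" for k using that by (simp_all add: M_def)
  have "petz_isometry \<rho> = mat_sum (N * N) (m * m) K (\<lambda>k. kron (J k) (M k))"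
    by (simp add: petz_isometry_def M_def)
  note W = this
  have "kron A (transpose_mat B) * petz_isometry \<rho> = mat_sum (N * N) (m * m) K (\<lambda>l. kron (A * J l) (transpose_mat B * M l))"
    unfolding W using assms M by (subst mat_sum_mult_left) (auto simp: kron_mult intro!: mat_sum_cong)
  moreover have "adj (petz_isometry \<rho>) = mat_sum (m * m) (N * N) K (\<lambda>k. kron (adj (J k)) (adj (M k)))"
    unfolding W using M by (subst mat_sum_adjoint) (auto simp: kron_adjoint)
  ultimately have "adj (petz_isometry \<rho>) * (kron A (transpose_mat B) * petz_isometry \<rho>) =
      mat_sum (m * m) (m * m) K (\<lambda>k. mat_sum (m * m) (m * m) K (\<lambda>l.
        kron (adj (J k)) (adj (M k)) * kron (A * J l) (transpose_mat B * M l)))"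
    using assms M by (simp, subst mat_sum_mult_right) (auto simp: mat_sum_mult_left intro!: mat_sum_cong)
  also have "\<dots> = mat_sum (m * m) (m * m) K (\<lambda>k. mat_sum (m * m) (m * m) K (\<lambda>l.
      if k = l then G k else 0\<^sub>m (m * m) (m * m)))"
  proof (intro mat_sum_cong)
    fix k l assume kl: "k < K" "l < K"
    \<comment> \<open>Transposition reverses products: in the second tensor factor \<open>l\<close>
      stands to the left of \<open>k\<close>, in the first one to the right.\<close>
    have "adj (M k) * (transpose_mat B * M l) = transpose_mat (mat_inv_sqrt (reduce \<rho>) * adj (J l) * mat_fun sqrt \<rho> * B *
          mat_fun sqrt \<rho> * J k * mat_inv_sqrt (reduce \<rho>))"
      using kl assms unfolding M_def
      by (simp add: adj_transpose adj_mult mult_mat_assoc transpose_mult_dim)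
    then show "kron (adj (J k)) (adj (M k)) * kron (A * J l) (transpose_mat B * M l) =
        (if k = l then G k else 0\<^sub>m (m * m) (m * m))"
      using kl assms(1-4) M eq[OF kl] by (simp add: kron_mult mult_mat_assoc)
  qed
  also have "\<dots> = mat_sum (m * m) (m * m) K G" (is "_ = ?R")
  proof (rule eq_mat_dimI[of "m * m" "m * m"])
    fix i j assume ij: "i < m * m" "j < m * m"
    have "(\<Sum>k<K. \<Sum>l<K. (if k = l then G k else 0\<^sub>m (m * m) (m * m)) $$ (i, j)) =
       (\<Sum>k<K. \<Sum>l<K. if k = l then G k $$ (i, j) else 0)"
      using ij by (intro sum.cong) auto
    then show "mat_sum (m * m) (m * m) K (\<lambda>k. mat_sum (m * m) (m * m) K (\<lambda>l.
        if k = l then G k else 0\<^sub>m (m * m) (m * m))) $$ (i, j) = ?R $$ (i, j)"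
      using ij by (simp add: mat_sum_index)
  qed auto
  finally show ?thesis
    using assms by (simp add: mult_mat_assoc)
qed

text \<open>Here the first tensor factor is diagonal in \<open>k\<close> and \<open>l\<close> by
  orthogonality of the embeddings, and the second factors add up to \<open>reduce \<rho>\<close>
  between two inverse roots of itself.\<close>

lemma petz_isometry_isometry:
  "adj (petz_isometry \<rho>) * petz_isometry \<rho> = 1\<^sub>m (m * m)"
proof -
  let ?t = "mat_inv_sqrt (reduce \<rho>)"
  have "adj (petz_isometry \<rho>) * kron (1\<^sub>m N) (transpose_mat (1\<^sub>m N)) * petz_isometry \<rho> =
     mat_sum (m * m) (m * m) K (\<lambda>k. kron (1\<^sub>m m) (transpose_mat (?t * adj (J k) * \<rho> * J k * ?t)))"
  proof (rule compress)
    fix k l assume kl: "k < K" "l < K"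
    have "?t * adj (J k) * mat_fun sqrt \<rho> * 1\<^sub>m N * mat_fun sqrt \<rho> * J k * ?t =
       ?t * adj (J k) * \<rho> * J k * ?t" if "k = l"
      using kl by (subst (3) mat_fun_sqrt(1)[OF pos, symmetric]) (simp add: mult_mat_assoc that)
    moreover have "kron (0\<^sub>m m m) X = 0\<^sub>m (m * m) (m * m)" if "dim_row X = m" "dim_col X = m" for X
      using that by (auto intro!: eq_matI simp: kron_index div_mod_less)
    ultimately show "kron (adj (J k) * 1\<^sub>m N * J l)
        (transpose_mat (?t * adj (J l) * mat_fun sqrt \<rho> * 1\<^sub>m N * mat_fun sqrt \<rho> * J k * ?t)) =
        (if k = l then kron (1\<^sub>m m) (transpose_mat (?t * adj (J k) * \<rho> * J k * ?t)) else 0\<^sub>m (m * m) (m * m))"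
      using kl by (cases "k = l") (simp_all add: J_orth)
  qed auto
  also have "\<dots> = kron (1\<^sub>m m) (transpose_mat (?t * (reduce \<rho> * ?t)))"
  proof -
    have "?t * (reduce \<rho> * ?t) = mat_sum m m K (\<lambda>k. ?t * adj (J k) * \<rho> * J k * ?t)"
      by (simp add: mult_reduce_mult)
    then show ?thesis
      by (intro eq_matI) (auto simp: mat_sum_index kron_index div_mod_less sum_distrib_left)
  qed
  also have "\<dots> = 1\<^sub>m (m * m)" by (simp add: root_rho_root kron_one)
  finally show ?thesis by (simp add: kron_one)
qed

text \<open>The roles are exchanged: the roots of \<rho> cancel its inverse, so the second tensor
  factor is diagonal in \<open>k\<close> and \<open>l\<close>, and the first factors add up to
  \<open>reduce \<sigma>\<close>.\<close>

lemma petz_isometry_modular: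
  assumes "dim_row \<sigma> = N" "dim_col \<sigma> = N"
  shows "adj (petz_isometry \<rho>) * modular_op \<rho> \<sigma> * petz_isometry \<rho> = modular_op (reduce \<rho>) (reduce \<sigma>)"
proof -
  let ?t = "mat_inv_sqrt (reduce \<rho>)"
  have "adj (petz_isometry \<rho>) * kron \<sigma> (transpose_mat (mat_fun inverse \<rho>)) * petz_isometry \<rho> =
     mat_sum (m * m) (m * m) K (\<lambda>k. kron (adj (J k) * \<sigma> * J k) (transpose_mat (mat_fun inverse (reduce \<rho>))))"
  proof (rule compress)
    fix k l assume kl: "k < K" "l < K"
    have "?t * adj (J l) * mat_fun sqrt \<rho> * mat_fun inverse \<rho> * mat_fun sqrt \<rho> * J k * ?t =
       ?t * (adj (J l) * (mat_fun sqrt \<rho> * (mat_fun inverse \<rho> * mat_fun sqrt \<rho>)) * J k) * ?t"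
      using kl by (simp add: mult_mat_assoc)
    also have "\<dots> = (if k = l then mat_fun inverse (reduce \<rho>) else 0\<^sub>m m m)"
      using kl by (auto simp: J_orth mat_fun_sqrt(2)[OF pos] root_inverse)
    finally have "?t * adj (J l) * mat_fun sqrt \<rho> * mat_fun inverse \<rho> * mat_fun sqrt \<rho> * J k * ?t =
      (if k = l then mat_fun inverse (reduce \<rho>) else 0\<^sub>m m m)" .
    moreover have "kron X (transpose_mat (0\<^sub>m m m)) = 0\<^sub>m (m * m) (m * m)" if "dim_row X = m" "dim_col X = m" for X
      using that by (auto intro!: eq_matI simp: kron_index div_mod_less)
    ultimately show "kron (adj (J k) * \<sigma> * J l)
        (transpose_mat (?t * adj (J l) * mat_fun sqrt \<rho> * mat_fun inverse \<rho> * mat_fun sqrt \<rho> * J k * ?t)) =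
        (if k = l then kron (adj (J k) * \<sigma> * J k) (transpose_mat (mat_fun inverse (reduce \<rho>))) else 0\<^sub>m (m * m) (m * m))"
      using kl assms by simp
  qed (use assms in auto)
  also have "\<dots> = kron (reduce \<sigma>) (transpose_mat (mat_fun inverse (reduce \<rho>)))"
    by (intro eq_matI) (auto simp: mat_sum_index kron_index div_mod_less sum_distrib_right reduce_def[of \<sigma>])
  finally show ?thesis by (simp add: modular_op_def)
qed

end

theorem data_processing:
  assumes "operator_convex_on I f" "admissible I N \<rho> \<sigma>" "strictly_pos m (reduce \<rho>)"
  shows "f_rel_entropy f (reduce \<rho>) (reduce \<sigma>) \<le> f_rel_entropy f \<rho> \<sigma>"
proof -
  have pos: "strictly_pos N \<rho>" "strictly_pos N \<sigma>" using assms(2) by (simp_all add: admissible_def)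
  obtain U l where S: "spectral_decomposition (N * N) (modular_op \<rho> \<sigma>) U l" and I: "\<And>k. k < N * N \<Longrightarrow> l k \<in> I"
    using admissible_modular_op[OF assms(2)] by metis
  have \<sigma>: "dim_row \<sigma> = N" "dim_col \<sigma> = N"
    using pos(2) hermitianD by (auto simp: strictly_pos_def)
  have s: "dim_vec (vec_rows (mat_fun sqrt (reduce \<rho>))) = m * m"
    using hermitianD(1,2)[OF mat_fun_hermitian[of m "reduce \<rho>" sqrt]] assms(3) by (simp add: strictly_pos_def)
  show ?thesis
    using operator_jensen[OF assms(1) S I petz_isometry_dim petz_isometry_isometry[OF pos(1) assms(3)] s]
    by (simp add: petz_isometry_sqrt petz_isometry_modular pos assms(3) \<sigma>
        f_rel_entropy_modular[OF pos(1)] f_rel_entropy_modular[OF assms(3)])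
qed

end

subsection \<open>Equality in the operator Jensen inequality for diffused functions\<close>

lemma mat_fun_affine:
  assumes "hermitian n A"
  shows "mat_fun (\<lambda>t. c + e * t) A = complex_of_real c \<cdot>\<^sub>m 1\<^sub>m n + complex_of_real e \<cdot>\<^sub>m A"
proof -
  obtain U l where U: "spectral_decomposition n A U l" using assms spectral_theorem by blast
  note S = spectral_decompositionD[OF U]
  have "real_diag n (\<lambda>i. c + e * l i) =
      complex_of_real c \<cdot>\<^sub>m 1\<^sub>m n + complex_of_real e \<cdot>\<^sub>m real_diag n l"
    by (intro eq_matI) auto
  then show ?thesis
    unfolding mat_fun_eq[OF U]
    by (simp add: mult_add_distrib_dim mult_smult_dim S(2,3,7)) (simp flip: S(8))
qed

text \<open>A nondegenerate interval has positive measure and is not contained in a null set. This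
  later supplies parameters arbitrarily close to zero.\<close>

lemma AE_lborel_interval:
  assumes "AE x in lborel. P x" "c < (d :: real)"
  shows "\<exists>x. c < x \<and> x < d \<and> P x"
proof (rule ccontr)
  assume no: "\<not> ?thesis"
  obtain N where N: "N \<in> null_sets lborel" "{x. \<not> P x} \<subseteq> N"
    using assms(1) by (auto simp: eventually_ae_filter)
  have "{c<..<d} \<subseteq> N" using no N(2) by auto
  then have "emeasure lborel {c<..<d} \<le> emeasure lborel N"
    using N(1) by (intro emeasure_mono) auto
  then show False using N(1) assms(2) by (auto simp: null_sets_def)
qed

lemma spectral_weights:
  assumes "spectral_decomposition n A U l" "dim_vec v = n"
  shows "Re ((mat_fun f A *\<^sub>v v) \<bullet>c v) = (\<Sum>i<n. f (l i) * (cmod (vec_index (adj U *\<^sub>v v) i))\<^sup>2)"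
  by (simp add: quadratic_form_spectral[OF mat_fun_spectral_decomposition[OF assms(1)] assms(2)])

lemma positive_form_eq_0:
  assumes "spectral_decomposition n A U l" "dim_vec z = n" "\<And>i. i < n \<Longrightarrow> f (l i) > 0"
    and "Re ((mat_fun f A *\<^sub>v z) \<bullet>c z) = 0"
  shows "z = 0\<^sub>v n"
proof -
  note S = spectral_decompositionD[OF assms(1)]
  have "(\<Sum>i<n. f (l i) * (cmod (vec_index (adj U *\<^sub>v z) i))\<^sup>2) = 0"
    using assms by (simp add: spectral_weights)
  moreover have "f (l i) * (cmod (vec_index (adj U *\<^sub>v z) i))\<^sup>2 \<ge> 0" if "i < n" for i
    using assms(3)[OF that] by simp
  ultimately have "f (l i) * (cmod (vec_index (adj U *\<^sub>v z) i))\<^sup>2 = 0" if "i < n" for i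
    using that by (subst (asm) sum_nonneg_eq_0_iff) auto
  then have "vec_index (adj U *\<^sub>v z) i = 0" if "i < n" for i
    using assms(3)[OF that] that by force
  then have "adj U *\<^sub>v z = 0\<^sub>v n"
    using S(3) by (intro eq_vecI) auto
  then have "U *\<^sub>v (adj U *\<^sub>v z) = U *\<^sub>v 0\<^sub>v n" by simp
  moreover have "U *\<^sub>v 0\<^sub>v n = 0\<^sub>v n"
    using S(2,3) by (intro eq_vecI) (auto simp: mult_vec_index)
  ultimately show ?thesis
    using S(2,3,7) assms(2) by (simp add: mult_mat_vec_assoc[symmetric])
qed

text \<open>
  The defect of Jensen's inequality for the resolvent function is the square norm of
  \<open>R W v - W R' v\<close> in the form defined by \<open>R\<^sup>-\<^sup>1\<close>.
\<close>

lemma resolvent_defect: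
  fixes c e :: real
  assumes A: "spectral_decomposition n A U l" and B: "spectral_decomposition m (adj W * A * W) V k"
    and W: "dim_row W = n" "dim_col W = m" "adj W * W = 1\<^sub>m m" and v: "dim_vec v = m"
    and pos: "\<And>i. i < n \<Longrightarrow> c + e * l i > 0" "\<And>j. j < m \<Longrightarrow> c + e * k j > 0"
  defines "r \<equiv> \<lambda>t. 1 / (c + e * t)"
  defines "w \<equiv> mat_fun r (adj W * A * W) *\<^sub>v v"
  defines "D \<equiv> Re ((mat_fun r A *\<^sub>v (W *\<^sub>v v)) \<bullet>c (W *\<^sub>v v)) - Re (w \<bullet>c v)"
  shows "D \<ge> 0" and "D = 0 \<Longrightarrow> e \<noteq> 0 \<Longrightarrow> A *\<^sub>v (W *\<^sub>v w) = W *\<^sub>v ((adj W * A * W) *\<^sub>v w)"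
proof -
  define B where "B = adj W * A * W"
  define q where "q = (\<lambda>t. c + e * t)"
  define Q where "Q = mat_fun q A"
  define Q' where "Q' = mat_fun q B"
  define R where "R = mat_fun r A"
  have hA: "hermitian n A" using A by (rule spectral_decomposition_hermitian)
  have hB: "hermitian m B" using assms(2) unfolding B_def by (rule spectral_decomposition_hermitian)
  note Ad = hermitianD[OF hA] and Bd = hermitianD[OF hB]
  have Qd: "dim_row Q = n" "dim_col Q = n" "adj Q = Q"
    and Q'd: "dim_row Q' = m" "dim_col Q' = m"
    and Rd: "dim_row R = n" "dim_col R = n" "adj R = R"
    and rB: "dim_row (mat_fun r B) = m" "dim_col (mat_fun r B) = m"
    using hermitianD[OF mat_fun_hermitian[OF hA, of q]] hermitianD[OF mat_fun_hermitian[OF hB, of q]]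
      hermitianD[OF mat_fun_hermitian[OF hA, of r]] hermitianD[OF mat_fun_hermitian[OF hB, of r]]
    by (simp_all add: Q_def Q'_def R_def)
  have w: "w = mat_fun r B *\<^sub>v v" by (simp add: w_def B_def)
  have wd: "dim_vec w = m" by (simp add: w rB)
  have QR: "Q * R = 1\<^sub>m n"
  proof -
    have "mat_fun (\<lambda>t. q t * r t) A = mat_fun (\<lambda>t. 1) A"
      by (rule mat_fun_cong[OF A]) (use pos(1) in \<open>force simp: q_def r_def\<close>)
    then show ?thesis by (simp add: Q_def R_def mat_fun_mult[OF hA] mat_fun_const_one[OF hA])
  qed
  have RQ: "R * Q = 1\<^sub>m n"
    by (rule left_inverse_imp_right_inverse[OF QR carrier_matI[OF Qd(1,2)] carrier_matI[OF Rd(1,2)]])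
  have QR': "Q' * mat_fun r B = 1\<^sub>m m"
  proof -
    have "mat_fun (\<lambda>t. q t * r t) B = mat_fun (\<lambda>t. 1) B"
      by (rule mat_fun_cong[OF assms(2)[folded B_def]]) (use pos(2) in \<open>force simp: q_def r_def\<close>)
    then show ?thesis by (simp add: Q'_def mat_fun_mult[OF hB] mat_fun_const_one[OF hB])
  qed
  have Q: "Q = complex_of_real c \<cdot>\<^sub>m 1\<^sub>m n + complex_of_real e \<cdot>\<^sub>m A"
    unfolding Q_def q_def by (rule mat_fun_affine[OF hA])
  have Q': "Q' = complex_of_real c \<cdot>\<^sub>m 1\<^sub>m m + complex_of_real e \<cdot>\<^sub>m B"
    unfolding Q'_def q_def by (rule mat_fun_affine[OF hB])
  \<comment> \<open>Compression by an isometry commutes with affine functions.\<close>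
  have WQW: "adj W * (Q * W) = Q'"
    unfolding Q Q' by (simp add: mult_add_distrib_dim mult_smult_dim W Ad B_def mult_mat_assoc)
  define y where "y = W *\<^sub>v v"
  \<comment> \<open>Since \<open>Q\<close> is the inverse of \<open>R\<close>, the form of
    \<open>Q\<close> at \<open>z\<close> expands into four terms; apart from the form of
    \<open>R\<close> at \<open>y\<close>, each equals the inner product of \<open>w\<close> and
    \<open>v\<close> up to sign, and the total is \<open>D\<close>.\<close>
  define z where "z = R *\<^sub>v y - W *\<^sub>v w"
  have yd: "dim_vec y = n" and zd: "dim_vec z = n" by (simp_all add: y_def z_def W)
  have Qz: "Q *\<^sub>v z = y - Q *\<^sub>v (W *\<^sub>v w)"
  proof -
    have "Q *\<^sub>v z = Q *\<^sub>v (R *\<^sub>v y) - Q *\<^sub>v (W *\<^sub>v w)"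
      unfolding z_def using Qd Rd yd wd W
      by (intro eq_vecI) (auto simp: mult_vec_index algebra_simps sum_subtractf)
    then show ?thesis using Qd Rd yd by (simp add: mult_mat_vec_assoc[symmetric] QR)
  qed
  have 1: "y \<bullet>c (W *\<^sub>v w) = v \<bullet>c w"
    unfolding y_def by (rule isometry_norm[OF W(3,2) v wd])
  have 2: "(Q *\<^sub>v (W *\<^sub>v w)) \<bullet>c (R *\<^sub>v y) = w \<bullet>c v"
  proof -
    have "(Q *\<^sub>v (W *\<^sub>v w)) \<bullet>c (R *\<^sub>v y) = (R *\<^sub>v (Q *\<^sub>v (W *\<^sub>v w))) \<bullet>c y"
      by (subst (2) cscalar_prod_adjoint) (simp_all add: Rd Qd yd)
    also have "R *\<^sub>v (Q *\<^sub>v (W *\<^sub>v w)) = W *\<^sub>v w"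
      by (simp add: mult_mat_vec_assoc[symmetric] Rd Qd W wd) (simp add: mult_mat_assoc[symmetric] Rd Qd W RQ)
    finally show ?thesis
      unfolding y_def using isometry_norm[OF W(3,2) wd v] by simp
  qed
  have 3: "(Q *\<^sub>v (W *\<^sub>v w)) \<bullet>c (W *\<^sub>v w) = v \<bullet>c w"
  proof -
    have "(Q *\<^sub>v (W *\<^sub>v w)) \<bullet>c (W *\<^sub>v w) = (W *\<^sub>v w) \<bullet>c (Q *\<^sub>v (W *\<^sub>v w))"
      by (subst cscalar_prod_adjoint) (simp_all add: Qd W)
    also have "\<dots> = w \<bullet>c (adj W *\<^sub>v (Q *\<^sub>v (W *\<^sub>v w)))"
      by (subst cscalar_prod_adjoint) (simp_all add: Qd W wd)
    also have "adj W *\<^sub>v (Q *\<^sub>v (W *\<^sub>v w)) = Q' *\<^sub>v w"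
      by (simp add: mult_mat_vec_assoc[symmetric] Qd W wd mult_mat_assoc WQW)
    also have "Q' *\<^sub>v w = v"
      unfolding w by (simp add: mult_mat_vec_assoc[symmetric] Q'd rB v QR')
    also have "w \<bullet>c v = v \<bullet>c w"
    proof -
      have "(mat_fun r B *\<^sub>v v) \<bullet>c v = v \<bullet>c (mat_fun r B *\<^sub>v v)"
        by (subst cscalar_prod_adjoint) (simp_all add: rB v hermitianD(3)[OF mat_fun_hermitian[OF hB]])
      then show ?thesis by (simp add: w)
    qed
    finally show ?thesis .
  qed
  have "(Q *\<^sub>v z) \<bullet>c z = y \<bullet>c (R *\<^sub>v y) - y \<bullet>c (W *\<^sub>v w)
      - ((Q *\<^sub>v (W *\<^sub>v w)) \<bullet>c (R *\<^sub>v y) - (Q *\<^sub>v (W *\<^sub>v w)) \<bullet>c (W *\<^sub>v w))"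
    unfolding Qz unfolding z_def by (simp add: cscalar_prod_diff yd Qd Rd W)
  also have "\<dots> = y \<bullet>c (R *\<^sub>v y) - w \<bullet>c v" by (simp add: 1 2 3)
  also have "y \<bullet>c (R *\<^sub>v y) = (R *\<^sub>v y) \<bullet>c y"
    by (subst cscalar_prod_adjoint) (simp_all add: Rd yd)
  finally have D: "D = Re ((mat_fun q A *\<^sub>v z) \<bullet>c z)"
    by (simp add: D_def y_def R_def Q_def)
  have "Re ((mat_fun q A *\<^sub>v z) \<bullet>c z) \<ge> 0"
    unfolding spectral_weights[OF A zd]
    by (intro sum_nonneg mult_nonneg_nonneg) (use pos(1) in \<open>force simp: q_def\<close>)+
  then show "D \<ge> 0" by (simp add: D)
  show "A *\<^sub>v (W *\<^sub>v w) = W *\<^sub>v ((adj W * A * W) *\<^sub>v w)" if "D = 0" "e \<noteq> 0"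
  proof -
    have "z = 0\<^sub>v n"
      using positive_form_eq_0[OF A zd, of q] pos(1) D that(1) by (simp add: q_def)
    then have z0: "y - Q *\<^sub>v (W *\<^sub>v w) = Q *\<^sub>v 0\<^sub>v n" by (simp add: Qz[symmetric])
    have eq: "vec_index (Q *\<^sub>v (W *\<^sub>v w)) i = vec_index y i" if "i < n" for i
    proof -
      have "vec_index (y - Q *\<^sub>v (W *\<^sub>v w)) i = 0"
        unfolding z0 using that Qd by (simp add: mult_vec_index)
      then show ?thesis using that Qd by simp
    qed
    \<comment> \<open>So \<open>Q\<close> and \<open>Q'\<close> are intertwined by \<open>W\<close>
      at \<open>w\<close>. The constant parts cancel, and the nonzero slope \<open>e\<close> can be
      divided out.\<close>
    have "Q *\<^sub>v (W *\<^sub>v w) = y" by (rule eq_vecI) (auto simp: eq yd Qd)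
    also have "y = W *\<^sub>v (Q' *\<^sub>v w)"
      unfolding y_def w by (simp add: mult_mat_vec_assoc[symmetric] Q'd rB v QR')
    finally have "complex_of_real c \<cdot>\<^sub>v (W *\<^sub>v w) + complex_of_real e \<cdot>\<^sub>v (A *\<^sub>v (W *\<^sub>v w)) =
       W *\<^sub>v (complex_of_real c \<cdot>\<^sub>v w + complex_of_real e \<cdot>\<^sub>v (B *\<^sub>v w))"
      by (simp add: Q Q' mat_vec_distrib smult_mat_vec Ad Bd W wd)
    also have "W *\<^sub>v (complex_of_real c \<cdot>\<^sub>v w + complex_of_real e \<cdot>\<^sub>v (B *\<^sub>v w)) =
       complex_of_real c \<cdot>\<^sub>v (W *\<^sub>v w) + complex_of_real e \<cdot>\<^sub>v (W *\<^sub>v (B *\<^sub>v w))"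
      using W wd Bd by (intro eq_vecI)
        (auto simp: mult_vec_index[of _ W] sum.distrib sum_distrib_left algebra_simps simp del: mult_vec_index)
    finally have eq: "complex_of_real c \<cdot>\<^sub>v (W *\<^sub>v w) + complex_of_real e \<cdot>\<^sub>v (A *\<^sub>v (W *\<^sub>v w)) =
       complex_of_real c \<cdot>\<^sub>v (W *\<^sub>v w) + complex_of_real e \<cdot>\<^sub>v (W *\<^sub>v (B *\<^sub>v w))" .
    have "A *\<^sub>v (W *\<^sub>v w) = W *\<^sub>v (B *\<^sub>v w)"
    proof (rule eq_vecI)
      fix i assume "i < dim_vec (W *\<^sub>v (B *\<^sub>v w))"
      then show "vec_index (A *\<^sub>v (W *\<^sub>v w)) i = vec_index (W *\<^sub>v (B *\<^sub>v w)) i"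
        using arg_cong[OF eq, of "\<lambda>v. vec_index v i"] that(2) W Ad by simp
    qed (simp add: W Ad)
    then show ?thesis by (simp add: B_def)
  qed
qed

definition diffused_kernel :: "real \<Rightarrow> real \<Rightarrow> real \<Rightarrow> real \<Rightarrow> real" where
  "diffused_kernel a t0 x t = (t - t0)\<^sup>2 / (a\<^sup>2 - (t - t0) * x)"

lemma diffused_denominator_pos:
  fixes a t t0 x :: real
  assumes "t \<in> {t0 - a<..<t0 + a}" "x \<in> {-a..a}"
  shows "a\<^sup>2 - (t - t0) * x > 0"
proof -
  have "\<bar>t - t0\<bar> < a" "\<bar>x\<bar> \<le> a" using assms by auto
  then have "\<bar>t - t0\<bar> * \<bar>x\<bar> < a * a"
    by (intro le_less_trans[OF mult_left_mono mult_strict_right_mono]) auto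
  then show ?thesis
    by (metis abs_ge_self abs_mult diff_gt_0_iff_gt le_less_trans power2_eq_square)
qed

lemma set_integral_weighted_sum:
  fixes g :: "nat \<Rightarrow> real \<Rightarrow> real"
  assumes "\<forall>i<n. set_integrable M S (g i)"
  shows "set_integrable M S (\<lambda>x. \<Sum>i<n. w i * g i x)"
    "(LINT x:S|M. (\<Sum>i<n. w i * g i x)) = (\<Sum>i<n. w i * (LINT x:S|M. g i x))"
proof -
  have *: "set_integrable M S (\<lambda>x. w i * g i x)" if "i < n" for i
    using assms that by (intro set_integrable_mult_right) blast
  then show "set_integrable M S (\<lambda>x. \<Sum>i<n. w i * g i x)"
    unfolding set_integrable_def scaleR_sum_right by (intro Bochner_Integration.integrable_sum) auto
  have "(LINT x:S|M. (\<Sum>i<n. w i * g i x)) = (\<Sum>i<n. LINT x:S|M. w i * g i x)"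
    using * unfolding set_integrable_def set_lebesgue_integral_def scaleR_sum_right
    by (subst Bochner_Integration.integral_sum) auto
  then show "(LINT x:S|M. (\<Sum>i<n. w i * g i x)) = (\<Sum>i<n. w i * (LINT x:S|M. g i x))"
    by simp
qed

text \<open>For fixed \<open>t\<close> the distance to the centre is strictly below
  \<open>a\<close>, so the denominator stays away from zero uniformly in \<open>x\<close> and the
  kernel is bounded.\<close>

lemma diffused_kernel_integrable:
  fixes p :: "real \<Rightarrow> real"
  assumes "t \<in> {t0 - a<..<t0 + a}" "prob_density_on {-a..a} p"
  shows "set_integrable lborel {-a..a} (\<lambda>x. diffused_kernel a t0 x t * p x)"
proof -
  define s where "s = \<bar>t - t0\<bar>"
  have s: "0 \<le> s" "s < a" using assms(1) by (auto simp: s_def)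
  define C where "C = s\<^sup>2 / (a\<^sup>2 - s * a)"
  have den: "a\<^sup>2 - s * a > 0" using s by (simp add: power2_eq_square)
  have p: "integrable lborel (\<lambda>x. indicator {-a..a} x *\<^sub>R p x)"
    using assms(2) by (simp add: prob_density_on_def set_integrable_def)
  have "integrable lborel (\<lambda>x. diffused_kernel a t0 x t * (indicator {-a..a} x *\<^sub>R p x))"
  proof (rule Bochner_Integration.integrable_bound)
    show "integrable lborel (\<lambda>x. C * (indicator {-a..a} x *\<^sub>R p x))"
      using p by (rule integrable_mult_right)
    have [measurable]: "(\<lambda>x. indicator {-a..a} x *\<^sub>R p x) \<in> borel_measurable lborel"
      using p by (rule borel_measurable_integrable)
    show "(\<lambda>x. diffused_kernel a t0 x t * (indicator {-a..a} x *\<^sub>R p x)) \<in> borel_measurable lborel"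
      unfolding diffused_kernel_def by measurable
    show "AE x in lborel. norm (diffused_kernel a t0 x t * (indicator {-a..a} x *\<^sub>R p x))
        \<le> norm (C * (indicator {-a..a} x *\<^sub>R p x))"
    proof (intro AE_I2)
      fix x :: real
      show "norm (diffused_kernel a t0 x t * (indicator {-a..a} x *\<^sub>R p x))
        \<le> norm (C * (indicator {-a..a} x *\<^sub>R p x))"
      proof (cases "x \<in> {-a..a}")
        case True
        have "(t - t0) * x \<le> s * \<bar>x\<bar>"
          by (metis abs_ge_self abs_mult s_def)
        also have "\<dots> \<le> s * a" using True s by (intro mult_left_mono) auto
        finally have "a\<^sup>2 - (t - t0) * x \<ge> a\<^sup>2 - s * a" by simp
        then have "diffused_kernel a t0 x t \<le> C"
          unfolding diffused_kernel_def C_def using den by (intro frac_le) (auto simp: s_def)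
        moreover have "diffused_kernel a t0 x t \<ge> 0"
          using diffused_denominator_pos[OF assms(1) True] by (simp add: diffused_kernel_def)
        ultimately show ?thesis
          unfolding norm_mult by (intro mult_right_mono) auto
      qed simp
    qed
  qed
  then show ?thesis by (simp add: set_integrable_def mult.left_commute)
qed

text \<open>
  A diffused function is affine up to an average of resolvents, so equality in Jensen's inequality forces
  a vanishing resolvent defect for parameters \<open>x \<noteq> 0\<close> that accumulate at \<open>0\<close>; in the limit \<open>x \<rightarrow> 0\<close>
  the resolvents disappear from the resulting intertwining relation.
\<close>

lemma diffused_jensen_equality:
  assumes f: "diffused_on I f"
    and A: "spectral_decomposition n A U l" and B: "spectral_decomposition m (adj W * A * W) V k"
    and I: "\<And>i. i < n \<Longrightarrow> l i \<in> I" "\<And>j. j < m \<Longrightarrow> k j \<in> I"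
    and W: "dim_row W = n" "dim_col W = m" "adj W * W = 1\<^sub>m m" and v: "dim_vec v = m"
    and eq: "Re ((mat_fun f (adj W * A * W) *\<^sub>v v) \<bullet>c v)
      = Re ((mat_fun f A *\<^sub>v (W *\<^sub>v v)) \<bullet>c (W *\<^sub>v v))"
  shows "A *\<^sub>v (W *\<^sub>v v) = W *\<^sub>v ((adj W * A * W) *\<^sub>v v)"
proof -
  obtain t0 a b c \<kappa> p u' v' where a: "0 < a" and Ieq: "I = {t0 - a<..<t0 + a}" and \<kappa>: "0 < \<kappa>"
    and p: "prob_density_on {-a..a} p"
    and uv: "u' < v'" "{u'..v'} \<subseteq> {-a..a}" "0 \<in> {u'..v'}" "AE x in lborel. x \<in> {u'..v'} \<longrightarrow> 0 < p x"
    and frep: "\<And>t. t \<in> I \<Longrightarrow> f t = b + c * t + \<kappa> * (LINT x:{-a..a}|lborel. diffused_kernel a t0 x t * p x)"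
    using f unfolding diffused_on_def diffused_kernel_def by blast
  define M where "M = adj W * A * W"
  define y where "y = W *\<^sub>v v"
  have yd: "dim_vec y = n" by (simp add: y_def W)
  note B' = B[folded M_def]
  have hA: "hermitian n A" using A by (rule spectral_decomposition_hermitian)
  have hM: "hermitian m M" using B' by (rule spectral_decomposition_hermitian)
  note Ad = hermitianD[OF hA] and Md = hermitianD[OF hM]
  \<comment> \<open>Spectral weights of \<open>W v\<close> for \<open>A\<close> and of
    \<open>v\<close> for the compression: the quadratic forms become finite sums that are linear in
    the function.\<close>
  define \<alpha> where "\<alpha> = (\<lambda>i. (cmod (vec_index (adj U *\<^sub>v y) i))\<^sup>2)"
  define \<beta> where "\<beta> = (\<lambda>j. (cmod (vec_index (adj V *\<^sub>v v) j))\<^sup>2)"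
  have form\<alpha>: "Re ((mat_fun g A *\<^sub>v y) \<bullet>c y) = (\<Sum>i<n. g (l i) * \<alpha> i)" for g
    unfolding \<alpha>_def by (rule spectral_weights[OF A yd])
  have form\<beta>: "Re ((mat_fun g M *\<^sub>v v) \<bullet>c v) = (\<Sum>j<m. g (k j) * \<beta> j)" for g
    unfolding \<beta>_def by (rule spectral_weights[OF B' v])
  \<comment> \<open>The Jensen gap as a linear functional of the function. It vanishes on affine
    functions, since \<open>W\<close> preserves norms and \<open>M\<close> is the compression of
    \<open>A\<close>.\<close>
  define defect where "defect = (\<lambda>g. (\<Sum>i<n. g (l i) * \<alpha> i) - (\<Sum>j<m. g (k j) * \<beta> j))"
  have defect_lin: "defect (\<lambda>t. g t + e * h t) = defect g + e * defect h" for g h e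
    by (simp add: defect_def sum.distrib sum_distrib_left algebra_simps)
  have defect_cong: "defect g = defect h" if "\<And>t. t \<in> I \<Longrightarrow> g t = h t" for g h
    unfolding defect_def using that I by (intro arg_cong2[of _ _ _ _ "(-)"] sum.cong) auto
  have defect_0: "defect (\<lambda>t. 1) = 0"
    using form\<alpha>[of "\<lambda>t. 1"] form\<beta>[of "\<lambda>t. 1"] isometry_norm[OF W(3,2) v v] yd v
    by (simp add: defect_def mat_fun_const_one[OF hA] mat_fun_const_one[OF hM] y_def W)
  have defect_1: "defect (\<lambda>t. t) = 0"
  proof -
    have "(A *\<^sub>v y) \<bullet>c y = (adj W *\<^sub>v (A *\<^sub>v y)) \<bullet>c v"
      unfolding y_def by (subst (2) cscalar_prod_adjoint) (simp_all add: W Ad v)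
    also have "adj W *\<^sub>v (A *\<^sub>v y) = M *\<^sub>v v"
      unfolding y_def M_def by (simp add: mult_mat_vec_assoc W Ad v)
    finally show ?thesis
      using form\<alpha>[of "\<lambda>t. t"] form\<beta>[of "\<lambda>t. t"]
      by (simp add: defect_def mat_fun_id[OF hA] mat_fun_id[OF hM])
  qed
  define D where "D = (\<lambda>x. defect (diffused_kernel a t0 x))"
  have res: "D x \<ge> 0 \<and> (D x = 0 \<longrightarrow>
      A *\<^sub>v (W *\<^sub>v (mat_fun (\<lambda>t. 1 / (a\<^sup>2 - (t - t0) * x)) M *\<^sub>v v)) =
      W *\<^sub>v (M *\<^sub>v (mat_fun (\<lambda>t. 1 / (a\<^sup>2 - (t - t0) * x)) M *\<^sub>v v)))"
    if x: "x \<in> {-a..a}" "x \<noteq> 0" for x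
  proof -
    define r where "r = (\<lambda>t. 1 / ((a\<^sup>2 + t0 * x) + (- x) * t))"
    have r: "r t = 1 / (a\<^sup>2 - (t - t0) * x)" for t by (simp add: r_def algebra_simps)
    have den: "(a\<^sup>2 + t0 * x) + (- x) * t > 0" if "t \<in> I" for t
      using diffused_denominator_pos[of t t0 a x] that x(1) Ieq by (simp add: algebra_simps)
    \<comment> \<open>Polynomial division by the denominator, which is linear in \<open>t\<close>
      with slope \<open>- x\<close>: an affine function plus a positive multiple of a resolvent.
      This is the step that excludes \<open>x = 0\<close>.\<close>
    have "diffused_kernel a t0 x t = ((t0 / x - a\<^sup>2 / x\<^sup>2) * 1 + (- 1 / x) * t) + (a^4 / x\<^sup>2) * r t" if "t \<in> I" for t
    proof -
      define s where "s = t - t0"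
      have "a\<^sup>2 - s * x \<noteq> 0" using den[OF that] by (simp add: s_def algebra_simps)
      then have "s\<^sup>2 / (a\<^sup>2 - s * x) = - s / x - a\<^sup>2 / x\<^sup>2 + (a^4 / x\<^sup>2) * (1 / (a\<^sup>2 - s * x))"
        using x(2) by (simp add: divide_simps) (simp add: algebra_simps power2_eq_square power4_eq_xxxx)
      then show ?thesis
        unfolding diffused_kernel_def r s_def by (simp add: diff_divide_distrib)
    qed
    then have "D x = defect (\<lambda>t. ((t0 / x - a\<^sup>2 / x\<^sup>2) * 1 + (- 1 / x) * t) + (a^4 / x\<^sup>2) * r t)"
      unfolding D_def by (rule defect_cong)
    also have "\<dots> = (a^4 / x\<^sup>2) * defect r"
      unfolding defect_lin[of _ "a^4 / x\<^sup>2"] defect_lin[of _ "- 1 / x"]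
      using defect_lin[of "\<lambda>t. 0" "t0 / x - a\<^sup>2 / x\<^sup>2" "\<lambda>t. 1"] defect_0 defect_1
      by (simp add: defect_def)
    finally have D: "D x = (a^4 / x\<^sup>2) * defect r" .
    have "defect r = Re ((mat_fun r A *\<^sub>v (W *\<^sub>v v)) \<bullet>c (W *\<^sub>v v)) - Re ((mat_fun r M *\<^sub>v v) \<bullet>c v)"
      by (simp add: defect_def form\<alpha>[symmetric] form\<beta>[symmetric] y_def)
    note dr = this[unfolded r_def M_def]
    note rd = resolvent_defect[OF A B W v den[OF I(1)] den[OF I(2)], folded dr]
    have "defect r \<ge> 0" using rd(1) by (simp add: r_def)
    moreover have "A *\<^sub>v (W *\<^sub>v (mat_fun r M *\<^sub>v v)) = W *\<^sub>v (M *\<^sub>v (mat_fun r M *\<^sub>v v))" if "defect r = 0"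
      using rd(2) that x(2) by (simp add: r_def M_def)
    moreover have "a^4 / x\<^sup>2 > 0" using a x(2) by simp
    ultimately show ?thesis
      unfolding D r[abs_def, symmetric]
      by (metis less_irrefl mult_eq_0_iff mult_nonneg_nonneg order_less_imp_le r)
  qed
  \<comment> \<open>There are finitely many eigenvalues, so the gap of the averaged kernel is the
    average of the gaps.\<close>
  have D_int: "set_integrable lborel {-a..a} (\<lambda>x. D x * p x)"
    and f_int: "defect f = \<kappa> * (LINT x:{-a..a}|lborel. D x * p x)"
  proof -
    define F where "F = (\<lambda>t. LINT x:{-a..a}|lborel. diffused_kernel a t0 x t * p x)"
    have int: "\<forall>i<n. set_integrable lborel {-a..a} (\<lambda>x. diffused_kernel a t0 x (l i) * p x)"
      "\<forall>j<m. set_integrable lborel {-a..a} (\<lambda>x. diffused_kernel a t0 x (k j) * p x)"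
      using I p unfolding Ieq by (auto intro: diffused_kernel_integrable)
    note s1 = set_integral_weighted_sum[OF int(1), where w = \<alpha>]
      and s2 = set_integral_weighted_sum[OF int(2), where w = \<beta>]
    have Dp: "D x * p x = (\<Sum>i<n. \<alpha> i * (diffused_kernel a t0 x (l i) * p x)) - (\<Sum>j<m. \<beta> j * (diffused_kernel a t0 x (k j) * p x))" for x
      by (simp add: D_def defect_def right_diff_distrib sum_distrib_left ac_simps)
    show "set_integrable lborel {-a..a} (\<lambda>x. D x * p x)"
      unfolding Dp using s1(1) s2(1) by (rule set_integral_diff(1))
    have "(LINT x:{-a..a}|lborel. D x * p x) = defect F"
      unfolding Dp set_integral_diff(2)[OF s1(1) s2(1)] s1(2) s2(2) defect_def F_def
      by (simp only: mult.commute)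
    moreover have "defect f = defect (\<lambda>t. (b * 1 + c * t) + \<kappa> * F t)"
      by (rule defect_cong) (simp add: frep F_def)
    moreover have "defect (\<lambda>t. (b * 1 + c * t) + \<kappa> * F t) = \<kappa> * defect F"
      unfolding defect_lin[of _ \<kappa>] defect_lin[of _ c]
      using defect_lin[of "\<lambda>t. 0" b "\<lambda>t. 1"] defect_0 defect_1
      by (simp add: defect_def)
    ultimately show "defect f = \<kappa> * (LINT x:{-a..a}|lborel. D x * p x)" by simp
  qed
  have "defect f = 0"
    using eq form\<alpha>[of f] form\<beta>[of f] by (simp add: defect_def y_def M_def)
  then have int0: "integral\<^sup>L lborel (\<lambda>x. indicator {-a..a} x *\<^sub>R (D x * p x)) = 0"
    using f_int \<kappa> by (simp add: set_lebesgue_integral_def)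
  have nz: "AE x in lborel. x \<noteq> (0 :: real)" by (rule AE_lborel_singleton)
  \<comment> \<open>The sign of \<open>D x\<close> has been found only for nonzero \<open>x\<close>;
    one point is negligible.\<close>
  have nonneg: "AE x in lborel. 0 \<le> indicator {-a..a} x *\<^sub>R (D x * p x)"
    using nz
  proof eventually_elim
    case (elim x)
    then show ?case
      using res[of x] p by (auto simp: indicator_def prob_density_on_def)
  qed
  have "AE x in lborel. indicator {-a..a} x *\<^sub>R (D x * p x) = 0"
    using integral_nonneg_eq_0_iff_AE[OF D_int[unfolded set_integrable_def] nonneg] int0 by simp
  with nz uv(4) have D0: "AE x in lborel. x \<in> {u'..v'} \<longrightarrow> x \<noteq> 0 \<and> D x = 0"
    by eventually_elim (use uv(2) in \<open>auto simp: indicator_def\<close>)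
  \<comment> \<open>In the eigenbasis of \<open>M\<close> the resolvent is diagonal, so each entry
    of the intertwining error is an explicit function \<open>G i\<close> of the parameter,
    continuous at \<open>0\<close>.\<close>
  define Y where "Y = (A * W - W * M) * V"
  note SV = spectral_decompositionD[OF B']
  have Yd: "dim_row Y = n" "dim_col Y = m" by (simp_all add: Y_def W Md SV)
  define y' where "y' = adj V *\<^sub>v v"
  have y'd: "dim_vec y' = m" by (simp add: y'_def SV)
  define G where "G = (\<lambda>i x. \<Sum>j<m. Y $$ (i, j) * (complex_of_real (1 / (a\<^sup>2 - (k j - t0) * x)) * vec_index y' j))"
  have G_eq: "vec_index (A *\<^sub>v (W *\<^sub>v (mat_fun g M *\<^sub>v v)) - W *\<^sub>v (M *\<^sub>v (mat_fun g M *\<^sub>v v))) i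
      = (\<Sum>j<m. Y $$ (i, j) * (complex_of_real (g (k j)) * vec_index y' j))" if "i < n" for i g
  proof -
    note gd = hermitianD[OF mat_fun_hermitian[OF hM, of g]]
    have "A *\<^sub>v (W *\<^sub>v (mat_fun g M *\<^sub>v v)) - W *\<^sub>v (M *\<^sub>v (mat_fun g M *\<^sub>v v))
        = (A * W - W * M) *\<^sub>v (mat_fun g M *\<^sub>v v)"
      by (simp add: mat_vec_distrib mult_mat_vec_assoc W Ad Md gd v)
    also have "\<dots> = Y *\<^sub>v (mat_diag m (\<lambda>j. complex_of_real (g (k j))) *\<^sub>v y')"
    proof -
      have "mat_fun g M *\<^sub>v v = V *\<^sub>v (mat_diag m (\<lambda>j. complex_of_real (g (k j))) *\<^sub>v y')"
        by (simp add: mat_fun_eq[OF B'] y'_def mult_mat_vec_assoc SV(2,3) v)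
      then show ?thesis
        by (simp add: Y_def mult_mat_vec_assoc SV(2,3) W Md)
    qed
    finally show ?thesis
      using that Yd y'd by (simp add: mult_vec_index[of i Y] mat_diag_vec_index)
  qed
  have "G i 0 = 0" if i: "i < n" for i
  proof (rule ccontr)
    assume ne: "G i 0 \<noteq> 0"
    have "isCont (G i) 0"
      unfolding G_def using a by (intro continuous_intros) auto
    then have "\<forall>\<^sub>F x in nhds 0. G i x \<noteq> 0"
      using ne by (simp add: isCont_def tendsto_imp_eventually_ne eventually_nhds_conv_at)
    then obtain \<epsilon> where \<epsilon>: "\<epsilon> > 0" "\<And>x. \<bar>x\<bar> < \<epsilon> \<Longrightarrow> G i x \<noteq> 0"
      by (auto simp: eventually_nhds_metric dist_real_def)
    \<comment> \<open>Zero may be an endpoint of the interval on which the density is positive, so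
      the parameters are taken from whichever side is available.\<close>
    have "\<exists>c d. c < d \<and> {c<..<d} \<subseteq> {u'..v'} \<and> {c<..<d} \<subseteq> {-\<epsilon><..<\<epsilon>}"
    proof (cases "v' > 0")
      case True
      then show ?thesis using uv(3) \<epsilon>(1)
        by (intro exI[of _ 0] exI[of _ "min v' \<epsilon>"]) auto
    next
      case False
      then show ?thesis using uv(1,3) \<epsilon>(1)
        by (intro exI[of _ "max u' (-\<epsilon>)"] exI[of _ 0]) auto
    qed
    then obtain c d where cd: "c < d" "{c<..<d} \<subseteq> {u'..v'}" "{c<..<d} \<subseteq> {-\<epsilon><..<\<epsilon>}" by blast
    obtain x where x: "c < x" "x < d" "x \<in> {u'..v'} \<longrightarrow> x \<noteq> 0 \<and> D x = 0"
      using AE_lborel_interval[OF D0 cd(1)] by blast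
    then have x': "x \<in> {u'..v'}" "\<bar>x\<bar> < \<epsilon>" using cd(2,3) by (auto simp: subset_iff abs_less_iff)
    then have "x \<in> {-a..a}" "x \<noteq> 0" "D x = 0" using x(3) uv(2) by auto
    from res[OF this(1,2)] this(3)
    have "A *\<^sub>v (W *\<^sub>v (mat_fun (\<lambda>t. 1 / (a\<^sup>2 - (t - t0) * x)) M *\<^sub>v v)) =
      W *\<^sub>v (M *\<^sub>v (mat_fun (\<lambda>t. 1 / (a\<^sup>2 - (t - t0) * x)) M *\<^sub>v v))" by simp
    then have "G i x = 0"
      using G_eq[OF i, of "\<lambda>t. 1 / (a\<^sup>2 - (t - t0) * x)"] i W by (simp add: G_def)
    then show False using \<epsilon>(2)[OF x'(2)] by simp
  qed
  \<comment> \<open>At \<open>x = 0\<close> every resolvent equals \<open>1 / a\<^sup>2\<close>, a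
    common nonzero factor.\<close>
  then have G0: "(\<Sum>j<m. Y $$ (i, j) * vec_index y' j) = 0" if "i < n" for i
    using that a by (auto simp: G_def sum_divide_distrib[symmetric])
  show ?thesis
  proof (rule eq_vecI)
    fix i assume "i < dim_vec (W *\<^sub>v (adj W * A * W *\<^sub>v v))"
    then have i: "i < n" by (simp add: W)
    have "vec_index (A *\<^sub>v (W *\<^sub>v v) - W *\<^sub>v (M *\<^sub>v v)) i = 0"
      using G_eq[OF i, of "\<lambda>t. 1"] G0[OF i] v by (simp add: mat_fun_const_one[OF hM])
    then show "vec_index (A *\<^sub>v (W *\<^sub>v v)) i = vec_index (W *\<^sub>v (adj W * A * W *\<^sub>v v)) i"
      using i W by (simp add: M_def)
  qed (simp add: W Ad)
qed

context factor_embedding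
begin

text \<open>The intertwining relation at the root of the reduced state, unstacked: \<sigma> times
  the root times the inverse of \<rho> equals the lift times the root of \<rho>. Multiplying by the
  root of \<rho> on the right clears both sides of roots.\<close>

theorem data_processing_equality:
  assumes "diffused_on I f" "admissible I N \<rho> \<sigma>" "admissible I m (reduce \<rho>) (reduce \<sigma>)"
    and eq: "f_rel_entropy f (reduce \<rho>) (reduce \<sigma>) = f_rel_entropy f \<rho> \<sigma>"
  shows "\<sigma> = mat_sum N N K (\<lambda>k. J k * (reduce \<sigma> * mat_fun inverse (reduce \<rho>)) * adj (J k)) * \<rho>"
proof -
  have pos: "strictly_pos N \<rho>" "strictly_pos N \<sigma>" "strictly_pos m (reduce \<rho>)" "strictly_pos m (reduce \<sigma>)"
    using assms(2,3) by (simp_all add: admissible_def)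
  have h: "hermitian N \<rho>" "hermitian N \<sigma>" "hermitian m (reduce \<rho>)" "hermitian m (reduce \<sigma>)"
    using pos by (simp_all add: strictly_pos_def)
  obtain U l where S: "spectral_decomposition (N * N) (modular_op \<rho> \<sigma>) U l" and I: "\<And>k. k < N * N \<Longrightarrow> l k \<in> I"
    using admissible_modular_op[OF assms(2)] by metis
  obtain U' l' where S': "spectral_decomposition (m * m) (modular_op (reduce \<rho>) (reduce \<sigma>)) U' l'"
    and I': "\<And>k. k < m * m \<Longrightarrow> l' k \<in> I"
    using admissible_modular_op[OF assms(3)] by metis
  note \<sigma> = hermitianD(1,2)[OF h(2)] and \<rho> = hermitianD(1,2)[OF h(1)]
  note fd = hermitianD(1,2)[OF mat_fun_hermitian[OF h(1)]] hermitianD(1,2)[OF mat_fun_hermitian[OF h(3)]]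
  let ?s = "mat_fun sqrt (reduce \<rho>)" and ?S = "mat_fun sqrt \<rho>"
  note modular = petz_isometry_modular[OF pos(1,3) \<sigma>]
  have "modular_op \<rho> \<sigma> *\<^sub>v (petz_isometry \<rho> *\<^sub>v vec_rows ?s) =
      petz_isometry \<rho> *\<^sub>v (modular_op (reduce \<rho>) (reduce \<sigma>) *\<^sub>v vec_rows ?s)"
    using diffused_jensen_equality[OF assms(1) S, of "m * m" "petz_isometry \<rho>",
        unfolded modular, OF S' I I' _ _ petz_isometry_isometry[OF pos(1,3)], of "vec_rows ?s"]
      eq by (simp add: fd petz_isometry_sqrt[OF pos(1,3)] f_rel_entropy_modular[OF pos(1)] f_rel_entropy_modular[OF pos(3)])
  also have "modular_op (reduce \<rho>) (reduce \<sigma>) *\<^sub>v vec_rows ?s = vec_rows (reduce \<sigma> * ?s * mat_fun inverse (reduce \<rho>))"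
    by (rule modular_op_mult_vec_rows[OF h(3)]) (simp_all add: fd)
  also have "petz_isometry \<rho> *\<^sub>v \<dots> = vec_rows (mat_sum N N K (\<lambda>k. J k * (reduce \<sigma> * ?s * mat_fun inverse (reduce \<rho>) *
      mat_inv_sqrt (reduce \<rho>)) * adj (J k)) * ?S)"
    by (rule petz_isometry_mult_vec_rows[OF pos(1,3)]) (simp_all add: fd)
  \<comment> \<open>The powers 1/2, -1 and -1/2 of the reduced state combine to its inverse.\<close>
  also have "reduce \<sigma> * ?s * mat_fun inverse (reduce \<rho>) * mat_inv_sqrt (reduce \<rho>) =
      reduce \<sigma> * mat_fun inverse (reduce \<rho>)"
  proof -
    have "?s * (mat_fun inverse (reduce \<rho>) * mat_inv_sqrt (reduce \<rho>)) = mat_fun inverse (reduce \<rho>)"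
      unfolding mat_fun_mult[OF h(3)] by (rule mat_fun_pos_cong[OF pos(3)]) (simp add: field_simps)
    then show ?thesis by (simp add: mult_mat_assoc fd)
  qed
  also have "modular_op \<rho> \<sigma> *\<^sub>v (petz_isometry \<rho> *\<^sub>v vec_rows ?s) = vec_rows (\<sigma> * ?S * mat_fun inverse \<rho>)"
    unfolding petz_isometry_sqrt[OF pos(1,3)]
    by (rule modular_op_mult_vec_rows[OF h(1)]) (simp_all add: fd \<sigma>)
  finally have "\<sigma> * ?S * mat_fun inverse \<rho> =
      mat_sum N N K (\<lambda>k. J k * (reduce \<sigma> * mat_fun inverse (reduce \<rho>)) * adj (J k)) * ?S"
    by (rule vec_rows_inject) (simp_all add: fd \<sigma>)
  then have "\<sigma> * ?S * mat_fun inverse \<rho> * ?S =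
      mat_sum N N K (\<lambda>k. J k * (reduce \<sigma> * mat_fun inverse (reduce \<rho>)) * adj (J k)) * ?S * ?S" by simp
  then show ?thesis by (simp add: mult_mat_assoc fd \<sigma> mat_fun_sqrt[OF pos(1)])
qed

end

subsection \<open>Kraus representations\<close>

lemma hermitian_mat_sum:
  assumes "\<And>k. k < K \<Longrightarrow> hermitian n (F k)"
  shows "hermitian n (mat_sum n n K F)"
proof -
  have "adj (mat_sum n n K F) = mat_sum n n K (\<lambda>k. adj (F k))"
    using hermitianD[OF assms] by (intro mat_sum_adjoint) auto
  also have "\<dots> = mat_sum n n K F"
    using hermitianD(3)[OF assms] by (intro mat_sum_cong) auto
  finally show ?thesis unfolding hermitian_def by (intro conjI carrier_matI) simp_all
qed

lemma mat_sum_form: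
  assumes "\<And>k. k < K \<Longrightarrow> dim_row (F k) = n" "\<And>k. k < K \<Longrightarrow> dim_col (F k) = n"
    and "dim_vec v = n" "dim_vec w = n"
  shows "(mat_sum n n K F *\<^sub>v v) \<bullet>c w = (\<Sum>k<K. (F k *\<^sub>v v) \<bullet>c w)"
proof -
  have "(mat_sum n n K F *\<^sub>v v) \<bullet>c w = (\<Sum>i<n. \<Sum>j<n. \<Sum>k<K. F k $$ (i, j) * vec_index v j * cnj (vec_index w i))"
    using assms by (simp add: cscalar_prod_sum mult_vec_index mat_sum_index sum_distrib_right)
  also have "\<dots> = (\<Sum>k<K. \<Sum>i<n. \<Sum>j<n. F k $$ (i, j) * vec_index v j * cnj (vec_index w i))"
    by (simp only: sum.swap[of _ "{..<n}" "{..<K}"])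
  also have "\<dots> = (\<Sum>k<K. (F k *\<^sub>v v) \<bullet>c w)"
    using assms by (simp add: cscalar_prod_sum mult_vec_index sum_distrib_right)
  finally show ?thesis .
qed

lemma pos_semidef_mat_sum:
  assumes "\<And>k. k < K \<Longrightarrow> pos_semidef n (F k)"
  shows "pos_semidef n (mat_sum n n K F)"
  unfolding pos_semidef_def
proof (intro conjI ballI)
  have h: "hermitian n (F k)" if "k < K" for k
    using assms[OF that] by (simp add: pos_semidef_def)
  then show "hermitian n (mat_sum n n K F)" by (rule hermitian_mat_sum)
  fix v :: "complex Matrix.vec" assume v: "v \<in> carrier_vec n"
  have "(mat_sum n n K F *\<^sub>v v) \<bullet>c v = (\<Sum>k<K. (F k *\<^sub>v v) \<bullet>c v)"
    using hermitianD[OF h] v by (intro mat_sum_form) auto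
  then show "0 \<le> Re ((mat_sum n n K F *\<^sub>v v) \<bullet>c v)"
    using assms v by (auto simp: pos_semidef_def intro!: sum_nonneg)
qed

lemma pos_semidef_conj:
  assumes "pos_semidef m X" "dim_row G = n" "dim_col G = m"
  shows "pos_semidef n (G * X * adj G)"
  unfolding pos_semidef_def
proof (intro conjI ballI)
  have h: "hermitian m X" using assms(1) by (simp add: pos_semidef_def)
  show "hermitian n (G * X * adj G)"
    using hermitian_conj[OF h, of "adj G"] assms by simp
  fix v :: "complex Matrix.vec" assume "v \<in> carrier_vec n"
  then have v: "dim_vec v = n" by simp
  have "(G * X * adj G *\<^sub>v v) \<bullet>c v = (G *\<^sub>v (X *\<^sub>v (adj G *\<^sub>v v))) \<bullet>c v"
    using hermitianD[OF h] assms v by (simp add: mult_mat_vec_assoc)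
  also have "\<dots> = (X *\<^sub>v (adj G *\<^sub>v v)) \<bullet>c (adj G *\<^sub>v v)"
    using hermitianD[OF h] assms v by (intro cscalar_prod_adjoint) auto
  finally show "0 \<le> Re ((G * X * adj G *\<^sub>v v) \<bullet>c v)"
    using assms(1) carrier_vecI[of "adj G *\<^sub>v v" m] assms(3) by (simp add: pos_semidef_def)
qed

lemma mat_trace_mat_sum: "mat_trace (mat_sum n n K F) = (\<Sum>k<K. \<Sum>i<n. F k $$ (i, i))"
  by (simp add: mat_trace_def mat_sum_index sum.swap[of _ "{..<n}" "{..<K}"])

definition kraus_map :: "nat \<Rightarrow> nat \<Rightarrow> (nat \<Rightarrow> complex mat) \<Rightarrow> complex mat \<Rightarrow> complex mat" where
  "kraus_map n K C X = mat_sum n n K (\<lambda>k. C k * X * adj (C k))"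

lemma kron_one_mult_index:
  assumes "dim_row Y = k * dim_col C" "i < k * dim_row C" "j < dim_col Y"
  shows "(kron (1\<^sub>m k) C * Y) $$ (i, j) =
    (\<Sum>r<dim_col C. C $$ (i mod dim_row C, r) * Y $$ ((i div dim_row C) * dim_col C + r, j))"
proof -
  note dm = div_mod_less[OF assms(2)]
  have "(kron (1\<^sub>m k) C * Y) $$ (i, j) =
      (\<Sum>a<k. \<Sum>r<dim_col C. 1\<^sub>m k $$ (i div dim_row C, a) * C $$ (i mod dim_row C, r) * Y $$ (a * dim_col C + r, j))"
    using assms by (simp add: mult_mat_index kron_index sum_mult_index)
  also have "\<dots> = (\<Sum>a<k. if a = i div dim_row C then
      (\<Sum>r<dim_col C. C $$ (i mod dim_row C, r) * Y $$ (a * dim_col C + r, j)) else 0)"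
    using dm by (intro sum.cong) auto
  also have "\<dots> = (\<Sum>r<dim_col C. C $$ (i mod dim_row C, r) * Y $$ ((i div dim_row C) * dim_col C + r, j))"
    using dm by simp
  finally show ?thesis .
qed

text \<open>Each block is transformed by the same Kraus operators, so the ampliation has the Kraus
  operators \<open>kron (1\<^sub>m k) (C l)\<close>. Complete positivity and entanglement fidelity
  are both computed from this form.\<close>

lemma ampliation_kraus_map:
  assumes C: "\<And>l. l < K \<Longrightarrow> dim_row (C l) = n" "\<And>l. l < K \<Longrightarrow> dim_col (C l) = m"
    and X: "dim_row X = k * m" "dim_col X = k * m"
    and E: "\<And>X. X \<in> carrier_mat m m \<Longrightarrow> E X = kraus_map n K C X"
  shows "ampliation k m n E X = kraus_map (k * n) K (\<lambda>l. kron (1\<^sub>m k) (C l)) X" (is "?L = ?R")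
proof (rule eq_mat_dimI[of "k * n" "k * n"])
  fix i j assume ij: "i < k * n" "j < k * n"
  note dm = div_mod_less[OF ij(1)] div_mod_less[OF ij(2)]
  define B where "B = Matrix.mat m m (\<lambda>(r, s). X $$ ((i div n) * m + r, (j div n) * m + s))"
  have "?L $$ (i, j) = (\<Sum>l<K. (C l * (B * adj (C l))) $$ (i mod n, j mod n))"
  proof -
    have Bd: "dim_row B = m" "dim_col B = m" by (simp_all add: B_def)
    have "?L $$ (i, j) = E B $$ (i mod n, j mod n)"
      using ij by (simp add: ampliation_def B_def)
    also have "\<dots> = (\<Sum>l<K. (C l * B * adj (C l)) $$ (i mod n, j mod n))"
      using dm by (simp add: E[OF carrier_matI[OF Bd]] kraus_map_def mat_sum_index)
    finally show ?thesis by (simp add: mult_mat_assoc C Bd)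
  qed
  also have "\<dots> = (\<Sum>l<K. (kron (1\<^sub>m k) (C l) * X * adj (kron (1\<^sub>m k) (C l))) $$ (i, j))"
  proof (rule sum.cong, rule refl)
    fix l assume "l \<in> {..<K}"
    then have l: "dim_row (C l) = n" "dim_col (C l) = m" using C by auto
    have "(X * adj (kron (1\<^sub>m k) (C l))) $$ ((i div n) * m + r, j) = (B * adj (C l)) $$ (r, j mod n)"
      if r: "r < m" for r
    proof -
      have a: "(i div n) * m + r < k * m" using dm r by simp
      have "(X * adj (kron (1\<^sub>m k) (C l))) $$ ((i div n) * m + r, j) =
          cnj ((kron (1\<^sub>m k) (C l) * adj X) $$ (j, (i div n) * m + r))"
        using adj_index[of "(i div n) * m + r" "kron (1\<^sub>m k) (C l) * adj X" j] X l ij a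
        by (simp add: adj_mult)
      also have "\<dots> = cnj (\<Sum>s<m. C l $$ (j mod n, s) * adj X $$ ((j div n) * m + s, (i div n) * m + r))"
        using kron_one_mult_index[of "adj X" k "C l" j "(i div n) * m + r"] X l ij a by simp
      also have "\<dots> = (B * adj (C l)) $$ (r, j mod n)"
        using X l ij r dm by (simp add: mult_mat_index B_def) (simp only: mult.commute)
      finally show ?thesis .
    qed
    then show "(C l * (B * adj (C l))) $$ (i mod n, j mod n) =
        (kron (1\<^sub>m k) (C l) * X * adj (kron (1\<^sub>m k) (C l))) $$ (i, j)"
      using ij dm X l by (simp add: mult_mat_assoc kron_one_mult_index)
        (simp add: mult_mat_index[of "i mod n" "C l"] B_def)
  qed
  also have "\<dots> = ?R $$ (i, j)"
    using ij by (simp add: kraus_map_def mat_sum_index)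
  finally show "?L $$ (i, j) = ?R $$ (i, j)" .
qed (simp_all add: ampliation_def kraus_map_def)

text \<open>By cyclicity of the trace, trace preservation is the completeness relation. It serves in
  both directions: to certify a channel, and to extract completeness from a given one.\<close>

lemma kraus_map_trace:
  assumes C: "\<And>l. l < K \<Longrightarrow> dim_row (C l) = n" "\<And>l. l < K \<Longrightarrow> dim_col (C l) = m"
    and X: "dim_row X = m" "dim_col X = m"
  shows "mat_trace (kraus_map n K C X) = mat_trace (mat_sum m m K (\<lambda>l. adj (C l) * C l) * X)"
proof -
  have "mat_trace (kraus_map n K C X) = (\<Sum>l<K. mat_trace (C l * (X * adj (C l))))"
    unfolding kraus_map_def mat_trace_mat_sum using C X by (simp add: mat_trace_def mult_mat_assoc)
  also have "\<dots> = (\<Sum>l<K. mat_trace (adj (C l) * C l * X))"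
  proof (rule sum.cong, rule refl)
    fix l assume "l \<in> {..<K}"
    then have l: "dim_row (C l) = n" "dim_col (C l) = m" using C by auto
    have "mat_trace (C l * (X * adj (C l))) = mat_trace (X * (adj (C l) * C l))"
      using l X by (subst mat_trace_mult_commute) (simp_all add: mult_mat_assoc)
    also have "\<dots> = mat_trace (adj (C l) * C l * X)"
      using l X by (subst mat_trace_mult_commute) simp_all
    finally show "mat_trace (C l * (X * adj (C l))) = mat_trace (adj (C l) * C l * X)" .
  qed
  also have "\<dots> = mat_trace (mat_sum m m K (\<lambda>l. adj (C l) * C l) * X)"
  proof -
    have "mat_sum m m K (\<lambda>l. adj (C l) * C l) * X = mat_sum m m K (\<lambda>l. adj (C l) * C l * X)"
      using C X by (subst mat_sum_mult_right) simp_all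
    then show ?thesis by (simp add: mat_trace_mat_sum) (simp add: mat_trace_def C X)
  qed
  finally show ?thesis .
qed

lemma cptp_kraus_map:
  assumes C: "\<And>l. l < K \<Longrightarrow> dim_row (C l) = n" "\<And>l. l < K \<Longrightarrow> dim_col (C l) = m"
    and one: "mat_sum m m K (\<lambda>l. adj (C l) * C l) = 1\<^sub>m m"
  shows "cptp m n (kraus_map n K C)"
  unfolding cptp_def
proof (intro conjI ballI allI impI)
  fix X Y :: "complex mat" and c assume XY: "X \<in> carrier_mat m m" "Y \<in> carrier_mat m m"
  show "kraus_map n K C X \<in> carrier_mat n n" by (auto simp: kraus_map_def)
  have d: "dim_row X = m" "dim_col X = m" "dim_row Y = m" "dim_col Y = m" using XY by auto
  have "(C l * (X + Y) * adj (C l)) = C l * X * adj (C l) + C l * Y * adj (C l)"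
    if "l < K" for l by (simp add: mult_add_distrib_dim d C that)
  then show "kraus_map n K C (X + Y) = kraus_map n K C X + kraus_map n K C Y"
    by (intro eq_matI) (simp_all add: kraus_map_def mat_sum_index C d sum.distrib)
  have "(C l * (c \<cdot>\<^sub>m X) * adj (C l)) = c \<cdot>\<^sub>m (C l * X * adj (C l))"
    if "l < K" for l by (simp add: mult_smult_dim d C that)
  then show "kraus_map n K C (c \<cdot>\<^sub>m X) = c \<cdot>\<^sub>m kraus_map n K C X"
    by (intro eq_matI) (simp_all add: kraus_map_def mat_sum_index C d sum_distrib_left)
  show "mat_trace (kraus_map n K C X) = mat_trace X"
    using XY by (subst kraus_map_trace[OF C]) (simp_all add: one)
next
  fix k X assume X: "pos_semidef (k * m) X"
  then have Xd: "dim_row X = k * m" "dim_col X = k * m"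
    using hermitianD by (auto simp: pos_semidef_def)
  have "pos_semidef (k * n) (kraus_map (k * n) K (\<lambda>l. kron (1\<^sub>m k) (C l)) X)"
    unfolding kraus_map_def by (intro pos_semidef_mat_sum pos_semidef_conj[OF X]) (simp_all add: C)
  then show "pos_semidef (k * n) (ampliation k m n (kraus_map n K C) X)"
    by (subst ampliation_kraus_map[OF C Xd]) simp_all
qed

section \<open>Rank-one matrices and the existence of Kraus operators\<close>

lemma ket_bra_dim [simp]: "dim_row (ket_bra v) = dim_vec v" "dim_col (ket_bra v) = dim_vec v"
  by (simp_all add: ket_bra_def)

lemma ket_bra_mult_vec:
  assumes "dim_vec w = dim_vec v"
  shows "ket_bra v *\<^sub>v w = (w \<bullet>c v) \<cdot>\<^sub>v v"
  using assms by (intro eq_vecI)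
    (auto simp: mult_vec_index ket_bra_def cscalar_prod_sum sum_distrib_left sum_distrib_right ac_simps)

lemma pos_semidef_ket_bra:
  assumes "dim_vec v = n"
  shows "pos_semidef n (ket_bra v)"
  unfolding pos_semidef_def
proof (intro conjI ballI)
  show "hermitian n (ket_bra v)"
    using assms by (auto simp: hermitian_def ket_bra_def intro!: eq_matI)
  fix w :: "complex Matrix.vec" assume "w \<in> carrier_vec n"
  then have w: "dim_vec w = dim_vec v" using assms by simp
  have "(ket_bra v *\<^sub>v w) \<bullet>c w = (w \<bullet>c v) * cnj (w \<bullet>c v)"
    using w by (simp add: ket_bra_mult_vec cscalar_prod_commute[of w v])
  then show "0 \<le> Re ((ket_bra v *\<^sub>v w) \<bullet>c w)"
    by (simp add: complex_norm_square[symmetric] flip: of_real_power)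
qed

lemma linear_mat_sum:
  assumes add: "\<And>X Y. X \<in> carrier_mat m m \<Longrightarrow> Y \<in> carrier_mat m m \<Longrightarrow> E (X + Y) = E X + E Y"
    and smult: "\<And>c X. X \<in> carrier_mat m m \<Longrightarrow> E (c \<cdot>\<^sub>m X) = c \<cdot>\<^sub>m E X"
    and dim: "\<And>X. X \<in> carrier_mat m m \<Longrightarrow> E X \<in> carrier_mat n n"
    and F: "\<And>k. k < K \<Longrightarrow> F k \<in> carrier_mat m m"
  shows "E (mat_sum m m K (\<lambda>k. c k \<cdot>\<^sub>m F k)) = mat_sum n n K (\<lambda>k. c k \<cdot>\<^sub>m E (F k))"
  using F
proof (induction K)
  case 0
  have "mat_sum m m 0 (\<lambda>k. c k \<cdot>\<^sub>m F k) = 0 \<cdot>\<^sub>m 1\<^sub>m m"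
    by (intro eq_matI) (auto simp: mat_sum_index)
  then have "E (mat_sum m m 0 (\<lambda>k. c k \<cdot>\<^sub>m F k)) = 0 \<cdot>\<^sub>m E (1\<^sub>m m)"
    by (simp add: smult)
  also have "\<dots> = mat_sum n n 0 (\<lambda>k. c k \<cdot>\<^sub>m E (F k))"
    using dim[of "1\<^sub>m m"] by (intro eq_matI) (auto simp: mat_sum_index)
  finally show ?case .
next
  case (Suc K)
  have S: "mat_sum m' m' (Suc K) G = mat_sum m' m' K G + G K" if "G K \<in> carrier_mat m' m'" for m' G
    using that by (intro eq_matI) (auto simp: mat_sum_index)
  have FK: "F K \<in> carrier_mat m m" "E (F K) \<in> carrier_mat n n" using Suc.prems dim by auto
  have "E (mat_sum m m (Suc K) (\<lambda>k. c k \<cdot>\<^sub>m F k)) = E (mat_sum m m K (\<lambda>k. c k \<cdot>\<^sub>m F k)) + c K \<cdot>\<^sub>m E (F K)"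
  proof -
    have "mat_sum m m K (\<lambda>k. c k \<cdot>\<^sub>m F k) \<in> carrier_mat m m" "c K \<cdot>\<^sub>m F K \<in> carrier_mat m m"
      using FK by (auto intro: carrier_matI)
    then show ?thesis by (subst S) (simp_all add: add smult FK)
  qed
  then show ?case
    using FK Suc by (subst S) auto
qed

text \<open>Choi's construction: the ampliation applied to the unnormalized maximally entangled
  vector gives a positive semidefinite matrix, whose eigenvectors, scaled by the roots of the
  eigenvalues, refold into Kraus operators.\<close>

theorem kraus_exists:
  assumes "cptp m n E"
  obtains C where "\<And>l. l < m * n \<Longrightarrow> dim_row (C l) = n" "\<And>l. l < m * n \<Longrightarrow> dim_col (C l) = m"
    "\<And>X. X \<in> carrier_mat m m \<Longrightarrow> E X = kraus_map n (m * n) C X"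
    "mat_sum m m (m * n) (\<lambda>l. adj (C l) * C l) = 1\<^sub>m m"
proof -
  define \<Omega> where "\<Omega> = ket_bra (vec_rows (1\<^sub>m m))"
  define Choi where "Choi = ampliation m m n E \<Omega>"
  define u where "u = (\<lambda>r s. Matrix.mat m m (\<lambda>(a, b). if a = r \<and> b = s then 1 else 0 :: complex))"
  have uc: "u r s \<in> carrier_mat m m" for r s by (simp add: u_def)
  have dim: "E X \<in> carrier_mat n n" if "X \<in> carrier_mat m m" for X
    using assms that by (simp add: cptp_def)
  have "pos_semidef (m * m) \<Omega>" unfolding \<Omega>_def by (rule pos_semidef_ket_bra) simp
  then have pos: "pos_semidef (m * n) Choi" using assms by (simp add: cptp_def Choi_def)
  then obtain U p where U: "spectral_decomposition (m * n) Choi U p"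
    using spectral_theorem unfolding pos_semidef_def by blast
  note S = spectral_decompositionD[OF U]
  \<comment> \<open>The index of an eigenvector splits into an input part \<open>r\<close>, which
    becomes the column, and an output part \<open>i\<close>, which becomes the row.\<close>
  define C where "C = (\<lambda>l. Matrix.mat n m (\<lambda>(i, r). complex_of_real (sqrt (p l)) * U $$ (r * n + i, l)))"
  have Cd: "dim_row (C l) = n" "dim_col (C l) = m" for l by (simp_all add: C_def)
  have Choi_u: "E (u r s) $$ (i, j) = Choi $$ (r * n + i, s * n + j)"
    if "r < m" "s < m" "i < n" "j < n" for r s i j
  proof -
    have "Matrix.mat m m (\<lambda>(a, b). \<Omega> $$ (r * m + a, s * m + b)) = u r s"
      using that unfolding u_def \<Omega>_def ket_bra_def
      by (intro eq_matI) (auto simp: vec_rows_index)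
    then show ?thesis using that by (simp add: Choi_def ampliation_def)
  qed
  have Choi_C: "Choi $$ (r * n + i, s * n + j) = (\<Sum>l<m * n. C l $$ (i, r) * cnj (C l $$ (j, s)))"
    if "r < m" "s < m" "i < n" "j < n" for r s i j
  proof -
    have "Choi $$ (r * n + i, s * n + j) = (\<Sum>l<m * n. U $$ (r * n + i, l) * complex_of_real (p l) * cnj (U $$ (s * n + j, l)))"
      unfolding S(8) using that S(2,3) by (simp add: mult_mat_index[of _ "U * _"] mat_diag_mult_index)
    also have "\<dots> = (\<Sum>l<m * n. C l $$ (i, r) * cnj (C l $$ (j, s)))"
    proof (rule sum.cong, rule refl)
      fix l assume "l \<in> {..<m * n}"
      then have "p l \<ge> 0" using pos_semidef_spectral[OF U pos] by simp
      then have "complex_of_real (p l) = complex_of_real (sqrt (p l)) * complex_of_real (sqrt (p l))"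
        by (simp flip: of_real_mult)
      then show "U $$ (r * n + i, l) * complex_of_real (p l) * cnj (U $$ (s * n + j, l)) =
          C l $$ (i, r) * cnj (C l $$ (j, s))"
        using that by (simp add: C_def)
    qed
    finally show ?thesis .
  qed
  have E: "E X = kraus_map n (m * n) C X" if X: "X \<in> carrier_mat m m" for X
  proof (rule eq_matI)
    have Xd: "dim_row X = m" "dim_col X = m" using X by auto
    \<comment> \<open>Expansion in matrix units, whose images under \<open>E\<close> are the blocks
      of the Choi matrix.\<close>
    have "X = mat_sum m m (m * m) (\<lambda>k. X $$ (k div m, k mod m) \<cdot>\<^sub>m u (k div m) (k mod m))" (is "_ = ?R")
    proof (rule eq_mat_dimI[of m m])
      fix i j assume ij: "i < m" "j < m"
      have "(\<Sum>k<m * m. (X $$ (k div m, k mod m) \<cdot>\<^sub>m u (k div m) (k mod m)) $$ (i, j)) =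
          (\<Sum>r<m. \<Sum>s<m. (X $$ (r, s) \<cdot>\<^sub>m u r s) $$ (i, j))"
        by (rule sum_div_mod)
      also have "\<dots> = (\<Sum>r<m. if r = i then (\<Sum>s<m. if s = j then X $$ (r, s) else 0) else 0)"
      proof -
        have "(X $$ (r, s) \<cdot>\<^sub>m u r s) $$ (i, j) = (if r = i then if s = j then X $$ (r, s) else 0 else 0)" for r s
          using ij by (simp add: u_def)
        then show ?thesis by (intro sum.cong) auto
      qed
      also have "\<dots> = X $$ (i, j)" using ij by simp
      finally show "X $$ (i, j) = ?R $$ (i, j)"
        using ij by (simp add: mat_sum_index)
    qed (use Xd in auto)
    then have "E X = E (mat_sum m m (m * m) (\<lambda>k. X $$ (k div m, k mod m) \<cdot>\<^sub>m u (k div m) (k mod m)))" by simp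
    also have "\<dots> = mat_sum n n (m * m) (\<lambda>k. X $$ (k div m, k mod m) \<cdot>\<^sub>m E (u (k div m) (k mod m)))"
      using assms uc by (intro linear_mat_sum) (auto simp: cptp_def)
    finally have EX: "E X = mat_sum n n (m * m) (\<lambda>k. X $$ (k div m, k mod m) \<cdot>\<^sub>m E (u (k div m) (k mod m)))" .
    fix i j assume "i < dim_row (kraus_map n (m * n) C X)" "j < dim_col (kraus_map n (m * n) C X)"
    then have ij: "i < n" "j < n" by (auto simp: kraus_map_def)
    have Eu: "dim_row (E (u r s)) = n" "dim_col (E (u r s)) = n" for r s using dim[OF uc] by auto
    have "E X $$ (i, j) = (\<Sum>r<m. \<Sum>s<m. (X $$ (r, s) \<cdot>\<^sub>m E (u r s)) $$ (i, j))"
      unfolding EX using ij by (subst sum_div_mod[symmetric]) (simp add: mat_sum_index)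
    also have "\<dots> = (\<Sum>r<m. \<Sum>s<m. \<Sum>l<m * n. C l $$ (i, r) * X $$ (r, s) * cnj (C l $$ (j, s)))"
      using ij by (intro sum.cong) (auto simp: Eu trans[OF Choi_u Choi_C] sum_distrib_left ac_simps)
    also have "\<dots> = (\<Sum>l<m * n. \<Sum>r<m. \<Sum>s<m. C l $$ (i, r) * X $$ (r, s) * cnj (C l $$ (j, s)))"
      by (simp only: sum.swap[of _ "{..<m}" "{..<m * n}"])
    also have "\<dots> = kraus_map n (m * n) C X $$ (i, j)"
      using ij Xd by (simp add: kraus_map_def mat_sum_index mult_mat_assoc Cd mult_mat_index[of i "C _"]
          mult_mat_index[of _ X] sum_distrib_left mult.assoc)
    finally show "E X $$ (i, j) = kraus_map n (m * n) C X $$ (i, j)" .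
  qed (use dim[OF that] in \<open>auto simp: kraus_map_def\<close>)
  have "mat_sum m m (m * n) (\<lambda>l. adj (C l) * C l) = 1\<^sub>m m" (is "?G = _")
  proof (rule eq_mat_dimI[of m m])
    fix i j assume ij: "i < m" "j < m"
    \<comment> \<open>Pairing with matrix units reads off single entries, so trace preservation
      determines \<open>?G\<close> entry by entry.\<close>
    have tr: "mat_trace (X * u j i) = X $$ (i, j)" if "dim_row X = m" "dim_col X = m" for X
    proof -
      have "mat_trace (X * u j i) = (\<Sum>a<m. \<Sum>b<m. if a = i then (if b = j then X $$ (a, b) else 0) else 0)"
        using that by (auto simp: mat_trace_def mult_mat_index u_def intro!: sum.cong)
      also have "\<dots> = (\<Sum>a<m. if a = i then (\<Sum>b<m. if b = j then X $$ (a, b) else 0) else 0)"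
        by (intro sum.cong) auto
      finally show ?thesis using ij by simp
    qed
    have "?G $$ (i, j) = mat_trace (?G * u j i)" by (simp add: tr)
    also have "\<dots> = mat_trace (kraus_map n (m * n) C (u j i))"
      using kraus_map_trace[of "m * n" C n m "u j i"] Cd by (simp add: u_def)
    also have "\<dots> = mat_trace (1\<^sub>m m * u j i)"
      using assms uc[of j i] by (simp add: E[symmetric] cptp_def u_def)
    also have "\<dots> = 1\<^sub>m m $$ (i, j)" by (rule tr) simp_all
    finally show "?G $$ (i, j) = 1\<^sub>m m $$ (i, j)" .
  qed auto
  with that Cd E show ?thesis by blast
qed

subsection \<open>Relative entropy of commuting matrices\<close>

lemma strictly_posI:
  assumes "spectral_decomposition n A U l" "\<And>i. i < n \<Longrightarrow> l i > 0"
  shows "strictly_pos n A"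
  unfolding strictly_pos_def
proof (intro conjI ballI impI)
  show h: "hermitian n A" using assms(1) by (rule spectral_decomposition_hermitian)
  fix v :: "complex Matrix.vec" assume "v \<in> carrier_vec n" "v \<noteq> 0\<^sub>v n"
  then have v: "dim_vec v = n" "v \<noteq> 0\<^sub>v n" by auto
  have "Re ((mat_fun (\<lambda>x. x) A *\<^sub>v v) \<bullet>c v) \<noteq> 0"
    using positive_form_eq_0[OF assms(1) v(1), of "\<lambda>x. x"] assms(2) v(2) by blast
  moreover have "Re ((mat_fun (\<lambda>x. x) A *\<^sub>v v) \<bullet>c v) \<ge> 0"
    unfolding spectral_weights[OF assms(1) v(1)]
    by (intro sum_nonneg mult_nonneg_nonneg) (use assms(2) in \<open>force+\<close>)
  ultimately show "0 < Re ((A *\<^sub>v v) \<bullet>c v)" by (simp add: mat_fun_id[OF h])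
qed

lemma kron_spectral:
  assumes "spectral_decomposition m A U l" "spectral_decomposition n B V k"
  shows "spectral_decomposition (m * n) (kron A B) (kron U V) (\<lambda>i. l (i div n) * k (i mod n))"
proof -
  note S = spectral_decompositionD[OF assms(1)] and T = spectral_decompositionD[OF assms(2)]
  have "kron A B = kron U V * kron (real_diag m l) (real_diag n k) *
      adj (kron U V)"
    by (simp add: kron_adjoint kron_mult S(2,3) T(2,3)) (simp flip: S(8) T(8))
  moreover have "adj (kron U V) * kron U V = 1\<^sub>m (m * n)"
    by (simp add: kron_adjoint kron_mult S(2,3,6) T(2,3,6) kron_one)
  moreover have "kron U V \<in> carrier_mat (m * n) (m * n)"
    by (rule carrier_matI) (simp_all add: S(2,3) T(2,3))
  ultimately show ?thesis
    unfolding spectral_decomposition_def by (simp add: kron_diag)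
qed

lemma spectral_decomposition_one:
  assumes "spectral_decomposition n A U l"
  shows "spectral_decomposition n (1\<^sub>m n) U (\<lambda>_. 1)"
proof -
  note S = spectral_decompositionD[OF assms]
  have "mat_diag n (\<lambda>i. complex_of_real 1) = 1\<^sub>m n" by (intro eq_matI) auto
  then show ?thesis
    unfolding spectral_decomposition_def using S(1,6,7) by (simp add: S(2,3))
qed

text \<open>In a common eigenbasis the overlaps are Kronecker deltas, which leaves the classical
  f-divergence of the eigenvalues.\<close>

lemma f_rel_entropy_common_basis:
  assumes "spectral_decomposition n \<rho> U p" "spectral_decomposition n \<sigma> U q" "strictly_pos n \<rho>"
  shows "f_rel_entropy f \<rho> \<sigma> = (\<Sum>i<n. p i * f (q i / p i))"
proof -
  note S = spectral_decompositionD[OF assms(1)]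
  have p: "p i > 0" if "i < n" for i using strictly_pos_spectral[OF assms(1,3) that] .
  note modular = modular_op_spectral[OF assms(1,2)]
  define s where "s = mat_fun sqrt \<rho>"
  have s: "s = U * real_diag n (\<lambda>i. sqrt (p i)) * adj U"
    by (simp add: s_def mat_fun_eq[OF assms(1)])
  have sd: "dim_row s = n" "dim_col s = n" by (simp_all add: s S(2,3))
  have "adj (kron U (transpose_mat (adj U))) *\<^sub>v vec_rows s = vec_rows (adj U * s * U)"
    by (simp add: kron_adjoint adj_transpose kron_mult_vec_rows sd S(2,3))
  also have "adj U * s * U = (adj U * U) * real_diag n (\<lambda>i. sqrt (p i)) * (adj U * U)"
    by (simp add: s mult_mat_assoc S(2,3))
  also have "\<dots> = real_diag n (\<lambda>i. sqrt (p i))"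
    by (simp add: S(6))
  finally have diag: "adj (kron U (transpose_mat (adj U))) *\<^sub>v vec_rows s =
      vec_rows (real_diag n (\<lambda>i. sqrt (p i)))" .
  have "f_rel_entropy f \<rho> \<sigma> = (\<Sum>k<n * n. f (q (k div n) / p (k mod n)) *
      (cmod (real_diag n (\<lambda>i. sqrt (p i)) $$ (k div n, k mod n)))\<^sup>2)"
    unfolding f_rel_entropy_modular[OF assms(3)] s_def[symmetric]
    by (subst spectral_weights[OF modular]) (simp_all add: sd diag vec_rows_index)
  also have "\<dots> = (\<Sum>a<n. \<Sum>b<n. f (q a / p b) * (cmod (real_diag n (\<lambda>i. sqrt (p i)) $$ (a, b)))\<^sup>2)"
    by (rule sum_div_mod)
  also have "\<dots> = (\<Sum>a<n. \<Sum>b<n. if b = a then p a * f (q a / p a) else 0)"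
    using p by (intro sum.cong) (auto simp: less_imp_le)
  finally show ?thesis by simp
qed

subsection \<open>Partial traces as reductions\<close>

text \<open>A bijection between the indices below \<open>N\<close> and pairs of a traced-out index
  \<kappa> and a remaining index \<iota>, with inverse \<open>j\<close>. It covers the removal of a
  tensor factor in any position.\<close>

locale index_splitting =
  fixes N m K :: nat and \<kappa> \<iota> :: "nat \<Rightarrow> nat" and j :: "nat \<Rightarrow> nat \<Rightarrow> nat"
  assumes split: "a < N \<Longrightarrow> \<kappa> a < K" "a < N \<Longrightarrow> \<iota> a < m" "a < N \<Longrightarrow> j (\<kappa> a) (\<iota> a) = a"
    and join: "k < K \<Longrightarrow> i < m \<Longrightarrow> j k i < N" "k < K \<Longrightarrow> i < m \<Longrightarrow> \<kappa> (j k i) = k" "k < K \<Longrightarrow> i < m \<Longrightarrow> \<iota> (j k i) = i"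
begin

definition embed :: "nat \<Rightarrow> complex mat" where
  "embed k = Matrix.mat N m (\<lambda>(a, i). if \<kappa> a = k \<and> \<iota> a = i then 1 else 0)"

lemma embed_dim [simp]: "dim_row (embed k) = N" "dim_col (embed k) = m"
  by (simp_all add: embed_def)

lemma embed_index: "a < N \<Longrightarrow> i < m \<Longrightarrow> embed k $$ (a, i) = (if \<kappa> a = k \<and> \<iota> a = i then 1 else 0)"
  by (simp add: embed_def)

lemma mult_embed:
  assumes "k < K" "i < m" "dim_col X = N" "r < dim_row X"
  shows "(X * embed k) $$ (r, i) = X $$ (r, j k i)"
proof -
  have "(X * embed k) $$ (r, i) = (\<Sum>a<N. X $$ (r, a) * embed k $$ (a, i))"
    using assms by (simp add: mult_mat_index)
  also have "\<dots> = (\<Sum>a<N. if a = j k i then X $$ (r, a) else 0)"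
  proof (rule sum.cong, rule refl)
    fix a assume "a \<in> {..<N}"
    then have a: "a < N" by simp
    then have "\<kappa> a = k \<and> \<iota> a = i \<longleftrightarrow> a = j k i" using split(3)[OF a] join assms by auto
    then show "X $$ (r, a) * embed k $$ (a, i) = (if a = j k i then X $$ (r, a) else 0)"
      using a assms by (simp add: embed_index)
  qed
  finally show ?thesis using assms join by simp
qed

lemma mult_adjoint_embed:
  assumes "b < N" "dim_col X = m" "r < dim_row X"
  shows "(X * adj (embed k)) $$ (r, b) = (if \<kappa> b = k then X $$ (r, \<iota> b) else 0)"
proof -
  have "(X * adj (embed k)) $$ (r, b) = (\<Sum>i<m. X $$ (r, i) * cnj (embed k $$ (b, i)))"
    using assms by (simp add: mult_mat_index)
  also have "\<dots> = (\<Sum>i<m. if i = \<iota> b then (if \<kappa> b = k then X $$ (r, i) else 0) else 0)"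
    using assms by (intro sum.cong) (auto simp: embed_index)
  finally have "(X * adj (embed k)) $$ (r, b) =
      (\<Sum>i<m. if i = \<iota> b then (if \<kappa> b = k then X $$ (r, i) else 0) else 0)" .
  then show ?thesis using split(2)[OF assms(1)] by simp
qed

lemma adjoint_embed_mult:
  assumes "k < K" "i < m" "dim_row X = N" "c < dim_col X"
  shows "(adj (embed k) * X) $$ (i, c) = X $$ (j k i, c)"
proof -
  have "(adj (embed k) * X) $$ (i, c) = cnj ((adj X * embed k) $$ (c, i))"
    using adj_index[of i "adj X * embed k" c] assms by (simp add: adj_mult)
  then show ?thesis using assms join by (simp add: mult_embed)
qed

lemma embed_mult:
  assumes "a < N" "dim_row X = m" "c < dim_col X"
  shows "(embed k * X) $$ (a, c) = (if \<kappa> a = k then X $$ (\<iota> a, c) else 0)"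
proof -
  have "(embed k * X) $$ (a, c) = cnj ((adj X * adj (embed k)) $$ (c, a))"
    using adj_index[of a "adj X * adj (embed k)" c] assms by (simp add: adj_mult)
  then show ?thesis using assms split by (simp add: mult_adjoint_embed)
qed

lemma sum_embed_conj_index:
  assumes "a < N" "b < N" "dim_row X = m" "dim_col X = m"
  shows "mat_sum N N K (\<lambda>k. embed k * X * adj (embed k)) $$ (a, b) =
    (if \<kappa> a = \<kappa> b then X $$ (\<iota> a, \<iota> b) else 0)"
proof -
  have "mat_sum N N K (\<lambda>k. embed k * X * adj (embed k)) $$ (a, b) =
      (\<Sum>k<K. if k = \<kappa> b then (if \<kappa> a = \<kappa> b then X $$ (\<iota> a, \<iota> b) else 0) else 0)"
    using assms split by (simp add: mat_sum_index mult_adjoint_embed embed_mult)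
  then show ?thesis using split assms by simp
qed

sublocale factor_embedding N m K embed
proof
  show "adj (embed k) * embed l = (if k = l then 1\<^sub>m m else 0\<^sub>m m m)" if "k < K" "l < K" for k l
    using that join by (intro eq_matI) (auto simp: adjoint_embed_mult embed_index)
  have "mat_sum N N K (\<lambda>k. embed k * adj (embed k)) = mat_sum N N K (\<lambda>k. embed k * 1\<^sub>m m * adj (embed k))"
    by (intro mat_sum_cong) simp
  also have "\<dots> = 1\<^sub>m N"
  proof (rule eq_mat_dimI[of N N])
    fix a b assume ab: "a < N" "b < N"
    have "\<kappa> a = \<kappa> b \<and> \<iota> a = \<iota> b \<longleftrightarrow> a = b" using split(3)[OF ab(1)] split(3)[OF ab(2)] by metis
    then show "mat_sum N N K (\<lambda>k. embed k * 1\<^sub>m m * adj (embed k)) $$ (a, b) = 1\<^sub>m N $$ (a, b)"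
      by (subst sum_embed_conj_index) (use ab split in auto)
  qed auto
  finally show "mat_sum N N K (\<lambda>k. embed k * adj (embed k)) = 1\<^sub>m N" .
qed simp_all

lemma reduce_index:
  assumes "dim_row A = N" "dim_col A = N" "i < m" "i' < m"
  shows "reduce A $$ (i, i') = (\<Sum>k<K. A $$ (j k i, j k i'))"
  using assms join unfolding reduce_def by (simp add: mat_sum_index mult_embed adjoint_embed_mult)

end

lemma index_splitting_second:
  "index_splitting (d * e) d e (\<lambda>a. a mod e) (\<lambda>a. a div e) (\<lambda>k i. i * e + k)"
  by unfold_locales (simp_all add: div_mod_less)

lemma middle_index:
  fixes r k l e1 e2 :: nat
  assumes "k < e2" "l < e1"
  shows "(r * (e2 * e1) + (k * e1 + l)) div e1 mod e2 = k" "(r * (e2 * e1) + (k * e1 + l)) mod e1 = l"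
    "(r * (e2 * e1) + (k * e1 + l)) div (e2 * e1) = r" "(r * (e2 * e1) + (k * e1 + l)) mod (e2 * e1) = k * e1 + l"
proof -
  have eq: "r * (e2 * e1) + (k * e1 + l) = (r * e2 + k) * e1 + l" by (simp add: algebra_simps)
  show "(r * (e2 * e1) + (k * e1 + l)) div e1 mod e2 = k" "(r * (e2 * e1) + (k * e1 + l)) mod e1 = l"
    unfolding eq using assms by (simp_all only: index_div_mod)
  have "k * e1 + l < e2 * e1" using assms by simp
  then show "(r * (e2 * e1) + (k * e1 + l)) div (e2 * e1) = r" "(r * (e2 * e1) + (k * e1 + l)) mod (e2 * e1) = k * e1 + l"
    by (simp_all only: index_div_mod)
qed

text \<open>For reference, second environment and first environment in this order, the traced-out
  index is the digit in the middle of a three-digit mixed-radix number.\<close>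

lemma index_splitting_middle:
  "index_splitting (d * (e2 * e1)) (d * e1) e2 (\<lambda>a. a div e1 mod e2) (\<lambda>a. a div (e2 * e1) * e1 + a mod e1)
    (\<lambda>k i. i div e1 * (e2 * e1) + (k * e1 + i mod e1))"
proof
  fix a assume "a < d * (e2 * e1)"
  then have a: "a < (d * e2) * e1" "a < d * (e2 * e1)" by (simp_all add: mult.assoc)
  note 1 = div_mod_less[OF a(1)] and 2 = div_mod_less[OF div_mod_less(1)[OF a(1)]] and 3 = div_mod_less[OF a(2)]
  show "a div e1 mod e2 < e2" by (rule 2)
  show "a div (e2 * e1) * e1 + a mod e1 < d * e1" by (rule index_less[OF 3(1) 1(2)])
  have "a div (e2 * e1) = a div e1 div e2" by (metis div_mult2_eq mult.commute)
  moreover have "r * (e2 * e1) + (k * e1 + l) = (r * e2 + k) * e1 + l" for r k l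
    by (simp add: algebra_simps)
  ultimately show "(a div (e2 * e1) * e1 + a mod e1) div e1 * (e2 * e1) + (a div e1 mod e2 * e1 + (a div (e2 * e1) * e1 + a mod e1) mod e1) = a"
    unfolding index_div_mod[OF 1(2)] by (simp only: div_mult_mod_eq)
next
  fix k i assume k: "k < e2" and i: "i < d * e1"
  note 1 = div_mod_less[OF i]
  have "k * e1 + i mod e1 < e2 * e1" by (rule index_less[OF k 1(2)])
  then show "i div e1 * (e2 * e1) + (k * e1 + i mod e1) < d * (e2 * e1)" by (rule index_less[OF 1(1)])
  show "(i div e1 * (e2 * e1) + (k * e1 + i mod e1)) div e1 mod e2 = k" by (rule middle_index[OF k 1(2)])
  show "(i div e1 * (e2 * e1) + (k * e1 + i mod e1)) div (e2 * e1) * e1 + (i div e1 * (e2 * e1) + (k * e1 + i mod e1)) mod e1 = i"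
    unfolding middle_index[OF k 1(2)] by (rule div_mult_mod_eq)
qed

subsection \<open>Reference and environment\<close>

text \<open>Up to transposition, the Gram matrices \<open>\<Psi> \<Psi>\<^sup>*\<close> and \<open>\<Psi>\<^sup>* \<Psi>\<close> of this \<open>\<Psi>\<close> are the reduced states of \<open>\<psi>\<close>.\<close>

definition psi_mat :: "nat \<Rightarrow> complex Matrix.vec \<Rightarrow> complex mat" where
  "psi_mat d \<psi> = Matrix.mat d d (\<lambda>(r, q). vec_index \<psi> (r * d + q))"

text \<open>The slice of the isometry at environment basis vector \<open>k\<close>: the Kraus
  operator of the channel for this outcome.\<close>

definition kraus_of :: "nat \<Rightarrow> nat \<Rightarrow> complex mat \<Rightarrow> nat \<Rightarrow> complex mat" where
  "kraus_of n e V k = Matrix.mat n (dim_col V) (\<lambda>(q, i). V $$ (q * e + k, i))"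

lemma psi_mat_dim [simp]: "dim_row (psi_mat d \<psi>) = d" "dim_col (psi_mat d \<psi>) = d"
  by (simp_all add: psi_mat_def)

lemma kraus_of_dim [simp]: "dim_row (kraus_of n e V k) = n" "dim_col (kraus_of n e V k) = dim_col V"
  by (simp_all add: kraus_of_def)

lemma kraus_of_index: "q < n \<Longrightarrow> i < dim_col V \<Longrightarrow> kraus_of n e V k $$ (q, i) = V $$ (q * e + k, i)"
  by (simp add: kraus_of_def)

lemma vec_rows_psi_mat:
  assumes "dim_vec \<psi> = d * d"
  shows "vec_rows (psi_mat d \<psi>) = \<psi>"
  using assms by (intro eq_vecI) (auto simp: vec_rows_index psi_mat_def div_mod_less)

lemma state_RE_dim [simp]: "dim_row (state_RE d n e \<psi> V) = d * e" "dim_col (state_RE d n e \<psi> V) = d * e"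
  by (simp_all add: state_RE_def ampliation_def)

lemma state_E_dim [simp]: "dim_row (state_E d n e \<psi> V) = e" "dim_col (state_E d n e \<psi> V) = e"
  by (simp_all add: state_E_def ptrace1_def)

text \<open>The global vector is the stacking of the purification matrix times the transposed
  isometry. Summing out the output system joins two slices of the isometry into
  \<open>adj (K l) * K k\<close>, the only trace that the channel leaves in the joint state.\<close>

lemma state_RE_index:
  assumes "dim_vec \<psi> = d * d" "dim_row V = n * e" "dim_col V = d" "i < d * e" "j < d * e"
  shows "state_RE d n e \<psi> V $$ (i, j) = (psi_mat d \<psi> *
    transpose_mat (adj (kraus_of n e V (j mod e)) * kraus_of n e V (i mod e)) * adj (psi_mat d \<psi>)) $$ (i div e, j div e)"
proof -
  note dm = div_mod_less[OF assms(4)] div_mod_less[OF assms(5)]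
  define \<Psi> where "\<Psi> = psi_mat d \<psi>"
  have \<Psi>d: "dim_row \<Psi> = d" "dim_col \<Psi> = d" by (simp_all add: \<Psi>_def)
  define K where "K = kraus_of n e V"
  have Kd: "dim_row (K k) = n" "dim_col (K k) = d" for k by (simp_all add: K_def assms(3))
  define \<phi> where "\<phi> = kron (1\<^sub>m d) V *\<^sub>v \<psi>"
  have "\<phi> = vec_rows (\<Psi> * transpose_mat V)"
    unfolding \<phi>_def using kron_mult_vec_rows[of "1\<^sub>m d" \<Psi> V] assms(1-3) \<Psi>d
    by (simp add: vec_rows_psi_mat[OF assms(1)] \<Psi>_def)
  then have \<phi>: "vec_index \<phi> (r * (n * e) + (q * e + k)) = (\<Psi> * transpose_mat (K k)) $$ (r, q)"
    if "r < d" "q < n" "k < e" for r q k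
    using that index_less[OF that(2,3)] assms(2,3) \<Psi>d
    by (simp add: vec_rows_index mult_mat_index K_def kraus_of_index)
  have \<phi>d: "dim_vec \<phi> = d * (n * e)" by (simp add: \<phi>_def assms(2))
  have "state_RE d n e \<psi> V $$ (i, j) = (\<Sum>q<n. ket_bra \<phi> $$ ((i div e) * (n * e) + (q * e + i mod e), (j div e) * (n * e) + (q * e + j mod e)))"
    using dm assms(4,5) by (simp add: state_RE_def ampliation_def ptrace1_def \<phi>_def[symmetric])
  also have "\<dots> = (\<Sum>q<n. (\<Psi> * transpose_mat (K (i mod e))) $$ (i div e, q) * cnj ((\<Psi> * transpose_mat (K (j mod e))) $$ (j div e, q)))"
    using dm by (intro sum.cong) (auto simp: ket_bra_def \<phi>d \<phi>)
  also have "\<dots> = ((\<Psi> * transpose_mat (K (i mod e))) * adj (\<Psi> * transpose_mat (K (j mod e)))) $$ (i div e, j div e)"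
    using dm \<Psi>d Kd by (simp add: mult_mat_index[of "i div e" "\<Psi> * transpose_mat (K (i mod e))"])
  also have "(\<Psi> * transpose_mat (K (i mod e))) * adj (\<Psi> * transpose_mat (K (j mod e))) =
      \<Psi> * transpose_mat (adj (K (j mod e)) * K (i mod e)) * adj \<Psi>"
    using \<Psi>d Kd by (simp add: adj_mult adj_transpose transpose_mult_dim mult_mat_assoc)
  finally show ?thesis by (simp add: \<Psi>_def K_def)
qed

lemma state_E_index:
  "k < e \<Longrightarrow> l < e \<Longrightarrow> state_E d n e \<psi> V $$ (k, l) = (\<Sum>r<d. state_RE d n e \<psi> V $$ (r * e + k, r * e + l))"
  by (simp add: state_E_def ptrace1_def)

lemma kraus_of_complete:
  assumes "dim_row V = n * e" "dim_col V = d" "adj V * V = 1\<^sub>m d"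
  shows "mat_sum d d e (\<lambda>k. adj (kraus_of n e V k) * kraus_of n e V k) = 1\<^sub>m d" (is "?L = _")
proof (rule eq_mat_dimI[of d d])
  fix i j assume ij: "i < d" "j < d"
  have "(adj V * V) $$ (i, j) = (\<Sum>q<n. \<Sum>k<e. cnj (V $$ (q * e + k, i)) * V $$ (q * e + k, j))"
    using ij assms(1,2) by (simp add: mult_mat_index sum_mult_index)
  also have "\<dots> = (\<Sum>k<e. \<Sum>q<n. cnj (V $$ (q * e + k, i)) * V $$ (q * e + k, j))" by (rule sum.swap)
  also have "\<dots> = ?L $$ (i, j)"
    using ij assms(2) by (simp add: mat_sum_index mult_mat_index kraus_of_index)
  finally show "?L $$ (i, j) = 1\<^sub>m d $$ (i, j)"
    using assms(3) by simp
qed auto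

lemma realizes_kraus_map:
  assumes "realizes d n e V E" "X \<in> carrier_mat d d"
  shows "E X = kraus_map n e (kraus_of n e V) X"
proof -
  have V: "dim_row V = n * e" "dim_col V = d" and E: "E X = ptrace2 n e (V * X * adj V)"
    using assms by (auto simp: realizes_def)
  have X: "dim_row X = d" "dim_col X = d" using assms(2) by auto
  have VX: "(V * X) $$ (q * e + k, s) = (kraus_of n e V k * X) $$ (q, s)" if "q < n" "k < e" "s < d" for q k s
    using that V X by (simp add: mult_mat_index kraus_of_index)
  show ?thesis
    unfolding E
  proof (rule eq_mat_dimI[of n n])
    fix i j assume ij: "i < n" "j < n"
    have "(V * X * adj V) $$ (i * e + k, j * e + k) =
        (kraus_of n e V k * X * adj (kraus_of n e V k)) $$ (i, j)" if "k < e" for k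
      using that ij V X by (simp add: mult_mat_index[of _ "_ * X"] VX kraus_of_index)
    then show "ptrace2 n e (V * X * adj V) $$ (i, j) = kraus_map n e (kraus_of n e V) X $$ (i, j)"
      using ij by (simp add: ptrace2_def kraus_map_def mat_sum_index)
  qed (simp_all add: ptrace2_def kraus_map_def)
qed

text \<open>With the second environment in front, the index \<open>k * e1 + l\<close> is a pair of
  one outcome per step, and the Kraus operators of the composite are products.\<close>

lemma kraus_of_compose:
  assumes "dim_row V1 = n * e1" "dim_col V1 = d" "dim_row V2 = n' * e2" "dim_col V2 = n" "k < e2" "l < e1"
  shows "kraus_of n' (e2 * e1) (compose_isometry e1 V2 V1) (k * e1 + l) = kraus_of n' e2 V2 k * kraus_of n e1 V1 l" (is "?L = ?R")
proof (rule eq_mat_dimI[of n' d])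
  fix q i assume qi: "q < n'" "i < d"
  have b: "q * e2 + k < n' * e2" using qi(1) assms(5) by simp
  have eq: "q * (e2 * e1) + (k * e1 + l) = (q * e2 + k) * e1 + l" by (simp add: algebra_simps)
  have a: "(q * e2 + k) * e1 + l < n' * e2 * e1" by (rule index_less[OF b assms(6)])
  have "(kron V2 (1\<^sub>m e1) * V1) $$ ((q * e2 + k) * e1 + l, i) =
      (\<Sum>c<n * e1. V2 $$ (q * e2 + k, c div e1) * 1\<^sub>m e1 $$ (l, c mod e1) * V1 $$ (c, i))"
    using a qi assms by (simp add: mult_mat_index kron_index)
  also have "\<dots> = (\<Sum>c<n. \<Sum>r<e1. if r = l then V2 $$ (q * e2 + k, c) * V1 $$ (c * e1 + r, i) else 0)"
    using assms(6) unfolding sum_mult_index by (intro sum.cong) auto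
  also have "\<dots> = (\<Sum>c<n. V2 $$ (q * e2 + k, c) * V1 $$ (c * e1 + l, i))"
    using assms(6) by simp
  finally show "?L $$ (q, i) =
      ?R $$ (q, i)"
    using qi assms by (simp add: kraus_of_index compose_isometry_def eq mult_mat_index[of q])
qed (simp_all add: assms compose_isometry_def)

lemma kraus_map_compose:
  assumes "\<And>t. t < L \<Longrightarrow> dim_row (C t) = d" "\<And>t. t < L \<Longrightarrow> dim_col (C t) = n"
    and "\<And>k. k < e \<Longrightarrow> dim_row (K k) = n" "\<And>k. k < e \<Longrightarrow> dim_col (K k) = m"
    and "dim_row X = m" "dim_col X = m"
  shows "kraus_map d L C (kraus_map n e K X) = kraus_map d (L * e) (\<lambda>t. C (t div e) * K (t mod e)) X" (is "?L = ?R")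
proof (rule eq_mat_dimI[of d d])
  fix i j assume ij: "i < d" "j < d"
  have "C t * kraus_map n e K X * adj (C t) =
      mat_sum d d e (\<lambda>k. C t * K k * X * adj (C t * K k))" if t: "t < L" for t
  proof -
    have "C t * kraus_map n e K X * adj (C t) = mat_sum d d e (\<lambda>k. C t * (K k * X * adj (K k)) * adj (C t))"
      unfolding kraus_map_def using t assms by (simp add: mat_sum_mult_left mat_sum_mult_right)
    also have "\<dots> = mat_sum d d e (\<lambda>k. C t * K k * X * adj (C t * K k))"
      using t assms by (intro mat_sum_cong) (simp add: mult_mat_assoc adj_mult)
    finally show ?thesis .
  qed
  then have "?L $$ (i, j) =
      (\<Sum>t<L. \<Sum>k<e. (C t * K k * X * adj (C t * K k)) $$ (i, j))"
    unfolding kraus_map_def[of d L] using ij by (simp add: mat_sum_index)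
  also have "\<dots> = (\<Sum>t<L * e. (C (t div e) * K (t mod e) * X * adj (C (t div e) * K (t mod e))) $$ (i, j))"
    by (rule sum_div_mod[symmetric])
  finally show "?L $$ (i, j) =
      ?R $$ (i, j)"
    using ij by (simp add: kraus_map_def mat_sum_index)
qed (simp_all add: kraus_map_def)

text \<open>Completeness of \<open>C\<close> inserted between the two factors: a subsequent channel
  preserves the Gram products of Kraus operators once its own outcomes are summed.\<close>

lemma gram_kraus_mult:
  assumes "\<And>t. t < L \<Longrightarrow> dim_row (C t) = d" "\<And>t. t < L \<Longrightarrow> dim_col (C t) = n"
    and "dim_row A = n" "dim_row B = n"
    and "mat_sum n n L (\<lambda>t. adj (C t) * C t) = 1\<^sub>m n"
  shows "mat_sum (dim_col A) (dim_col B) L (\<lambda>t. adj (C t * A) * (C t * B)) = adj A * B"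
proof -
  have "adj A * B = adj A * (mat_sum n n L (\<lambda>t. adj (C t) * C t) * B)"
    using assms by simp
  also have "\<dots> = mat_sum (dim_col A) (dim_col B) L (\<lambda>t. adj A * (adj (C t) * C t * B))"
    using assms(1-4) by (simp add: mat_sum_mult_right mat_sum_mult_left)
  also have "\<dots> = mat_sum (dim_col A) (dim_col B) L (\<lambda>t. adj (C t * A) * (C t * B))"
    using assms(1-4) by (intro mat_sum_cong) (simp add: adj_mult mult_mat_assoc)
  finally show ?thesis by simp
qed

lemma mat_sum_append:
  "mat_sum m n (K + L) F = mat_sum m n K F + mat_sum m n L (\<lambda>k. F (K + k))"
proof -
  have "(\<Sum>k<K + L. g k) = (\<Sum>k<K. g k) + (\<Sum>k<L. g (K + k))" for g :: "nat \<Rightarrow> complex"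
    by (induction L) (simp_all add: add.assoc)
  then show ?thesis by (intro eq_matI) (auto simp: mat_sum_index)
qed

lemma mat_trace_mult_transpose:
  "dim_row X = dim_row Y \<Longrightarrow> dim_col X = dim_col Y \<Longrightarrow>
    mat_trace (X * transpose_mat Y) = mat_trace (Y * transpose_mat X)"
  by (simp add: mat_trace_def mult_mat_index mult.commute)

text \<open>
  Under the Knill-Laflamme condition the adjoints of the orthonormalized Kraus operators, together with
  operators supported on the complement of their range, form a recovery operation.
\<close>

lemma recovery_kraus:
  assumes K: "\<And>k. k < e \<Longrightarrow> dim_row (K k) = n" "\<And>k. k < e \<Longrightarrow> dim_col (K k) = d" and "d > 0"
    and KL: "\<And>k l. k < e \<Longrightarrow> l < e \<Longrightarrow> adj (K l) * K k = \<beta> $$ (k, l) \<cdot>\<^sub>m 1\<^sub>m d"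
    and \<beta>: "spectral_decomposition e \<beta> T \<mu>" "\<And>i. i < e \<Longrightarrow> \<mu> i > 0" "(\<Sum>i<e. \<mu> i) = 1"
  obtains C c where "\<And>t. t < e + n \<Longrightarrow> dim_row (C t) = d" "\<And>t. t < e + n \<Longrightarrow> dim_col (C t) = n"
    "mat_sum n n (e + n) (\<lambda>t. adj (C t) * C t) = 1\<^sub>m n"
    "\<And>t k. t < e + n \<Longrightarrow> k < e \<Longrightarrow> C t * K k = c t k \<cdot>\<^sub>m 1\<^sub>m d"
    "(\<Sum>t<e + n. \<Sum>k<e. (cmod (c t k))\<^sup>2) = 1"
proof -
  note S = spectral_decompositionD[OF \<beta>(1)]
  define q where "q = (\<lambda>m. complex_of_real (sqrt (\<mu> m)))"
  have q: "q m \<noteq> 0" "q m * q m = complex_of_real (\<mu> m)" "cnj (q m) = q m" if "m < e" for m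
    using \<beta>(2)[OF that] by (simp_all add: q_def flip: of_real_mult)
  \<comment> \<open>Diagonalizing \<beta> by \<open>T\<close> turns the Kraus operators into
    combinations with mutually orthogonal ranges; dividing by the roots \<open>q m\<close> makes
    them isometries, and \<open>A m\<close> is the adjoint of the \<open>m\<close>-th one.\<close>
  define A where "A = (\<lambda>m. mat_sum d n e (\<lambda>l. (T $$ (l, m) / q m) \<cdot>\<^sub>m adj (K l)))"
  have Ad: "dim_row (A m) = d" "dim_col (A m) = n" for m by (simp_all add: A_def)
  have \<beta>T: "(\<Sum>l<e. \<beta> $$ (k, l) * T $$ (l, m)) = T $$ (k, m) * complex_of_real (\<mu> m)" if "k < e" "m < e" for k m
  proof -
    have "\<beta> * T = T * real_diag e (\<lambda>i. \<mu> i)"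
      unfolding S(8) by (simp add: mult_mat_assoc S(2,3,6))
    from arg_cong[OF this, of "\<lambda>M. M $$ (k, m)"] show ?thesis
      using that S(2-5) by (simp add: mult_mat_index[of k \<beta>] mat_diag_mult_index)
  qed
  have TT: "(\<Sum>k<e. cnj (T $$ (k, m)) * T $$ (k, m')) = (if m = m' then 1 else 0)" if "m < e" "m' < e" for m m'
    using arg_cong[OF S(6), of "\<lambda>M. M $$ (m, m')"] that S(2,3) by (simp add: mult_mat_index)
  have TT': "(\<Sum>m<e. T $$ (k, m) * cnj (T $$ (l, m))) = (if k = l then 1 else 0)" if "k < e" "l < e" for k l
    using arg_cong[OF S(7), of "\<lambda>M. M $$ (k, l)"] that S(2,3) by (simp add: mult_mat_index)
  have AK: "A m * K k = (T $$ (k, m) * q m) \<cdot>\<^sub>m 1\<^sub>m d" if "m < e" "k < e" for m k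
  proof -
    have "A m * K k = mat_sum d d e (\<lambda>l. (T $$ (l, m) / q m * \<beta> $$ (k, l)) \<cdot>\<^sub>m 1\<^sub>m d)"
      unfolding A_def using that K
      by (subst mat_sum_mult_right) (auto simp: mult_smult_dim KL intro!: mat_sum_cong eq_matI)
    also have "\<dots> = (T $$ (k, m) * q m) \<cdot>\<^sub>m 1\<^sub>m d" (is "_ = ?R")
    proof (rule eq_mat_dimI[of d d])
      fix i j assume ij: "i < d" "j < d"
      have "(\<Sum>l<e. T $$ (l, m) / q m * \<beta> $$ (k, l)) = (\<Sum>l<e. \<beta> $$ (k, l) * T $$ (l, m)) / q m"
        by (simp add: sum_divide_distrib mult.commute)
      also have "\<dots> = T $$ (k, m) * q m"
        using \<beta>T[of k m] q[OF that(1)] that by (simp add: field_simps)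
      finally show "mat_sum d d e (\<lambda>l. (T $$ (l, m) / q m * \<beta> $$ (k, l)) \<cdot>\<^sub>m 1\<^sub>m d) $$ (i, j) =
          ?R $$ (i, j)"
        using ij by (simp add: mat_sum_index)
    qed auto
    finally show ?thesis .
  qed
  have Aadj: "adj (A m) = mat_sum n d e (\<lambda>l. (cnj (T $$ (l, m)) / q m) \<cdot>\<^sub>m K l)" if "m < e" for m
    unfolding A_def using K q(3)[OF that]
    by (subst mat_sum_adjoint) (auto simp: adj_smult intro!: mat_sum_cong)
  have AA: "A m * adj (A m') = (if m = m' then 1\<^sub>m d else 0\<^sub>m d d)" if m: "m < e" "m' < e" for m m'
  proof -
    have "A m * adj (A m') = mat_sum d d e (\<lambda>l. (cnj (T $$ (l, m')) / q m' * (T $$ (l, m) * q m)) \<cdot>\<^sub>m 1\<^sub>m d)"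
      unfolding Aadj[OF m(2)] using m K Ad
      by (subst mat_sum_mult_left) (auto simp: mult_smult_dim AK intro!: mat_sum_cong eq_matI)
    also have "\<dots> = (if m = m' then 1\<^sub>m d else 0\<^sub>m d d)"
    proof (rule eq_mat_dimI[of d d])
      fix i j assume ij: "i < d" "j < d"
      have "(\<Sum>l<e. cnj (T $$ (l, m')) / q m' * (T $$ (l, m) * q m)) =
          (\<Sum>l<e. cnj (T $$ (l, m')) * T $$ (l, m)) * q m / q m'"
        by (simp add: sum_divide_distrib sum_distrib_right mult.assoc)
      also have "\<dots> = (if m = m' then 1 else 0)" using TT[of m' m] m q(1) by auto
      finally have coeff: "(\<Sum>l<e. cnj (T $$ (l, m')) / q m' * (T $$ (l, m) * q m)) = (if m = m' then 1 else 0)" .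
      have "mat_sum d d e (\<lambda>l. (cnj (T $$ (l, m')) / q m' * (T $$ (l, m) * q m)) \<cdot>\<^sub>m 1\<^sub>m d) $$ (i, j) =
          (\<Sum>l<e. cnj (T $$ (l, m')) / q m' * (T $$ (l, m) * q m)) * 1\<^sub>m d $$ (i, j)"
        using ij by (simp add: mat_sum_index sum_distrib_right del: index_one_mat(1))
      then show "mat_sum d d e (\<lambda>l. (cnj (T $$ (l, m')) / q m' * (T $$ (l, m) * q m)) \<cdot>\<^sub>m 1\<^sub>m d) $$ (i, j) =
          (if m = m' then 1\<^sub>m d else 0\<^sub>m d d) $$ (i, j)"
        unfolding coeff using ij by auto
    qed auto
    finally show ?thesis .
  qed
  \<comment> \<open>The projection onto the span of these ranges, which contains the range of every
    \<open>K k\<close>.\<close>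
  define P where "P = mat_sum n n e (\<lambda>m. adj (A m) * A m)"
  have Pd: "dim_row P = n" "dim_col P = n" by (simp_all add: P_def)
  have P_adj: "adj P = P"
    unfolding P_def by (subst mat_sum_adjoint) (simp_all add: Ad adj_mult)
  have AP: "A m * P = A m" if m: "m < e" for m
  proof -
    have "A m * P = mat_sum d n e (\<lambda>m'. (A m * adj (A m')) * A m')"
      unfolding P_def by (subst mat_sum_mult_left) (simp_all add: Ad mult_mat_assoc)
    also have "\<dots> = A m"
    proof (rule eq_matI)
      fix i j assume ij: "i < dim_row (A m)" "j < dim_col (A m)"
      have "(\<Sum>m'<e. ((A m * adj (A m')) * A m') $$ (i, j)) = (\<Sum>m'<e. if m' = m then A m $$ (i, j) else 0)"
        using m ij by (intro sum.cong) (auto simp: AA Ad)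
      then show "mat_sum d n e (\<lambda>m'. (A m * adj (A m')) * A m') $$ (i, j) = A m $$ (i, j)"
        using ij m by (simp add: mat_sum_index Ad)
    qed (simp_all add: Ad)
    finally show ?thesis .
  qed
  have PP: "P * P = P"
  proof -
    have "P * P = mat_sum n n e (\<lambda>m. adj (A m) * (A m * P))"
      by (subst (1) P_def, subst mat_sum_mult_right) (simp_all add: Ad Pd mult_mat_assoc)
    also have "\<dots> = mat_sum n n e (\<lambda>m. adj (A m) * A m)"
      by (intro mat_sum_cong) (simp add: AP)
    finally show ?thesis by (simp add: P_def)
  qed
  have PK: "P * K k = K k" if k: "k < e" for k
  proof -
    have "P * K k = mat_sum n d e (\<lambda>m. adj (A m) * (A m * K k))"
      unfolding P_def using K k by (subst mat_sum_mult_right) (simp_all add: Ad mult_mat_assoc)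
    also have "\<dots> = mat_sum n d e (\<lambda>m. (T $$ (k, m) * q m) \<cdot>\<^sub>m adj (A m))"
      using k by (intro mat_sum_cong) (simp add: AK mult_smult_dim Ad)
    also have "\<dots> = K k"
    proof (rule eq_mat_dimI[of n d])
      fix i j assume ij: "i < n" "j < d"
      have "mat_sum n d e (\<lambda>m. (T $$ (k, m) * q m) \<cdot>\<^sub>m adj (A m)) $$ (i, j) =
          (\<Sum>m<e. \<Sum>l<e. T $$ (k, m) * cnj (T $$ (l, m)) * K l $$ (i, j))"
        using ij K q by (simp add: mat_sum_index Ad Aadj sum_distrib_left mult.assoc)
      also have "\<dots> = (\<Sum>l<e. (\<Sum>m<e. T $$ (k, m) * cnj (T $$ (l, m))) * K l $$ (i, j))"
        by (subst sum.swap) (simp add: sum_distrib_right)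
      also have "\<dots> = (\<Sum>l<e. if l = k then K l $$ (i, j) else 0)"
        using k by (intro sum.cong) (auto simp: TT')
      also have "\<dots> = K k $$ (i, j)" using k by simp
      finally show "mat_sum n d e (\<lambda>m. (T $$ (k, m) * q m) \<cdot>\<^sub>m adj (A m)) $$ (i, j) = K k $$ (i, j)" .
    qed (use K k in auto)
    finally show ?thesis .
  qed
  define Q where "Q = 1\<^sub>m n - P"
  have Qd: "dim_row Q = n" "dim_col Q = n" by (simp_all add: Q_def Pd)
  have Q_adj: "adj Q = Q" by (simp add: Q_def adj_diff Pd P_adj)
  have QQ: "Q * Q = Q"
    by (simp add: Q_def mult_diff_distrib_dim Pd PP) (use Pd in \<open>auto intro!: eq_matI\<close>)
  have QK: "Q * K k = 0\<^sub>m n d" if "k < e" for k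
    using that K by (simp add: Q_def mult_diff_distrib_dim Pd PK) (auto intro!: eq_matI)
  \<comment> \<open>Row \<open>i\<close> of \<open>Q\<close>, placed in the first row, which exists
    because \<open>d > 0\<close>. Everything orthogonal to the code is sent to one fixed basis
    vector, and the Gram products add up to \<open>adj Q * Q\<close>.\<close>
  define B where "B = (\<lambda>i. Matrix.mat d n (\<lambda>(a, b). if a = 0 then Q $$ (i, b) else 0))"
  have Bd: "dim_row (B i) = d" "dim_col (B i) = n" for i by (simp_all add: B_def)
  have BK: "B i * K k = 0\<^sub>m d d" if "i < n" "k < e" for i k
  proof (rule eq_mat_dimI[of d d])
    fix a b assume ab: "a < d" "b < d"
    have "(B i * K k) $$ (a, b) = (if a = 0 then (Q * K k) $$ (i, b) else 0)"
      using ab that K by (simp add: mult_mat_index Bd Qd) (simp add: B_def)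
    then show "(B i * K k) $$ (a, b) = 0\<^sub>m d d $$ (a, b)" using ab that by (simp add: QK)
  qed (use that K in \<open>simp_all add: Bd\<close>)
  have BB: "mat_sum n n n (\<lambda>i. adj (B i) * B i) = Q"
  proof -
    have "mat_sum n n n (\<lambda>i. adj (B i) * B i) = adj Q * Q" (is "?L = _")
    proof (rule eq_mat_dimI[of n n])
      fix a b assume ab: "a < n" "b < n"
      have "(adj (B i) * B i) $$ (a, b) = cnj (Q $$ (i, a)) * Q $$ (i, b)" for i
      proof -
        have "(adj (B i) * B i) $$ (a, b) = (\<Sum>c<d. if c = 0 then cnj (Q $$ (i, a)) * Q $$ (i, b) else 0)"
          using ab by (simp add: mult_mat_index Bd del: sum.delta sum.delta') (intro sum.cong; simp add: B_def)
        then show ?thesis using assms(3) by simp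
      qed
      then show "?L $$ (a, b) = (adj Q * Q) $$ (a, b)"
        using ab by (simp add: mat_sum_index mult_mat_index Qd)
    qed (simp_all add: Qd)
    then show ?thesis by (simp add: Q_adj QQ)
  qed
  define C where "C = (\<lambda>t. if t < e then A t else B (t - e))"
  define c where "c = (\<lambda>t k. if t < e then T $$ (k, t) * q t else 0)"
  have "mat_sum n n (e + n) (\<lambda>t. adj (C t) * C t) = P + Q"
  proof -
    have "mat_sum n n e (\<lambda>t. adj (C t) * C t) = P"
      unfolding P_def by (intro mat_sum_cong) (simp add: C_def)
    then show ?thesis
      by (simp add: mat_sum_append) (simp add: C_def BB)
  qed
  also have "P + Q = 1\<^sub>m n" using Pd by (auto simp: Q_def intro!: eq_matI)
  finally have 1: "mat_sum n n (e + n) (\<lambda>t. adj (C t) * C t) = 1\<^sub>m n" .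
  have 2: "C t * K k = c t k \<cdot>\<^sub>m 1\<^sub>m d" if "t < e + n" "k < e" for t k
  proof (cases "t < e")
    case True
    then show ?thesis using that by (simp add: C_def c_def AK)
  next
    case False
    then have "B (t - e) * K k = 0\<^sub>m d d" using that by (intro BK) auto
    with False show ?thesis by (auto simp: C_def c_def intro!: eq_matI)
  qed
  have "(\<Sum>t<e + n. \<Sum>k<e. (cmod (c t k))\<^sup>2) = (\<Sum>t<e. \<Sum>k<e. (cmod (c t k))\<^sup>2)"
    by (rule sum.mono_neutral_right) (auto simp: c_def)
  \<comment> \<open>The columns of the unitary \<open>T\<close> are normalized, so branch
    \<open>t\<close> contributes exactly its eigenvalue.\<close>
  also have "\<dots> = (\<Sum>t<e. \<mu> t)"
  proof (rule sum.cong, rule refl)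
    fix t assume "t \<in> {..<e}"
    then have t: "t < e" by simp
    have "complex_of_real (\<Sum>k<e. (cmod (T $$ (k, t)))\<^sup>2) = 1"
      using TT[OF t t] by (simp only: of_real_sum complex_norm_square mult.commute) simp
    then have "(\<Sum>k<e. (cmod (T $$ (k, t)))\<^sup>2) = 1" by (simp only: of_real_eq_1_iff)
    moreover have "(cmod (c t k))\<^sup>2 = (cmod (T $$ (k, t)))\<^sup>2 * \<mu> t" for k
      using t \<beta>(2)[OF t] by (simp add: c_def q_def norm_mult power_mult_distrib)
    ultimately show "(\<Sum>k<e. (cmod (c t k))\<^sup>2) = \<mu> t"
      by (simp flip: sum_distrib_right)
  qed
  finally have 3: "(\<Sum>t<e + n. \<Sum>k<e. (cmod (c t k))\<^sup>2) = 1" using \<beta>(3) by simp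
  have "dim_row (C t) = d" "dim_col (C t) = n" for t by (simp_all add: C_def Ad Bd)
  then show ?thesis using that 1 2 3 by blast
qed

section \<open>Purified states and entanglement fidelity\<close>

locale purified_state =
  fixes d :: nat and \<psi> :: "complex Matrix.vec" and \<rho> :: "complex mat"
  assumes density: "density_matrix d \<rho>" and pos: "strictly_pos d \<rho>" and purif: "purification d \<psi> \<rho>"
begin

abbreviation \<Psi> :: "complex mat" where
  "\<Psi> \<equiv> psi_mat d \<psi>"

definition state_R :: "complex mat" where
  "state_R = \<Psi> * adj \<Psi>"

lemma psi_dim: "dim_vec \<psi> = d * d"
  using purif by (simp add: purification_def)

lemma state_R_dim [simp]: "dim_row state_R = d" "dim_col state_R = d"
  by (simp_all add: state_R_def)

lemma rho_dim: "dim_row \<rho> = d" "dim_col \<rho> = d"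
  using pos hermitianD by (auto simp: strictly_pos_def)

lemma trace_rho: "mat_trace \<rho> = 1"
  using density by (simp add: density_matrix_def)

lemma d_pos: "d > 0"
  using trace_rho rho_dim by (cases d) (auto simp: mat_trace_def)

lemma gram: "adj \<Psi> * \<Psi> = transpose_mat \<rho>" (is "?L = _")
proof (rule eq_mat_dimI[of d d])
  fix i j assume ij: "i < d" "j < d"
  have "\<rho> $$ (j, i) = ptrace1 d d (ket_bra \<psi>) $$ (j, i)"
    using purif by (simp add: purification_def)
  then show "?L $$ (i, j) = transpose_mat \<rho> $$ (i, j)"
    using ij psi_dim by (simp add: rho_dim ptrace1_def ket_bra_def mult_mat_index psi_mat_def mult.commute)
qed (simp_all add: rho_dim)

lemma trace_state_R: "mat_trace state_R = 1"
proof -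
  have "mat_trace state_R = mat_trace (adj \<Psi> * \<Psi>)"
    unfolding state_R_def by (rule mat_trace_mult_commute) simp_all
  then show ?thesis using trace_rho by (simp add: gram mat_trace_def rho_dim)
qed

text \<open>Strict positivity of \<rho> makes the Gram matrix of \<Psi> invertible. With \<Psi>
  cancellable, identities between reduced states become identities between operators.\<close>

lemma psi_left_inverse: "\<exists>L. dim_row L = d \<and> dim_col L = d \<and> L * \<Psi> = 1\<^sub>m d"
proof -
  have h: "hermitian d \<rho>" using pos by (simp add: strictly_pos_def)
  note fd = hermitianD(1,2)[OF mat_fun_hermitian[OF h, of inverse]]
  have "transpose_mat (mat_fun inverse \<rho>) * transpose_mat \<rho> = 1\<^sub>m d"
    by (simp add: transpose_mult_dim[symmetric] fd rho_dim mat_fun_inverse[OF pos])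
  then have "transpose_mat (mat_fun inverse \<rho>) * adj \<Psi> * \<Psi> = 1\<^sub>m d"
    by (simp add: mult_mat_assoc fd gram)
  then show ?thesis
    by (intro exI[of _ "transpose_mat (mat_fun inverse \<rho>) * adj \<Psi>"]) (simp add: fd)
qed

lemma psi_cancel:
  assumes "dim_row X = d" "dim_row Y = d" "\<Psi> * X = \<Psi> * Y"
  shows "X = Y"
proof -
  obtain L where L: "dim_row L = d" "dim_col L = d" "L * \<Psi> = 1\<^sub>m d" using psi_left_inverse by blast
  have "L * (\<Psi> * X) = L * (\<Psi> * Y)" using assms(3) by simp
  then show ?thesis using assms(1,2) L by (simp add: mult_mat_assoc[symmetric])
qed

lemma psi_cancel_conj:
  assumes "dim_row X = d" "dim_col X = d" "dim_row Y = d" "dim_col Y = d"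
    and "\<Psi> * X * adj \<Psi> = \<Psi> * Y * adj \<Psi>"
  shows "X = Y"
proof -
  have "X * adj \<Psi> = Y * adj \<Psi>"
    by (rule psi_cancel) (use assms in \<open>simp_all add: mult_mat_assoc\<close>)
  then have "adj (X * adj \<Psi>) = adj (Y * adj \<Psi>)" by simp
  then have "\<Psi> * adj X = \<Psi> * adj Y"
    using assms by (simp add: adj_mult)
  then have "adj X = adj Y" by (rule psi_cancel[rotated 2]) (simp_all add: assms)
  then show ?thesis by (metis adj_adjoint)
qed

text \<open>A singular value decomposition of \<Psi>: its two Gram matrices have the same
  eigenvalues, and transposition does not change those of \<rho>.\<close>

lemma state_R_spectral:
  obtains U W p where "spectral_decomposition d \<rho> U p" "spectral_decomposition d state_R W p"
    "\<And>i. i < d \<Longrightarrow> p i > 0"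
proof -
  obtain U p where U: "spectral_decomposition d \<rho> U p" "\<And>i. i < d \<Longrightarrow> p i > 0"
    using strictly_pos_spectral_obtains[OF pos] by metis
  note S = spectral_decompositionD[OF U(1)]
  define g where "g = real_diag d (\<lambda>i. 1 / sqrt (p i))"
  define D where "D = real_diag d p"
  define V where "V = transpose_mat (adj U)"
  have gd: "dim_row g = d" "dim_col g = d" "adj g = g" and Dd: "dim_row D = d" "dim_col D = d"
    and Vd: "dim_row V = d" "dim_col V = d" by (simp_all add: g_def D_def V_def S(2,3))
  have "g * D * g = real_diag d (\<lambda>i. 1 / sqrt (p i) * p i * (1 / sqrt (p i)))"
    unfolding g_def D_def mat_diag_diag by (simp only: of_real_mult)
  also have "\<dots> = mat_diag d (\<lambda>i. 1)" (is "_ = ?R")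
  proof (rule eq_mat_dimI[of d d])
    fix i j assume ij: "i < d" "j < d"
    have "1 / sqrt (p j) * p j * (1 / sqrt (p j)) = 1"
      using U(2)[OF ij(2)] by (simp add: field_simps)
    then show "real_diag d (\<lambda>i. 1 / sqrt (p i) * p i * (1 / sqrt (p i))) $$ (i, j) =
        ?R $$ (i, j)"
      using ij by (simp only: mat_diag_index of_real_1)
  qed simp_all
  finally have gDg: "g * (D * g) = 1\<^sub>m d" by (simp add: mult_mat_assoc gd Dd)
  have gDg': "g * (D * (g * X)) = X" if "dim_row X = d" for X
    using that gDg by (simp add: mult_mat_assoc[symmetric] gd Dd)
  have VV: "adj V * V = 1\<^sub>m d"
    unfolding V_def using S(2,3,6) by (simp add: adj_transpose transpose_mult_dim[symmetric])
  have VV': "V * adj V = 1\<^sub>m d"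
    by (rule left_inverse_imp_right_inverse[OF VV]) (simp_all add: carrier_matI Vd)
  have "transpose_mat \<rho> = V * D * adj V"
    unfolding S(8) V_def D_def by (simp add: transpose_mult_dim mult_mat_assoc S(2,3) adj_transpose)
  then have gram': "adj \<Psi> * \<Psi> = V * D * adj V" by (simp add: gram)
  \<comment> \<open>The left singular vectors: images of the right ones, the columns of
    \<open>V\<close>, divided by the singular values \<open>sqrt (p i)\<close>.\<close>
  define W where "W = \<Psi> * V * g"
  have Wd: "dim_row W = d" "dim_col W = d" by (simp_all add: W_def gd)
  have "adj W * W = g * (adj V * (adj \<Psi> * \<Psi>) * V) * g"
    by (simp add: W_def adj_mult mult_mat_assoc gd Vd)
  also have "\<dots> = g * ((adj V * V) * D * (adj V * V)) * g"
    unfolding gram' by (simp add: mult_mat_assoc gd Vd Dd)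
  also have "\<dots> = 1\<^sub>m d" by (simp add: VV Dd gd mult_mat_assoc gDg)
  finally have WW: "adj W * W = 1\<^sub>m d" .
  have "W * D * adj W = \<Psi> * (V * (g * (D * (g * (adj V * adj \<Psi>)))))"
    by (simp add: W_def adj_mult mult_mat_assoc gd Vd Dd)
  also have "\<dots> = \<Psi> * ((V * adj V) * adj \<Psi>)"
    by (simp add: gDg' Vd mult_mat_assoc)
  also have "\<dots> = state_R" by (simp add: VV' state_R_def)
  finally have "spectral_decomposition d state_R W p"
    unfolding spectral_decomposition_def by (intro conjI carrier_matI) (simp_all add: D_def WW Wd)
  then show ?thesis using that U by blast
qed

lemma strictly_pos_state_R: "strictly_pos d state_R"
  by (rule state_R_spectral) (rule strictly_posI)

text \<open>Relative to the identity, the entropy depends on the spectrum alone.\<close>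

lemma f_entropy_state_R: "f_entropy f \<rho> = - f_rel_entropy f state_R (1\<^sub>m d)"
proof -
  obtain U W p where U: "spectral_decomposition d \<rho> U p" "spectral_decomposition d state_R W p"
    using state_R_spectral by metis
  show ?thesis
    using f_rel_entropy_common_basis[OF U(1) spectral_decomposition_one[OF U(1)] pos]
      f_rel_entropy_common_basis[OF U(2) spectral_decomposition_one[OF U(2)] strictly_pos_state_R]
    by (simp add: f_entropy_def rho_dim)
qed

lemma admissible_state_R:
  assumes "admissible I d \<rho> (1\<^sub>m d)"
  shows "admissible I d state_R (1\<^sub>m d)"
proof -
  obtain U W p where U: "spectral_decomposition d \<rho> U p" "spectral_decomposition d state_R W p"
    using state_R_spectral by metis
  have "eigenvalue state_R z \<longleftrightarrow> eigenvalue \<rho> z" for z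
    by (simp add: eigenvalue_spectral_decomposition[OF U(1)] eigenvalue_spectral_decomposition[OF U(2)])
  then show ?thesis using assms strictly_pos_state_R by (simp add: admissible_def)
qed

text \<open>Schumacher's formula, the sum of the squared moduli of the traces of
  \<open>\<rho> * M t\<close>; each trace is written as the overlap of a transformed purification
  with the original one.\<close>

lemma entanglement_fidelity_kraus:
  assumes M: "\<And>t. t < L \<Longrightarrow> dim_row (M t) = d" "\<And>t. t < L \<Longrightarrow> dim_col (M t) = d"
    and E: "\<And>X. X \<in> carrier_mat d d \<Longrightarrow> E X = kraus_map d L M X"
  shows "entanglement_fidelity d \<psi> E = (\<Sum>t<L. (cmod (mat_trace (\<Psi> * transpose_mat (M t) * adj \<Psi>)))\<^sup>2)"
proof -
  have summand: "(kron (1\<^sub>m d) (M t) * ket_bra \<psi> * adj (kron (1\<^sub>m d) (M t)) *\<^sub>v \<psi>) \<bullet>c \<psi> =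
      complex_of_real ((cmod (mat_trace (\<Psi> * transpose_mat (M t) * adj \<Psi>)))\<^sup>2)" if t: "t < L" for t
  proof -
    define G where "G = kron (1\<^sub>m d) (M t)"
    have Gd: "dim_row G = d * d" "dim_col G = d * d" by (simp_all add: G_def M[OF t])
    have "G *\<^sub>v \<psi> = vec_rows (\<Psi> * transpose_mat (M t))"
      using kron_mult_vec_rows[of "1\<^sub>m d" \<Psi> "M t"] M[OF t] by (simp add: G_def vec_rows_psi_mat psi_dim)
    then have "(G *\<^sub>v \<psi>) \<bullet>c \<psi> = vec_rows (\<Psi> * transpose_mat (M t)) \<bullet>c vec_rows \<Psi>"
      by (simp add: vec_rows_psi_mat psi_dim)
    then have G\<psi>: "(G *\<^sub>v \<psi>) \<bullet>c \<psi> = mat_trace (\<Psi> * transpose_mat (M t) * adj \<Psi>)"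
      using M[OF t] by (simp add: cscalar_prod_vec_rows)
    have "(adj G *\<^sub>v \<psi>) \<bullet>c \<psi> = \<psi> \<bullet>c (G *\<^sub>v \<psi>)"
      by (subst cscalar_prod_adjoint) (simp_all add: Gd psi_dim)
    also have "\<dots> = cnj ((G *\<^sub>v \<psi>) \<bullet>c \<psi>)"
      by (rule cscalar_prod_commute) (simp add: Gd psi_dim)
    finally have G\<psi>': "(adj G *\<^sub>v \<psi>) \<bullet>c \<psi> = cnj ((G *\<^sub>v \<psi>) \<bullet>c \<psi>)" .
    have "(G * ket_bra \<psi> * adj G *\<^sub>v \<psi>) \<bullet>c \<psi> = ((adj G *\<^sub>v \<psi>) \<bullet>c \<psi>) * ((G *\<^sub>v \<psi>) \<bullet>c \<psi>)"
      by (simp add: mult_mat_vec_assoc Gd psi_dim ket_bra_mult_vec mult_mat_vec_smult)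
    then show ?thesis
      unfolding G_def[symmetric] G\<psi>' G\<psi> by (simp only: complex_norm_square mult.commute)
  qed
  have "ampliation d d d E (ket_bra \<psi>) = kraus_map (d * d) L (\<lambda>t. kron (1\<^sub>m d) (M t)) (ket_bra \<psi>)"
    by (rule ampliation_kraus_map[OF M _ _ E]) (simp_all add: psi_dim)
  then have "(ampliation d d d E (ket_bra \<psi>) *\<^sub>v \<psi>) \<bullet>c \<psi> =
      (\<Sum>t<L. (kron (1\<^sub>m d) (M t) * ket_bra \<psi> * adj (kron (1\<^sub>m d) (M t)) *\<^sub>v \<psi>) \<bullet>c \<psi>)"
    unfolding kraus_map_def by (simp add: mat_sum_form M psi_dim)
  then show ?thesis
    by (simp add: entanglement_fidelity_def summand)
qed

text \<open>The equality case of the Cauchy-Schwarz inequality for the inner products of \<open>\<Psi> M\<^sup>T\<close> with \<open>\<Psi>\<close>.\<close>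

lemma fidelity_one_imp_scalar:
  assumes M: "\<And>t. t < L \<Longrightarrow> dim_row (M t) = d" "\<And>t. t < L \<Longrightarrow> dim_col (M t) = d"
    and one: "mat_sum d d L (\<lambda>t. adj (M t) * M t) = 1\<^sub>m d"
    and F: "(\<Sum>t<L. (cmod (mat_trace (\<Psi> * transpose_mat (M t) * adj \<Psi>)))\<^sup>2) = 1"
    and t: "t < L"
  shows "M t = mat_trace (\<Psi> * transpose_mat (M t) * adj \<Psi>) \<cdot>\<^sub>m 1\<^sub>m d"
proof -
  define c where "c = (\<lambda>t. mat_trace (\<Psi> * transpose_mat (M t) * adj \<Psi>))"
  define x where "x = (\<lambda>t. vec_rows (\<Psi> * transpose_mat (M t)))"
  define y where "y = vec_rows \<Psi>"
  have xd: "dim_vec (x t) = d * d" if "t < L" for t by (simp add: x_def M that)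
  have yd: "dim_vec y = d * d" by (simp add: y_def)
  have yy: "y \<bullet>c y = 1" by (simp add: y_def cscalar_prod_vec_rows state_R_def[symmetric] trace_state_R)
  have xy: "x t \<bullet>c y = c t" if "t < L" for t
    by (simp add: x_def y_def cscalar_prod_vec_rows M that c_def)
  have yx: "y \<bullet>c x t = cnj (c t)" if "t < L" for t
    using cscalar_prod_commute[of "x t" y] xy xd yd that by simp
  \<comment> \<open>The part of \<open>x t\<close> orthogonal to the unit vector
    \<open>y\<close>.\<close>
  define z where "z = (\<lambda>t. x t - c t \<cdot>\<^sub>v y)"
  have zd: "dim_vec (z t) = d * d" for t by (simp add: z_def yd)
  have ysm: "w \<bullet>c (a \<cdot>\<^sub>v y) = cnj a * (w \<bullet>c y)" if "dim_vec w = d * d" for w a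
    using that yd by (simp add: cscalar_prod_sum sum_distrib_left ac_simps)
  have zz: "z t \<bullet>c z t = x t \<bullet>c x t - c t * cnj (c t)" if "t < L" for t
    using that by (simp add: z_def cscalar_prod_diff ysm xd yd xy yx yy)
  \<comment> \<open>By completeness the square norms of all \<open>x t\<close> add up to the trace
    of \<rho>, which is one. The components along \<open>y\<close> already exhaust this total by
    \<open>F\<close>, so nothing is left for the \<open>z t\<close>.\<close>
  have "(\<Sum>t<L. x t \<bullet>c x t) = (\<Sum>t<L. mat_trace (adj (M t) * M t * transpose_mat (adj \<Psi> * \<Psi>)))"
  proof (rule sum.cong, rule refl)
    fix t assume "t \<in> {..<L}"
    then have t: "dim_row (M t) = d" "dim_col (M t) = d" using M by auto
    have "x t \<bullet>c x t = mat_trace (\<Psi> * (transpose_mat (adj (M t) * M t) * adj \<Psi>))"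
      using t by (simp add: x_def cscalar_prod_vec_rows adj_mult adj_transpose transpose_mult_dim mult_mat_assoc)
    also have "\<dots> = mat_trace (transpose_mat (adj (M t) * M t) * (adj \<Psi> * \<Psi>))"
      using t by (subst mat_trace_mult_commute) (simp_all add: mult_mat_assoc)
    also have "\<dots> = mat_trace ((adj \<Psi> * \<Psi>) * transpose_mat (adj (M t) * M t))"
      using t by (subst mat_trace_mult_commute) simp_all
    also have "\<dots> = mat_trace (adj (M t) * M t * transpose_mat (adj \<Psi> * \<Psi>))"
      using t by (intro mat_trace_mult_transpose) simp_all
    finally show "x t \<bullet>c x t = mat_trace (adj (M t) * M t * transpose_mat (adj \<Psi> * \<Psi>))" .
  qed
  also have "\<dots> = mat_trace (mat_sum d d L (\<lambda>t. adj (M t) * M t) * \<rho>)"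
    using M by (simp add: gram mat_sum_mult_right rho_dim mat_trace_mat_sum) (simp add: mat_trace_def rho_dim)
  also have "\<dots> = 1" by (simp add: one rho_dim trace_rho)
  finally have xx: "(\<Sum>t<L. x t \<bullet>c x t) = 1" .
  have F': "(\<Sum>t<L. c t * cnj (c t)) = 1"
    using arg_cong[OF F, of complex_of_real] unfolding c_def
    by (simp only: of_real_sum complex_norm_square of_real_1)
  have "(\<Sum>t<L. z t \<bullet>c z t) = 0"
    using xx F' by (simp add: zz sum_subtractf)
  then have "complex_of_real (\<Sum>t<L. \<Sum>k<d * d. (cmod (vec_index (z t) k))\<^sup>2) = 0"
    by (simp add: cscalar_prod_self zd)
  then have "(\<Sum>t<L. \<Sum>k<d * d. (cmod (vec_index (z t) k))\<^sup>2) = 0" by (simp only: of_real_eq_0_iff)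
  then have "(\<Sum>k<d * d. (cmod (vec_index (z t) k))\<^sup>2) = 0"
    using t by (subst (asm) sum_nonneg_eq_0_iff) (auto intro: sum_nonneg)
  then have z0: "vec_index (z t) k = 0" if "k < d * d" for k
    using that by (subst (asm) sum_nonneg_eq_0_iff) auto
  have "x t = vec_rows (\<Psi> * (c t \<cdot>\<^sub>m 1\<^sub>m d))"
  proof (rule eq_vecI)
    fix k assume "k < dim_vec (vec_rows (\<Psi> * (c t \<cdot>\<^sub>m 1\<^sub>m d)))"
    then have k: "k < d * d" by simp
    have "vec_index (x t) k = c t * vec_index y k"
      using z0[OF k] k yd xd[OF t] by (simp add: z_def)
    then show "vec_index (x t) k = vec_index (vec_rows (\<Psi> * (c t \<cdot>\<^sub>m 1\<^sub>m d))) k"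
      using k div_mod_less[OF k] by (simp add: mult_smult_dim vec_rows_index y_def)
  qed (simp add: xd t)
  then have "\<Psi> * transpose_mat (M t) = \<Psi> * (c t \<cdot>\<^sub>m 1\<^sub>m d)"
    unfolding x_def by (rule vec_rows_inject) (simp_all add: M t)
  then have "transpose_mat (M t) = c t \<cdot>\<^sub>m 1\<^sub>m d"
    by (rule psi_cancel[rotated 2]) (simp_all add: M t)
  then have "transpose_mat (transpose_mat (M t)) = transpose_mat (c t \<cdot>\<^sub>m 1\<^sub>m d)" by simp
  also have "transpose_mat (c t \<cdot>\<^sub>m 1\<^sub>m d) = c t \<cdot>\<^sub>m 1\<^sub>m d" by (intro eq_matI) auto
  finally show ?thesis by (simp add: c_def)
qed

end

section \<open>A channel acting on half of a purification\<close>

locale purified_channel = purified_state +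
  fixes n e :: nat and V :: "complex mat"
  assumes V_dim [simp]: "dim_row V = n * e" "dim_col V = d" and V_isometry: "adj V * V = 1\<^sub>m d"
begin

sublocale RE: index_splitting "d * e" d e "\<lambda>a. a mod e" "\<lambda>a. a div e" "\<lambda>k i. i * e + k"
  by (rule index_splitting_second)

abbreviation "\<rho>_RE \<equiv> state_RE d n e \<psi> V"
abbreviation "\<rho>_E \<equiv> state_E d n e \<psi> V"
abbreviation "K \<equiv> kraus_of n e V"

lemmas RE_index = state_RE_index[OF psi_dim V_dim]

text \<open>The isometry does not touch the reference; in terms of Kraus operators this is the
  completeness relation.\<close>

lemma reduce_RE: "RE.reduce \<rho>_RE = state_R"
proof (rule eq_mat_dimI[of d d])
  fix r r' assume r: "r < d" "r' < d"
  have "RE.reduce \<rho>_RE $$ (r, r') = (\<Sum>k<e. (\<Psi> * transpose_mat (adj (K k) * K k) * adj \<Psi>) $$ (r, r'))"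
    using r by (simp add: RE.reduce_index RE_index)
  also have "\<dots> = mat_sum d d e (\<lambda>k. \<Psi> * transpose_mat (adj (K k) * K k) * adj \<Psi>) $$ (r, r')"
    using r by (simp add: mat_sum_index)
  also have "mat_sum d d e (\<lambda>k. \<Psi> * transpose_mat (adj (K k) * K k) * adj \<Psi>) =
      \<Psi> * mat_sum d d e (\<lambda>k. transpose_mat (adj (K k) * K k)) * adj \<Psi>"
    by (simp add: mat_sum_mult_left mat_sum_mult_right)
  also have "mat_sum d d e (\<lambda>k. transpose_mat (adj (K k) * K k)) = transpose_mat (1\<^sub>m d)"
    unfolding kraus_of_complete[OF V_dim V_isometry, symmetric] by (subst mat_sum_transpose) simp_all
  finally show "RE.reduce \<rho>_RE $$ (r, r') = state_R $$ (r, r')"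
    by (simp add: state_R_def)
qed auto

lemma trace_E: "mat_trace \<rho>_E = 1"
proof -
  have "mat_trace \<rho>_E = (\<Sum>k<e. \<Sum>r<d. \<rho>_RE $$ (r * e + k, r * e + k))"
    by (simp add: mat_trace_def state_E_index)
  also have "\<dots> = (\<Sum>r<d. \<Sum>k<e. \<rho>_RE $$ (r * e + k, r * e + k))" by (rule sum.swap)
  also have "\<dots> = mat_trace (RE.reduce \<rho>_RE)"
    by (simp add: mat_trace_def RE.reduce_index)
  finally show ?thesis by (simp add: reduce_RE trace_state_R)
qed

text \<open>The trace of the environment state appears as a factor and equals one, so the second
  argument reduces to the one in the f-entropy.\<close>

lemma reduce_one_E: "RE.reduce (kron (1\<^sub>m d) \<rho>_E) = 1\<^sub>m d"
proof (rule eq_mat_dimI[of d d])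
  fix r r' assume r: "r < d" "r' < d"
  have "RE.reduce (kron (1\<^sub>m d) \<rho>_E) $$ (r, r') = (\<Sum>k<e. 1\<^sub>m d $$ (r, r') * \<rho>_E $$ (k, k))"
    using r by (simp add: RE.reduce_index kron_index)
  also have "\<dots> = 1\<^sub>m d $$ (r, r') * mat_trace \<rho>_E"
    by (simp add: mat_trace_def sum_distrib_left)
  finally show "RE.reduce (kron (1\<^sub>m d) \<rho>_E) $$ (r, r') = 1\<^sub>m d $$ (r, r')"
    by (simp add: trace_E)
qed auto

theorem coherent_info_le_entropy:
  assumes "operator_convex_on I f" "coherent_admissible I d n e \<psi> V"
  shows "f_coherent_info f d n e \<psi> V \<le> f_entropy f \<rho>"
  using RE.data_processing[OF assms(1) assms(2)[unfolded coherent_admissible_def]] strictly_pos_state_R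
  by (simp add: reduce_RE reduce_one_E f_entropy_state_R f_coherent_info_def)

text \<open>Blockwise comparison of the joint state with the product, followed by cancellation of
  \<Psi> on both sides. The coefficients turn out to be the entries of the environment
  state.\<close>

lemma decoupled_imp_knill_laflamme:
  assumes "\<rho>_RE = kron state_R \<rho>_E" "k < e" "l < e"
  shows "adj (K l) * K k = \<rho>_E $$ (k, l) \<cdot>\<^sub>m 1\<^sub>m d"
proof -
  have "\<Psi> * transpose_mat (adj (K l) * K k) * adj \<Psi> = \<Psi> * (\<rho>_E $$ (k, l) \<cdot>\<^sub>m 1\<^sub>m d) * adj \<Psi>" (is "?L = ?R")
  proof (rule eq_mat_dimI[of d d])
    fix r r' assume r: "r < d" "r' < d"
    have i: "r * e + k < d * e" "r' * e + l < d * e" using r assms(2,3) by simp_all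
    have "?L $$ (r, r') = kron state_R \<rho>_E $$ (r * e + k, r' * e + l)"
      unfolding assms(1)[symmetric] using RE_index[OF i] assms(2,3) by simp
    also have "\<dots> = state_R $$ (r, r') * \<rho>_E $$ (k, l)"
      using i assms(2,3) by (simp add: kron_index)
    finally show "?L $$ (r, r') =
        ?R $$ (r, r')"
      using r by (simp add: mult_smult_dim state_R_def[symmetric])
  qed auto
  then have "transpose_mat (adj (K l) * K k) = \<rho>_E $$ (k, l) \<cdot>\<^sub>m 1\<^sub>m d"
    by (rule psi_cancel_conj[rotated 4]) simp_all
  then have "transpose_mat (transpose_mat (adj (K l) * K k)) = transpose_mat (\<rho>_E $$ (k, l) \<cdot>\<^sub>m 1\<^sub>m d)" by simp
  also have "transpose_mat (\<rho>_E $$ (k, l) \<cdot>\<^sub>m 1\<^sub>m d) = \<rho>_E $$ (k, l) \<cdot>\<^sub>m 1\<^sub>m d" by (intro eq_matI) auto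
  finally show ?thesis by simp
qed

text \<open>The coefficients are arbitrary at first; tracing out the reference identifies them with
  the environment state.\<close>

lemma knill_laflamme_imp_decoupled:
  assumes KL: "\<And>k l. k < e \<Longrightarrow> l < e \<Longrightarrow> adj (K l) * K k = \<beta> k l \<cdot>\<^sub>m 1\<^sub>m d"
  shows "\<rho>_RE = kron state_R \<rho>_E"
proof -
  have RE: "\<rho>_RE $$ (i, j) = \<beta> (i mod e) (j mod e) * state_R $$ (i div e, j div e)" if ij: "i < d * e" "j < d * e" for i j
  proof -
    note dm = div_mod_less[OF ij(1)] div_mod_less[OF ij(2)]
    have "transpose_mat (\<beta> (i mod e) (j mod e) \<cdot>\<^sub>m 1\<^sub>m d) = \<beta> (i mod e) (j mod e) \<cdot>\<^sub>m 1\<^sub>m d" by (intro eq_matI) auto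
    then show ?thesis
      using RE_index[OF ij] dm by (simp add: KL mult_smult_dim state_R_def[symmetric])
  qed
  have E: "\<rho>_E $$ (k, l) = \<beta> k l" if "k < e" "l < e" for k l
  proof -
    have "\<rho>_E $$ (k, l) = (\<Sum>r<d. \<beta> k l * state_R $$ (r, r))"
      using that by (simp add: state_E_index RE)
    also have "\<dots> = \<beta> k l * mat_trace state_R"
      by (simp add: mat_trace_def sum_distrib_left)
    finally show ?thesis by (simp add: trace_state_R)
  qed
  show ?thesis
    by (rule eq_matI) (auto simp: RE E kron_index div_mod_less)
qed

text \<open>Positivity is assumed for \<open>kron (1\<^sub>m d) \<rho>_E\<close>. Since
  \<open>d > 0\<close>, its first diagonal block hands symmetry and positivity on to the environment
  state.\<close>

lemma E_spectral:
  assumes "coherent_admissible I d n e \<psi> V"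
  obtains T \<mu> where "spectral_decomposition e \<rho>_E T \<mu>" "\<And>i. i < e \<Longrightarrow> \<mu> i > 0" "(\<Sum>i<e. \<mu> i) = 1"
proof -
  have pos1: "strictly_pos (d * e) (kron (1\<^sub>m d) \<rho>_E)"
    using assms by (simp add: coherent_admissible_def admissible_def)
  obtain U W p where U: "spectral_decomposition d state_R W p" using state_R_spectral by metis
  have adj: "adj \<rho>_E = \<rho>_E"
  proof (rule eq_mat_dimI[of e e])
    fix k l assume kl: "k < e" "l < e"
    have "adj (kron (1\<^sub>m d) \<rho>_E) = kron (1\<^sub>m d) \<rho>_E"
      using pos1 hermitianD(3) by (auto simp: strictly_pos_def)
    from arg_cong[OF this, of "\<lambda>M. M $$ (k, l)"] show "adj \<rho>_E $$ (k, l) = \<rho>_E $$ (k, l)"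
      using kl d_pos index_less[of 0 d k e] index_less[of 0 d l e] by (simp add: kron_adjoint kron_index)
  qed auto
  have "hermitian e \<rho>_E" unfolding hermitian_def by (intro conjI carrier_matI) (simp_all add: adj)
  then obtain T \<mu> where T: "spectral_decomposition e \<rho>_E T \<mu>" using spectral_theorem by blast
  have "\<mu> i > 0" if "i < e" for i
    using strictly_pos_spectral[OF kron_spectral[OF spectral_decomposition_one[OF U] T] pos1, of i]
      that d_pos index_less[of 0 d i e] by simp
  moreover have "(\<Sum>i<e. \<mu> i) = 1"
  proof -
    note S = spectral_decompositionD[OF T]
    have "mat_trace \<rho>_E = mat_trace (adj T * (T * real_diag e (\<lambda>i. \<mu> i)))"
      unfolding S(8) by (rule mat_trace_mult_commute) (simp_all add: S(2,3))
    also have "adj T * (T * real_diag e (\<lambda>i. \<mu> i)) = real_diag e (\<lambda>i. \<mu> i)"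
      by (simp add: mult_mat_assoc[symmetric] S(2,3,6))
    finally have "mat_trace (real_diag e (\<lambda>i. \<mu> i)) = 1" by (simp only: trace_E)
    then have "complex_of_real (\<Sum>i<e. \<mu> i) = 1" by (simp add: mat_trace_def)
    then show ?thesis by (simp only: of_real_eq_1_iff)
  qed
  ultimately show ?thesis using that T by blast
qed

text \<open>The equality case with reduced pair \<open>state_R\<close> and identity: the lift of the
  inverse of \<open>state_R\<close> is its Kronecker product with the identity, and multiplying by
  \<open>kron state_R (1\<^sub>m e)\<close> solves for the joint state.\<close>

lemma entropy_eq_imp_decoupled:
  assumes "diffused_on I f" "admissible I d \<rho> (1\<^sub>m d)" "coherent_admissible I d n e \<psi> V"
    and eq: "f_entropy f \<rho> = f_coherent_info f d n e \<psi> V"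
  shows "\<rho>_RE = kron state_R \<rho>_E"
proof -
  have h: "hermitian d state_R" using strictly_pos_state_R by (simp add: strictly_pos_def)
  note inv = hermitianD(1,2)[OF mat_fun_hermitian[OF h, of inverse]]
  have "kron (1\<^sub>m d) \<rho>_E = mat_sum (d * e) (d * e) e
      (\<lambda>k. RE.embed k * (1\<^sub>m d * mat_fun inverse state_R) * adj (RE.embed k)) * \<rho>_RE"
    using RE.data_processing_equality[OF assms(1) assms(3)[unfolded coherent_admissible_def]]
      admissible_state_R[OF assms(2)] eq
    by (simp add: reduce_RE reduce_one_E f_entropy_state_R f_coherent_info_def)
  also have "mat_sum (d * e) (d * e) e (\<lambda>k. RE.embed k * (1\<^sub>m d * mat_fun inverse state_R) * adj (RE.embed k)) =
      kron (mat_fun inverse state_R) (1\<^sub>m e)"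
    by (rule eq_matI)
      (auto simp: RE.sum_embed_conj_index[where X = "mat_fun inverse state_R"] inv kron_index div_mod_less)
  finally have "kron state_R (1\<^sub>m e) * kron (1\<^sub>m d) \<rho>_E = kron state_R (1\<^sub>m e) * (kron (mat_fun inverse state_R) (1\<^sub>m e) * \<rho>_RE)"
    by simp
  also have "\<dots> = kron (state_R * mat_fun inverse state_R) (1\<^sub>m e) * \<rho>_RE"
    by (simp add: mult_mat_assoc[symmetric] kron_mult inv)
  also have "state_R * mat_fun inverse state_R = 1\<^sub>m d"
    by (rule mat_fun_inverse[OF strictly_pos_state_R])
  finally show ?thesis by (simp add: kron_mult kron_one)
qed

text \<open>For a product state the environment eigenvalue cancels in each ratio, and the remaining
  weights of the environment sum to one.\<close>

lemma decoupled_imp_entropy_eq: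
  assumes "coherent_admissible I d n e \<psi> V" "\<rho>_RE = kron state_R \<rho>_E"
  shows "f_entropy f \<rho> = f_coherent_info f d n e \<psi> V"
proof -
  obtain U W p where U: "spectral_decomposition d state_R W p" "\<And>i. i < d \<Longrightarrow> p i > 0" using state_R_spectral by metis
  obtain T \<mu> where T: "spectral_decomposition e \<rho>_E T \<mu>" "\<And>i. i < e \<Longrightarrow> \<mu> i > 0" "(\<Sum>i<e. \<mu> i) = 1"
    using E_spectral[OF assms(1)] by metis
  note one = spectral_decomposition_one[OF U(1)]
  have pos: "strictly_pos (d * e) (kron state_R \<rho>_E)"
    using assms by (simp add: coherent_admissible_def admissible_def)
  have "f_rel_entropy f \<rho>_RE (kron (1\<^sub>m d) \<rho>_E) =
      (\<Sum>i<d * e. p (i div e) * \<mu> (i mod e) * f (1 * \<mu> (i mod e) / (p (i div e) * \<mu> (i mod e))))"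
    unfolding assms(2)
    by (rule f_rel_entropy_common_basis[OF kron_spectral[OF U(1) T(1)] kron_spectral[OF one T(1)] pos])
  also have "\<dots> = (\<Sum>r<d. \<Sum>k<e. p r * \<mu> k * f (1 * \<mu> k / (p r * \<mu> k)))"
    by (rule sum_div_mod)
  also have "\<dots> = (\<Sum>r<d. \<Sum>k<e. \<mu> k * (p r * f (1 / p r)))"
    using T(2) by (intro sum.cong) (auto simp: less_imp_neq[symmetric])
  also have "\<dots> = (\<Sum>r<d. p r * f (1 / p r))"
    by (simp add: sum_distrib_right[symmetric] T(3))
  also have "\<dots> = f_rel_entropy f state_R (1\<^sub>m d)"
    by (rule f_rel_entropy_common_basis[OF U(1) one strictly_pos_state_R, symmetric])
  finally show ?thesis by (simp add: f_entropy_state_R f_coherent_info_def)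
qed

lemma K_complete: "mat_sum d d e (\<lambda>k. adj (K k) * K k) = 1\<^sub>m d"
  by (rule kraus_of_complete[OF V_dim V_isometry])

text \<open>After recovery every Kraus operator of the composite is a scalar \<open>c t k\<close>,
  and the fidelity is the sum of the squared moduli of these scalars.\<close>

lemma decoupled_imp_recovery:
  assumes "coherent_admissible I d n e \<psi> V" "\<rho>_RE = kron state_R \<rho>_E" "realizes d n e V E1"
  shows "\<exists>E2. cptp n d E2 \<and> entanglement_fidelity d \<psi> (E2 \<circ> E1) = 1"
proof -
  obtain T \<mu> where T: "spectral_decomposition e \<rho>_E T \<mu>" "\<And>i. i < e \<Longrightarrow> \<mu> i > 0" "(\<Sum>i<e. \<mu> i) = 1"
    using E_spectral[OF assms(1)] by metis
  have Kd: "dim_row (K k) = n" "dim_col (K k) = d" for k by simp_all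
  obtain C c where C: "\<And>t. t < e + n \<Longrightarrow> dim_row (C t) = d" "\<And>t. t < e + n \<Longrightarrow> dim_col (C t) = n"
    "mat_sum n n (e + n) (\<lambda>t. adj (C t) * C t) = 1\<^sub>m n"
    and c: "\<And>t k. t < e + n \<Longrightarrow> k < e \<Longrightarrow> C t * K k = c t k \<cdot>\<^sub>m 1\<^sub>m d"
    "(\<Sum>t<e + n. \<Sum>k<e. (cmod (c t k))\<^sup>2) = 1"
    using recovery_kraus[of e K n d \<rho>_E T \<mu>, OF Kd d_pos decoupled_imp_knill_laflamme[OF assms(2)] T] by blast
  define M where "M = (\<lambda>t. C (t div e) * K (t mod e))"
  have M: "dim_row (M t) = d" "dim_col (M t) = d" if "t < (e + n) * e" for t
    using div_mod_less[OF that] C by (simp_all add: M_def)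
  have E: "(kraus_map d (e + n) C \<circ> E1) X = kraus_map d ((e + n) * e) M X" if "X \<in> carrier_mat d d" for X
    using that kraus_map_compose[of "e + n" C d n e K d X] C realizes_kraus_map[OF assms(3) that] by (auto simp: M_def)
  have "entanglement_fidelity d \<psi> (kraus_map d (e + n) C \<circ> E1) =
      (\<Sum>t<(e + n) * e. (cmod (mat_trace (\<Psi> * transpose_mat (C (t div e) * K (t mod e)) * adj \<Psi>)))\<^sup>2)"
    using entanglement_fidelity_kraus[where E = "kraus_map d (e + n) C \<circ> E1", OF M E] by (simp add: M_def)
  also have "\<dots> = (\<Sum>t<e + n. \<Sum>k<e. (cmod (mat_trace (\<Psi> * transpose_mat (C t * K k) * adj \<Psi>)))\<^sup>2)"
    by (rule sum_div_mod)
  also have "\<dots> = (\<Sum>t<e + n. \<Sum>k<e. (cmod (c t k))\<^sup>2)"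
  proof (intro sum.cong refl)
    fix t k assume "t \<in> {..<e + n}" "k \<in> {..<e}"
    then have tk: "t < e + n" "k < e" by auto
    have "transpose_mat (c t k \<cdot>\<^sub>m 1\<^sub>m d) = c t k \<cdot>\<^sub>m 1\<^sub>m d" by (intro eq_matI) auto
    then have "mat_trace (\<Psi> * transpose_mat (C t * K k) * adj \<Psi>) = mat_trace (c t k \<cdot>\<^sub>m state_R)"
      using tk by (simp add: c(1) mult_smult_dim state_R_def)
    also have "\<dots> = c t k * mat_trace state_R" by (simp add: mat_trace_def sum_distrib_left)
    finally show "(cmod (mat_trace (\<Psi> * transpose_mat (C t * K k) * adj \<Psi>)))\<^sup>2 = (cmod (c t k))\<^sup>2"
      by (simp add: trace_state_R)
  qed
  finally have "entanglement_fidelity d \<psi> (kraus_map d (e + n) C \<circ> E1) = 1" by (simp add: c(2))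
  moreover have "cptp n d (kraus_map d (e + n) C)" by (rule cptp_kraus_map[OF C])
  ultimately show ?thesis by blast
qed

text \<open>Fidelity one makes every \<open>C t * K k\<close> scalar. Completeness of the recovery
  operators then writes \<open>adj (K l) * K k\<close> as a sum of products of such scalars.\<close>

lemma recovery_imp_decoupled:
  assumes "cptp n d E2" "realizes d n e V E1" "entanglement_fidelity d \<psi> (E2 \<circ> E1) = 1"
  shows "\<rho>_RE = kron state_R \<rho>_E"
proof -
  define L where "L = n * d"
  obtain C where C: "\<And>t. t < L \<Longrightarrow> dim_row (C t) = d" "\<And>t. t < L \<Longrightarrow> dim_col (C t) = n"
    and E2: "\<And>X. X \<in> carrier_mat n n \<Longrightarrow> E2 X = kraus_map d L C X"
    and C1: "mat_sum n n L (\<lambda>t. adj (C t) * C t) = 1\<^sub>m n"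
    using kraus_exists[OF assms(1)] unfolding L_def by metis
  define M where "M = (\<lambda>t. C (t div e) * K (t mod e))"
  have M: "dim_row (M t) = d" "dim_col (M t) = d" if "t < L * e" for t
    using div_mod_less[OF that] C by (simp_all add: M_def)
  have E: "(E2 \<circ> E1) X = kraus_map d (L * e) M X" if X: "X \<in> carrier_mat d d" for X
  proof -
    have "kraus_map n e K X \<in> carrier_mat n n" by (rule carrier_matI) (simp_all add: kraus_map_def)
    then show ?thesis
      using X kraus_map_compose[of L C d n e K d X] C realizes_kraus_map[OF assms(2) X] E2 by (auto simp: M_def)
  qed
  have F: "(\<Sum>t<L * e. (cmod (mat_trace (\<Psi> * transpose_mat (M t) * adj \<Psi>)))\<^sup>2) = 1"
    using entanglement_fidelity_kraus[where E = "E2 \<circ> E1", OF M E] assms(3) by simp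
  have gram_CK: "mat_sum d d L (\<lambda>t. adj (C t * K l) * (C t * K k)) = adj (K l) * K k" for k l
    using gram_kraus_mult[of L C d n "K l" "K k"] C C1 by simp
  have gram_M: "mat_sum d d (L * e) (\<lambda>t. adj (M t) * M t) = 1\<^sub>m d" (is "?L = _")
  proof (rule eq_mat_dimI[of d d])
    fix i j assume ij: "i < d" "j < d"
    have "(\<Sum>t<L * e. (adj (M t) * M t) $$ (i, j)) = (\<Sum>t<L. \<Sum>k<e. (adj (C t * K k) * (C t * K k)) $$ (i, j))"
      unfolding M_def by (rule sum_div_mod)
    also have "\<dots> = (\<Sum>k<e. \<Sum>t<L. (adj (C t * K k) * (C t * K k)) $$ (i, j))" by (rule sum.swap)
    also have "\<dots> = (\<Sum>k<e. (adj (K k) * K k) $$ (i, j))"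
      using ij by (simp add: gram_CK[symmetric] mat_sum_index)
    also have "\<dots> = 1\<^sub>m d $$ (i, j)"
      using ij by (simp add: K_complete[symmetric] mat_sum_index del: index_one_mat)
    finally show "?L $$ (i, j) = 1\<^sub>m d $$ (i, j)"
      using ij by (simp add: mat_sum_index)
  qed auto
  have scalar: "M t = mat_trace (\<Psi> * transpose_mat (M t) * adj \<Psi>) \<cdot>\<^sub>m 1\<^sub>m d" if "t < L * e" for t
    using fidelity_one_imp_scalar[of "L * e" M t] M gram_M F that by blast
  define c where "c = (\<lambda>t k. mat_trace (\<Psi> * transpose_mat (C t * K k) * adj \<Psi>))"
  have CK: "C t * K k = c t k \<cdot>\<^sub>m 1\<^sub>m d" if "t < L" "k < e" for t k
    using scalar[OF index_less[OF that]] that by (simp add: M_def c_def)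
  have "adj (K l) * K k = (\<Sum>t<L. cnj (c t l) * c t k) \<cdot>\<^sub>m 1\<^sub>m d" if "k < e" "l < e" for k l
  proof -
    have "adj (K l) * K k = mat_sum d d L (\<lambda>t. (cnj (c t l) * c t k) \<cdot>\<^sub>m 1\<^sub>m d)"
      unfolding gram_CK[symmetric]
      by (rule mat_sum_cong) (use that in \<open>auto simp: CK adj_smult mult_smult_dim intro!: eq_matI\<close>)
    also have "\<dots> = (\<Sum>t<L. cnj (c t l) * c t k) \<cdot>\<^sub>m 1\<^sub>m d"
      by (intro eq_matI) (auto simp: mat_sum_index)
    finally show ?thesis .
  qed
  then show ?thesis by (rule knill_laflamme_imp_decoupled)
qed

end

section \<open>Composition of two channels\<close>

context purified_state
begin

text \<open>Discarding the second environment returns the joint state after the first channel, both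
  with and without the reference, so monotonicity under a partial trace applies.\<close>

theorem coherent_info_compose_le:
  assumes "operator_convex_on I f" "realizes d d' e1 V1 E1" "realizes d' d'' e2 V2 E2"
    and "coherent_admissible I d d' e1 \<psi> V1"
    and "coherent_admissible I d d'' (e2 * e1) \<psi> (compose_isometry e1 V2 V1)"
  shows "f_coherent_info f d d'' (e2 * e1) \<psi> (compose_isometry e1 V2 V1) \<le> f_coherent_info f d d' e1 \<psi> V1"
proof -
  define V where "V = compose_isometry e1 V2 V1"
  have V1: "dim_row V1 = d' * e1" "dim_col V1 = d" "adj V1 * V1 = 1\<^sub>m d"
    and V2: "dim_row V2 = d'' * e2" "dim_col V2 = d'" "adj V2 * V2 = 1\<^sub>m d'"
    using assms(2,3) by (auto simp: realizes_def)
  have V: "dim_row V = d'' * (e2 * e1)" "dim_col V = d"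
    by (simp_all add: V_def compose_isometry_def V1 V2 mult.assoc)
  interpret mid: index_splitting "d * (e2 * e1)" "d * e1" e2 "\<lambda>a. a div e1 mod e2" "\<lambda>a. a div (e2 * e1) * e1 + a mod e1"
    "\<lambda>k i. i div e1 * (e2 * e1) + (k * e1 + i mod e1)"
    by (rule index_splitting_middle)
  define K1 where "K1 = kraus_of d' e1 V1"
  define K2 where "K2 = kraus_of d'' e2 V2"
  have Kd: "dim_row (K1 l) = d'" "dim_col (K1 l) = d" "dim_row (K2 k) = d''" "dim_col (K2 k) = d'" for k l
    by (simp_all add: K1_def K2_def V1 V2)
  \<comment> \<open>Summing over the outcomes of the second channel removes it from the Gram
    products, and with it from the joint state.\<close>
  have gram_K: "mat_sum d d e2 (\<lambda>k. adj (K2 k * K1 l') * (K2 k * K1 l)) = adj (K1 l') * K1 l" for l l'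
    using gram_kraus_mult[of e2 K2 d'' d' "K1 l'" "K1 l"] kraus_of_complete[OF V2] by (simp add: Kd K2_def[symmetric])
  have reduce_RE: "mid.reduce (state_RE d d'' (e2 * e1) \<psi> V) = state_RE d d' e1 \<psi> V1" (is "_ = ?R")
  proof (rule eq_mat_dimI[of "d * e1" "d * e1"])
    fix i i' assume i: "i < d * e1" "i' < d * e1"
    note dm = div_mod_less[OF i(1)] div_mod_less[OF i(2)]
    let ?G = "\<lambda>k. transpose_mat (adj (K2 k * K1 (i' mod e1)) * (K2 k * K1 (i mod e1)))"
    have "mid.reduce (state_RE d d'' (e2 * e1) \<psi> V) $$ (i, i') =
        (\<Sum>k<e2. (\<Psi> * ?G k * adj \<Psi>) $$ (i div e1, i' div e1))"
      unfolding mid.reduce_index[OF state_RE_dim i]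
    proof (rule sum.cong, rule refl)
      fix k assume "k \<in> {..<e2}"
      then have k: "k < e2" by simp
      note idx = mid.join(1)[OF k i(1)] mid.join(1)[OF k i(2)]
      show "state_RE d d'' (e2 * e1) \<psi> V $$ (i div e1 * (e2 * e1) + (k * e1 + i mod e1), i' div e1 * (e2 * e1) + (k * e1 + i' mod e1)) =
          (\<Psi> * ?G k * adj \<Psi>) $$ (i div e1, i' div e1)"
        unfolding state_RE_index[OF psi_dim V idx] middle_index[OF k dm(2)] middle_index[OF k dm(4)]
        by (simp add: V_def kraus_of_compose[OF V1(1,2) V2(1,2) k] dm K1_def K2_def)
    qed
    also have "\<dots> = mat_sum d d e2 (\<lambda>k. \<Psi> * ?G k * adj \<Psi>) $$ (i div e1, i' div e1)"
      using dm by (simp add: mat_sum_index)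
    also have "mat_sum d d e2 (\<lambda>k. \<Psi> * ?G k * adj \<Psi>) = \<Psi> * mat_sum d d e2 ?G * adj \<Psi>"
      by (simp add: mat_sum_mult_left mat_sum_mult_right Kd)
    also have "mat_sum d d e2 ?G = transpose_mat (adj (K1 (i' mod e1)) * K1 (i mod e1))"
      unfolding gram_K[symmetric] by (rule mat_sum_transpose[symmetric]) (simp_all add: Kd)
    finally show "mid.reduce (state_RE d d'' (e2 * e1) \<psi> V) $$ (i, i') = ?R $$ (i, i')"
      unfolding state_RE_index[OF psi_dim V1(1,2) i] K1_def .
  qed auto
  \<comment> \<open>The environment states are partial traces of the joint states over the
    reference, so this follows from \<open>reduce_RE\<close> by exchanging the two partial
    traces.\<close>
  have E: "(\<Sum>k<e2. state_E d d'' (e2 * e1) \<psi> V $$ (k * e1 + l, k * e1 + l')) = state_E d d' e1 \<psi> V1 $$ (l, l')"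
    if l: "l < e1" "l' < e1" for l l'
  proof -
    have "(\<Sum>k<e2. state_E d d'' (e2 * e1) \<psi> V $$ (k * e1 + l, k * e1 + l')) =
        (\<Sum>k<e2. \<Sum>r<d. state_RE d d'' (e2 * e1) \<psi> V $$ (r * (e2 * e1) + (k * e1 + l), r * (e2 * e1) + (k * e1 + l')))"
      using l by (simp add: state_E_index)
    also have "\<dots> = (\<Sum>r<d. \<Sum>k<e2. state_RE d d'' (e2 * e1) \<psi> V $$ (r * (e2 * e1) + (k * e1 + l), r * (e2 * e1) + (k * e1 + l')))"
      by (rule sum.swap)
    also have "\<dots> = (\<Sum>r<d. mid.reduce (state_RE d d'' (e2 * e1) \<psi> V) $$ (r * e1 + l, r * e1 + l'))"
      using l by (intro sum.cong) (simp_all add: mid.reduce_index)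
    finally show ?thesis using l by (simp add: reduce_RE state_E_index)
  qed
  have reduce_E: "mid.reduce (kron (1\<^sub>m d) (state_E d d'' (e2 * e1) \<psi> V)) = kron (1\<^sub>m d) (state_E d d' e1 \<psi> V1)" (is "_ = ?R")
  proof (rule eq_mat_dimI[of "d * e1" "d * e1"])
    fix i i' assume i: "i < d * e1" "i' < d * e1"
    note dm = div_mod_less[OF i(1)] div_mod_less[OF i(2)]
    have "mid.reduce (kron (1\<^sub>m d) (state_E d d'' (e2 * e1) \<psi> V)) $$ (i, i') =
        (\<Sum>k<e2. kron (1\<^sub>m d) (state_E d d'' (e2 * e1) \<psi> V) $$
          (i div e1 * (e2 * e1) + (k * e1 + i mod e1), i' div e1 * (e2 * e1) + (k * e1 + i' mod e1)))"
      by (rule mid.reduce_index) (simp_all add: i)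
    also have "\<dots> = (\<Sum>k<e2. 1\<^sub>m d $$ (i div e1, i' div e1) * state_E d d'' (e2 * e1) \<psi> V $$ (k * e1 + i mod e1, k * e1 + i' mod e1))"
    proof (rule sum.cong, rule refl)
      fix k assume "k \<in> {..<e2}"
      then have k: "k < e2" by simp
      note idx = mid.join(1)[OF k i(1)] mid.join(1)[OF k i(2)]
      show "kron (1\<^sub>m d) (state_E d d'' (e2 * e1) \<psi> V) $$
          (i div e1 * (e2 * e1) + (k * e1 + i mod e1), i' div e1 * (e2 * e1) + (k * e1 + i' mod e1)) =
          1\<^sub>m d $$ (i div e1, i' div e1) * state_E d d'' (e2 * e1) \<psi> V $$ (k * e1 + i mod e1, k * e1 + i' mod e1)"
        by (subst kron_index) (simp_all only: state_E_dim index_one_mat(2,3) idx middle_index[OF k dm(2)] middle_index[OF k dm(4)])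
    qed
    also have "\<dots> = 1\<^sub>m d $$ (i div e1, i' div e1) * state_E d d' e1 \<psi> V1 $$ (i mod e1, i' mod e1)"
      by (simp only: sum_distrib_left[symmetric] E[OF dm(2,4)])
    also have "\<dots> = ?R $$ (i, i')"
      using i by (simp add: kron_index)
    finally show "mid.reduce (kron (1\<^sub>m d) (state_E d d'' (e2 * e1) \<psi> V)) $$ (i, i') =
        ?R $$ (i, i')" .
  qed auto
  have "strictly_pos (d * e1) (state_RE d d' e1 \<psi> V1)"
    using assms(4) by (simp add: coherent_admissible_def admissible_def)
  then show ?thesis
    using mid.data_processing[OF assms(1) assms(5)[folded V_def, unfolded coherent_admissible_def]]
    by (simp add: f_coherent_info_def reduce_RE reduce_E V_def[symmetric])
qed

end

theorem lemma10:
  fixes f :: "real \<Rightarrow> real" and I :: "real set" and \<alpha> :: real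
    and d d' e1 :: nat
    and \<rho> V1 :: "complex mat" and \<psi> :: "complex Matrix.vec"
    and E1 :: "complex mat \<Rightarrow> complex mat"
  assumes "is_interval I" and "I \<subseteq> {0<..<\<alpha>}"
    and "operator_convex_on I f"
    and "density_matrix d \<rho>" and "strictly_pos d \<rho>"
    and "purification d \<psi> \<rho>"
    and "cptp d d' E1" and "realizes d d' e1 V1 E1"
    and "admissible I d \<rho> (1\<^sub>m d)"
    and "coherent_admissible I d d' e1 \<psi> V1"
  shows "f_entropy f \<rho> \<ge> f_coherent_info f d d' e1 \<psi> V1 \<and>
    (\<forall>d'' e2 V2 E2.
        cptp d' d'' E2 \<and> realizes d' d'' e2 V2 E2 \<and>
        coherent_admissible I d d'' (e2 * e1) \<psi> (compose_isometry e1 V2 V1) \<longrightarrow>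
        f_coherent_info f d d' e1 \<psi> V1
          \<ge> f_coherent_info f d d'' (e2 * e1) \<psi> (compose_isometry e1 V2 V1)) \<and>
    (\<not> affine_fun_on I f \<and> diffused_on I f \<longrightarrow>
        (f_entropy f \<rho> = f_coherent_info f d d' e1 \<psi> V1 \<longleftrightarrow>
          (\<exists>E2. cptp d' d E2 \<and> entanglement_fidelity d \<psi> (E2 \<circ> E1) = 1)))"
proof -
  interpret purified_channel d \<psi> \<rho> d' e1 V1
    using assms(4-6,8) by unfold_locales (auto simp: realizes_def)
  have "f_entropy f \<rho> \<ge> f_coherent_info f d d' e1 \<psi> V1"
    using coherent_info_le_entropy[OF assms(3,10)] .
  moreover have "f_coherent_info f d d' e1 \<psi> V1
          \<ge> f_coherent_info f d d'' (e2 * e1) \<psi> (compose_isometry e1 V2 V1)"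
    if "realizes d' d'' e2 V2 E2"
      "coherent_admissible I d d'' (e2 * e1) \<psi> (compose_isometry e1 V2 V1)" for d'' e2 V2 E2
    using coherent_info_compose_le[OF assms(3,8) that(1) assms(10) that(2)] .
  \<comment> \<open>Both directions pass through the product form of the joint state of reference
    and environment.\<close>
  moreover have "f_entropy f \<rho> = f_coherent_info f d d' e1 \<psi> V1 \<longleftrightarrow>
      (\<exists>E2. cptp d' d E2 \<and> entanglement_fidelity d \<psi> (E2 \<circ> E1) = 1)"
    if "diffused_on I f"
    using entropy_eq_imp_decoupled[OF that assms(9,10)] decoupled_imp_recovery[OF assms(10) _ assms(8)]
      recovery_imp_decoupled[OF _ assms(8)] decoupled_imp_entropy_eq[OF assms(10)] by blast
  ultimately show ?thesis by blast
qed

end
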